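(* Let $A$ and $B$ be the operators of the SABRA shell model described in the context, with $\beta=1$. For any $\nu>0$, there exists a $\mu^{1,\nu}$-stationary process (that is, a stationary process indexed by $t\in\mathbb R$ whose law at any fixed time is $\mu^{1,\nu}$), whose paths solve the deterministic inviscid equation $$\frac{du}{dt}(t)+B(u(t),u(t))=0$$ $\mathbb P$-a.s. In particular, the paths are in $C^\delta(\mathbb R;H^\alpha)$ (for any $0\le\delta<\frac12$ and $\alpha<1$).
   Context: SABRA shell model. $H=\{u=(u_1,u_2,\dots)\in(\mathbb R^2)^\infty:\sum_{n\ge1}|u_n|^2<\infty\}$, with $u_n=(u_{n,1},u_{n,2})\in\mathbb R^2$, $|\cdot|$ the Euclidean norm and $x\cdot y$ the Euclidean scalar product in $\mathbb R^2$. Fix $k_0>0$, $\lambda>1$; put $\lambda_n=k_0^2\lambda^{2n}$ and $k_n=\sqrt{\lambda_n}=k_0\lambda^n$. $A$ is the diagonal operator $(Au)_n=\lambda_nu_n$. For $\alpha\in\mathbb R$, $H^\alpha=D(A^{\alpha/2})$ with norm $\|u\|_\alpha^2=\sum_n\lambda_n^\alpha|u_n|^2$. $\mu^{1,\nu}=\mathcal N(0,\frac1\nu A^{-1})$ is the centered Gaussian measure under which all the real components $x_{n,1},x_{n,2}$ are independent, with law $\mathcal N(0,\frac1{\nu\lambda_n})$; it gives full measure to $H^\alpha$ for every $\alpha<1$. The real numbers $a,b$ satisfy $a+b\lambda^{2}=(a+b)\lambda^{4}$, that is $\lambda^{2}=-\frac a{a+b}$ (this is the case $\beta=1$ of the general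 condition $\lambda^{2\beta}=-\frac{a}{a+b}$). The bilinear operator $B$ has components $B_n=(B_{n,1},B_{n,2})$ given, with the convention that $u_m=v_m=0$ for $m\le0$, for every $n\ge1$ by $$\begin{aligned}B_{n,1}(u,v)=\;&ak_{n+1}[-u_{n+1,2}v_{n+2,1}+u_{n+1,1}v_{n+2,2}]+bk_n[-u_{n-1,2}v_{n+1,1}+u_{n-1,1}v_{n+1,2}]\\&+ak_{n-1}[u_{n-1,2}v_{n-2,1}+u_{n-1,1}v_{n-2,2}]+bk_{n-1}[u_{n-2,2}v_{n-1,1}+u_{n-2,1}v_{n-1,2}],\end{aligned}$$ $$\begin{aligned}B_{n,2}(u,v)=\;&-ak_{n+1}[u_{n+1,1}v_{n+2,1}+u_{n+1,2}v_{n+2,2}]-bk_n[u_{n-1,1}v_{n+1,1}+u_{n-1,2}v_{n+1,2}]\\&-ak_{n-1}[u_{n-1,1}v_{n-2,1}-u_{n-1,2}v_{n-2,2}]-bk_{n-1}[u_{n-2,1}v_{n-1,1}-u_{n-2,2}v_{n-1,2}].\end{aligned}$$ A path $u$ solves the inviscid equation if $u(t)=u(s)-\int_s^tB(u(r),u(r))\,dr$ for all $s\le t$ in $\mathbb R$. $C^\delta(\mathbb R;H^\alpha)$ denotes the space of functions $\mathbb R\to H^\alpha$ that are $\delta$-Hölder continuous (continuous, if $\delta=0$) on each bounded interval. The underlying probability space, with probability $\mathbb P$, is part of what is to be constructed. *)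

theory Defs
  imports "HOL-Probability.Probability"
begin

text \<open>
  A state \<open>u = (u\<^sub>1, u\<^sub>2, \<dots>) \<in> (\<real>\<^sup>2)\<^sup>\<infinity>\<close> is a function on \<open>{1..}\<close>; the value at index 0 is never used
  (elements of \<open>space states\<close> are \<open>undefined\<close> there).
\<close>

type_synonym state = "nat \<Rightarrow> real^2"

text \<open>
  The product sigma-algebra on \<open>(\<real>\<^sup>2)\<^sup>\<infinity>\<close>. Its trace on each of the separable Hilbert spaces
  \<open>H\<^sup>\<alpha>\<close> below is the Borel sigma-algebra of \<open>H\<^sup>\<alpha>\<close>.
\<close>

definition states :: "state measure" where
  "states = PiM {1..} (\<lambda>_. borel)"

definition lambda_seq :: "real \<Rightarrow> real \<Rightarrow> nat \<Rightarrow> real" where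
  "lambda_seq k0 lam n = k0^2 * lam^(2 * n)"

definition k_seq :: "real \<Rightarrow> real \<Rightarrow> nat \<Rightarrow> real" where
  "k_seq k0 lam n = sqrt (lambda_seq k0 lam n)"

text \<open>
  \<open>H\<^sup>\<alpha> = D(A\<^bsup>\<alpha>/2\<^esup>)\<close> for \<open>(Au)\<^sub>n = \<lambda>\<^sub>n u\<^sub>n\<close>, and its norm; \<open>H\<close> itself is the case \<open>\<alpha> = 0\<close>.
  For \<open>\<alpha> < 0\<close> this is a space of sequences that is larger than \<open>H\<close>.
  The norm is meaningful only on members of \<open>Hsp k0 lam \<alpha>\<close>.
\<close>

definition Hsp :: "real \<Rightarrow> real \<Rightarrow> real \<Rightarrow> state set" where
  "Hsp k0 lam \<alpha> =
     {u. summable (\<lambda>n. lambda_seq k0 lam (Suc n) powr \<alpha> * (norm (u (Suc n)))^2)}"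

definition Hnorm :: "real \<Rightarrow> real \<Rightarrow> real \<Rightarrow> state \<Rightarrow> real" where
  "Hnorm k0 lam \<alpha> u =
     sqrt (\<Sum>n. lambda_seq k0 lam (Suc n) powr \<alpha> * (norm (u (Suc n)))^2)"

text \<open>The real component \<open>u\<^bsub>m,i\<^esub>\<close>, with the convention \<open>u\<^sub>m = 0\<close> for \<open>m \<le> 0\<close>.\<close>

definition cmp :: "state \<Rightarrow> int \<Rightarrow> 2 \<Rightarrow> real" where
  "cmp u m i = (if m \<ge> 1 then u (nat m) $ i else 0)"

definition B1 :: "real \<Rightarrow> real \<Rightarrow> real \<Rightarrow> real \<Rightarrow> state \<Rightarrow> state \<Rightarrow> nat \<Rightarrow> real" where
  "B1 k0 lam a b u v n = (let k = k_seq k0 lam; m = int n in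
       a * k (n+1) * (- cmp u (m+1) 2 * cmp v (m+2) 1 + cmp u (m+1) 1 * cmp v (m+2) 2)
     + b * k n     * (- cmp u (m-1) 2 * cmp v (m+1) 1 + cmp u (m-1) 1 * cmp v (m+1) 2)
     + a * k (n-1) * (  cmp u (m-1) 2 * cmp v (m-2) 1 + cmp u (m-1) 1 * cmp v (m-2) 2)
     + b * k (n-1) * (  cmp u (m-2) 2 * cmp v (m-1) 1 + cmp u (m-2) 1 * cmp v (m-1) 2))"

definition B2 :: "real \<Rightarrow> real \<Rightarrow> real \<Rightarrow> real \<Rightarrow> state \<Rightarrow> state \<Rightarrow> nat \<Rightarrow> real" where
  "B2 k0 lam a b u v n = (let k = k_seq k0 lam; m = int n in
     - a * k (n+1) * (cmp u (m+1) 1 * cmp v (m+2) 1 + cmp u (m+1) 2 * cmp v (m+2) 2)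
     - b * k n     * (cmp u (m-1) 1 * cmp v (m+1) 1 + cmp u (m-1) 2 * cmp v (m+1) 2)
     - a * k (n-1) * (cmp u (m-1) 1 * cmp v (m-2) 1 - cmp u (m-1) 2 * cmp v (m-2) 2)
     - b * k (n-1) * (cmp u (m-2) 1 * cmp v (m-1) 1 - cmp u (m-2) 2 * cmp v (m-1) 2))"

definition B :: "real \<Rightarrow> real \<Rightarrow> real \<Rightarrow> real \<Rightarrow> state \<Rightarrow> state \<Rightarrow> state" where
  "B k0 lam a b u v =
     (\<lambda>n\<in>{1..}. vector [B1 k0 lam a b u v n, B2 k0 lam a b u v n])"

text \<open>
  The centered Gaussian measure \<open>N(0, \<nu>\<^bsup>-1\<^esup> A\<^bsup>-1\<^esup>)\<close>: independent real components with
  variances \<open>1 / (\<nu> \<lambda>\<^sub>n)\<close> (\<open>normal_density\<close> takes the standard deviation).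
\<close>

definition gibbs :: "real \<Rightarrow> real \<Rightarrow> real \<Rightarrow> state measure" where
  "gibbs k0 lam \<nu> =
     distr
       (PiM ({1..} \<times> (UNIV :: 2 set))
          (\<lambda>(n, i). density lborel (normal_density 0 (sqrt (1 / (\<nu> * lambda_seq k0 lam n))))))
       states
       (\<lambda>x. \<lambda>n\<in>{1..}. \<chi> i. x (n, i))"

text \<open>Strict stationarity: all finite-dimensional distributions are invariant under time shifts.\<close>

definition stationary_process ::
    "'w measure \<Rightarrow> 's measure \<Rightarrow> (real \<Rightarrow> 'w \<Rightarrow> 's) \<Rightarrow> bool" where
  "stationary_process M S X \<longleftrightarrow>
     (\<forall>t. X t \<in> measurable M S) \<and>
     (\<forall>J h. finite J \<longrightarrow>
        distr M (PiM J (\<lambda>_. S)) (\<lambda>\<omega>. \<lambda>t\<in>J. X (t + h) \<omega>) =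
        distr M (PiM J (\<lambda>_. S)) (\<lambda>\<omega>. \<lambda>t\<in>J. X t \<omega>))"

text \<open>
  \<open>y = \<integral>\<^sub>s\<^sup>t f(r) dr\<close> as a Bochner integral in \<open>H\<close>. Since \<open>H\<close> is separable, strong measurability
  amounts to measurability of the components, Bochner integrability adds integrability of the
  \<open>H\<close>-norm, and the value of the integral is determined by its components.
\<close>

definition has_H_integral ::
    "real \<Rightarrow> real \<Rightarrow> (real \<Rightarrow> state) \<Rightarrow> state \<Rightarrow> real \<Rightarrow> real \<Rightarrow> bool" where
  "has_H_integral k0 lam f y s t \<longleftrightarrow>
     (\<forall>r\<in>{s..t}. f r \<in> Hsp k0 lam 0) \<and>
     set_integrable lborel {s..t} (\<lambda>r. Hnorm k0 lam 0 (f r)) \<and>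
     (\<forall>n\<ge>1. set_integrable lborel {s..t} (\<lambda>r. f r n) \<and>
            y n = (LINT r:{s..t}|lborel. f r n))"

definition solves_inviscid ::
    "real \<Rightarrow> real \<Rightarrow> real \<Rightarrow> real \<Rightarrow> (real \<Rightarrow> state) \<Rightarrow> bool" where
  "solves_inviscid k0 lam a b u \<longleftrightarrow>
     (\<forall>s t. s \<le> t \<longrightarrow>
        (\<exists>I. has_H_integral k0 lam (\<lambda>r. B k0 lam a b (u r) (u r)) I s t \<and>
             (\<forall>n\<ge>1. u t n = u s n - I n)))"

text \<open>\<open>C\<^sup>\<delta>(\<real>; H\<^sup>\<alpha>)\<close>, for \<open>\<delta> \<ge> 0\<close>.\<close>

definition holder_paths :: "real \<Rightarrow> real \<Rightarrow> real \<Rightarrow> real \<Rightarrow> (real \<Rightarrow> state) set" where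
  "holder_paths k0 lam \<delta> \<alpha> =
     {u. (\<forall>t. u t \<in> Hsp k0 lam \<alpha>) \<and>
         (if \<delta> = 0
          then \<forall>t. ((\<lambda>s. Hnorm k0 lam \<alpha> (\<lambda>n. u s n - u t n)) \<longlongrightarrow> 0) (at t)
          else \<forall>S T. \<exists>C. \<forall>s\<in>{S..T}. \<forall>t\<in>{S..T}.
                 Hnorm k0 lam \<alpha> (\<lambda>n. u t n - u s n) \<le> C * \<bar>t - s\<bar> powr \<delta>)}"

end

theory Submission
  imports Defs "HOL-Real_Asymp.Real_Asymp" "HOL-Analysis.Function_Metric"
begin

text \<open>
  Put \<open>u\<^sub>n = y\<^sub>n / (k\<^sub>n \<surd>\<nu>)\<close>. Under \<open>N(0, \<nu>\<^sup>-\<^sup>1 A\<^sup>-\<^sup>1)\<close> the real components of \<open>y\<close> are independent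
  standard Gaussian variables, white noise on a one-dimensional lattice, and for \<open>\<beta> = 1\<close> the equation
  for \<open>y\<close> has quadratic interactions of finite range with coefficients that do not depend on the
  shell. The relation between \<open>a\<close>, \<open>b\<close> and \<open>\<lambda>\<close> says that the coefficients of every real triad
  \<open>(x, y, z)\<close> add up to zero. Therefore the vector field is a sum of elementary fields, each of which
  rotates a plane \<open>(x, z)\<close> with an angular speed proportional to a third coordinate \<open>y\<close>. The flow of
  one elementary field is explicit and preserves white noise.

  The solution is constructed on the probability space of the initial condition itself. At level \<open>l\<close>
  the time step is \<open>2\<^sup>-\<^sup>l\<close>, and one step composes the flows of finitely many elementary fields, whose
  number is of order \<open>l\<close>. All intermediate states are white noise, so the union bound over these
  states, in about \<open>2\<^sup>l\<close> steps, and the lemma of Borel and Cantelli show that almost surely all coordinates in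
  question stay below \<open>\<surd>(8 l)\<close> on a given time interval (\<open>AE_tame_orbit\<close>). On this event two successive
  levels are compared by a Gronwall argument (\<open>orbit_refinement\<close>). The Lipschitz constant is of order
  \<open>\<surd>l\<close>. The consistency error \<open>2\<^sup>-\<^sup>l exp(c \<surd>l)\<close> is summable, and so is the influence \<open>(c \<surd>l)\<^sup>l / l!\<close> of
  those coordinates at distance of order \<open>l\<close> about which nothing is known. Hence the approximations
  converge almost surely in every coordinate, uniformly on bounded time intervals, and the limit \<open>flow\<close> solves the lattice
  equation in the classical sense (\<open>flow_derivative\<close>).

  The approximations form a group of transformations that preserve white noise. This makes them
  stationary along the dyadic grid, and stationarity passes to the limit (\<open>flow_stationary\<close>).
  Finally the coordinates of the limit grow at most linearly with the site, so after division by
  \<open>k\<^sub>n\<close> the path and its derivative are bounded in \<open>H\<^sup>\<alpha>\<close> for every \<open>\<alpha> < 1\<close> on bounded time intervals;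
  the paths are locally Lipschitz in \<open>H\<^sup>\<alpha>\<close>.
\<close>

section \<open>Gaussian white noise and its rotations\<close>

text \<open>
  Planar rotations preserve Lebesgue measure. For a nontrivial sine this is Fubini's theorem with two
  affine substitutions; the remaining rotations are \<open>\<plusminus>id\<close>.
\<close>

lemma nn_integral_lborel_rotation:
  fixes c s :: real and G :: "real \<times> real \<Rightarrow> ennreal"
  assumes [measurable]: "G \<in> borel_measurable borel" and cs: "c\<^sup>2 + s\<^sup>2 = 1"
  shows "(\<integral>\<^sup>+a. \<integral>\<^sup>+b. G (c * a - s * b, s * a + c * b) \<partial>lborel \<partial>lborel)
       = (\<integral>\<^sup>+a. \<integral>\<^sup>+b. G (a, b) \<partial>lborel \<partial>lborel)"
proof (cases "s = 0")
  case True
  have reflect: "(\<integral>\<^sup>+b. F (c * b) \<partial>lborel) = (\<integral>\<^sup>+b. F b \<partial>lborel)"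
    if [measurable]: "F \<in> borel_measurable borel" for F :: "real \<Rightarrow> ennreal"
  proof -
    have "\<bar>c\<bar> = 1" "c \<noteq> 0"
      using True cs by (auto simp: power2_eq_1_iff)
    then show ?thesis
      using nn_integral_real_affine[of F c 0] by simp
  qed
  have "(\<integral>\<^sup>+a. \<integral>\<^sup>+b. G (c * a, c * b) \<partial>lborel \<partial>lborel) = (\<integral>\<^sup>+a. \<integral>\<^sup>+b. G (c * a, b) \<partial>lborel \<partial>lborel)"
    by (intro nn_integral_cong reflect) simp
  also have "\<dots> = (\<integral>\<^sup>+a. \<integral>\<^sup>+b. G (a, b) \<partial>lborel \<partial>lborel)"
    by (rule reflect[of "\<lambda>a. \<integral>\<^sup>+b. G (a, b) \<partial>lborel"]) measurable
  finally show ?thesis using True by simp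
next
  case False
  have scale: "ennreal \<bar>1 / s\<bar> * (\<integral>\<^sup>+b. F ((b - p) / s) \<partial>lborel) = (\<integral>\<^sup>+b. F b \<partial>lborel)"
    if [measurable]: "F \<in> borel_measurable borel" for F :: "real \<Rightarrow> ennreal" and p
    using nn_integral_real_affine[of F "1 / s" "- p / s"] False by (simp add: diff_divide_distrib add.commute)
  \<comment> \<open>For fixed \<open>a\<close> substitute \<open>u = c a - s b\<close>; then \<open>s a + c b = (a - c u) / s\<close>.\<close>
  have "(\<integral>\<^sup>+b. G (c * a - s * b, s * a + c * b) \<partial>lborel)
      = ennreal \<bar>1 / s\<bar> * (\<integral>\<^sup>+u. G (u, (a - c * u) / s) \<partial>lborel)" for a
  proof -
    have "s * a + c * (c * a / s + (- 1 / s) * u) = (a - c * u) / s" for u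
    proof -
      have "s * (s * a + c * (c * a / s + (- 1 / s) * u)) = (c\<^sup>2 + s\<^sup>2) * a - c * u"
        using False by (simp add: field_simps power2_eq_square)
      then show ?thesis using False cs by (metis mult_1 nonzero_mult_div_cancel_left)
    qed
    moreover have "c * a - s * (c * a / s + (- 1 / s) * u) = u" for u
      using False by (simp add: field_simps)
    ultimately show ?thesis
      using nn_integral_real_affine[of "\<lambda>b. G (c * a - s * b, s * a + c * b)" "- 1 / s" "c * a / s"] False
      by simp
  qed
  then have "(\<integral>\<^sup>+a. \<integral>\<^sup>+b. G (c * a - s * b, s * a + c * b) \<partial>lborel \<partial>lborel)
      = (\<integral>\<^sup>+a. \<integral>\<^sup>+u. ennreal \<bar>1 / s\<bar> * G (u, (a - c * u) / s) \<partial>lborel \<partial>lborel)"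
    by (simp add: nn_integral_cmult)
  also have "\<dots> = (\<integral>\<^sup>+u. \<integral>\<^sup>+a. ennreal \<bar>1 / s\<bar> * G (u, (a - c * u) / s) \<partial>lborel \<partial>lborel)"
    by (rule lborel_pair.Fubini') measurable
  also have "\<dots> = (\<integral>\<^sup>+u. \<integral>\<^sup>+b. G (u, b) \<partial>lborel \<partial>lborel)"
    using scale[of "\<lambda>b. G (_, b)"] by (simp add: nn_integral_cmult)
  finally show ?thesis .
qed

definition gauss :: "real measure" where
  "gauss = density lborel std_normal_density"

lemma sets_gauss [measurable_cong, simp]: "sets gauss = sets borel"
  and space_gauss [simp]: "space gauss = UNIV"
  by (auto simp: gauss_def)

lemma prob_space_gauss: "prob_space gauss"
  unfolding gauss_def by (rule prob_space_normal_density) simp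

interpretation gauss: prob_space gauss
  by (rule prob_space_gauss)

lemma nn_integral_gauss_rotation:
  fixes G :: "real \<times> real \<Rightarrow> ennreal"
  assumes [measurable]: "G \<in> borel_measurable borel"
  shows "(\<integral>\<^sup>+a. \<integral>\<^sup>+b. G (cos \<theta> * a - sin \<theta> * b, sin \<theta> * a + cos \<theta> * b) \<partial>gauss \<partial>gauss)
       = (\<integral>\<^sup>+a. \<integral>\<^sup>+b. G (a, b) \<partial>gauss \<partial>gauss)"
proof -
  define d where "d p = ennreal (std_normal_density (fst p) * std_normal_density (snd p))" for p :: "real \<times> real"
  have [measurable]: "d \<in> borel_measurable borel"
    unfolding d_def by (simp add: borel_prod[symmetric])
  have unfold_gauss: "(\<integral>\<^sup>+a. \<integral>\<^sup>+b. F a b \<partial>gauss \<partial>gauss)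
      = (\<integral>\<^sup>+a. \<integral>\<^sup>+b. d (a, b) * F a b \<partial>lborel \<partial>lborel)"
    if [measurable]: "case_prod F \<in> borel_measurable (borel \<Otimes>\<^sub>M borel)" for F :: "real \<Rightarrow> real \<Rightarrow> ennreal"
  proof -
    have "(\<integral>\<^sup>+a. \<integral>\<^sup>+b. F a b \<partial>gauss \<partial>gauss)
        = (\<integral>\<^sup>+a. ennreal (std_normal_density a) * (\<integral>\<^sup>+b. ennreal (std_normal_density b) * F a b \<partial>lborel) \<partial>lborel)"
      unfolding gauss_def by (simp add: nn_integral_density)
    then show ?thesis
      by (simp add: nn_integral_cmult[symmetric] d_def ennreal_mult mult.assoc)
  qed
  \<comment> \<open>The joint density depends on \<open>a\<^sup>2 + b\<^sup>2\<close> only.\<close>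
  have "d (cos \<theta> * a - sin \<theta> * b, sin \<theta> * a + cos \<theta> * b) = d (a, b)" for a b
  proof -
    have "(cos \<theta> * a - sin \<theta> * b)\<^sup>2 + (sin \<theta> * a + cos \<theta> * b)\<^sup>2
        = ((cos \<theta>)\<^sup>2 + (sin \<theta>)\<^sup>2) * (a\<^sup>2 + b\<^sup>2)"
      by algebra
    then have "(cos \<theta> * a - sin \<theta> * b)\<^sup>2 + (sin \<theta> * a + cos \<theta> * b)\<^sup>2 = a\<^sup>2 + b\<^sup>2"
      by simp
    then have "exp (- (cos \<theta> * a - sin \<theta> * b)\<^sup>2 / 2) * exp (- (sin \<theta> * a + cos \<theta> * b)\<^sup>2 / 2)
        = exp (- a\<^sup>2 / 2) * exp (- b\<^sup>2 / 2)"
      unfolding exp_add[symmetric] by (smt (verit) add_divide_distrib)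
    then show ?thesis
      by (simp add: d_def normal_density_def)
  qed
  moreover have meas: "(\<lambda>(a, b). G (cos \<theta> * a - sin \<theta> * b, sin \<theta> * a + cos \<theta> * b))
      \<in> borel_measurable (borel \<Otimes>\<^sub>M borel)"
    by measurable
  ultimately show ?thesis
    using nn_integral_lborel_rotation[of "\<lambda>p. d p * G p" "cos \<theta>" "sin \<theta>"]
      unfold_gauss[of "\<lambda>a b. G (a, b)"]
      unfold_gauss[of "\<lambda>a b. G (cos \<theta> * a - sin \<theta> * b, sin \<theta> * a + cos \<theta> * b)", OF meas]
    by (simp add: borel_prod split_beta')
qed

definition white_noise :: "(nat \<Rightarrow> real) measure" where
  "white_noise = PiM UNIV (\<lambda>_. gauss)"

lemma sets_white_noise [measurable_cong]: "sets white_noise = sets (PiM UNIV (\<lambda>_. borel))"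
  unfolding white_noise_def by (intro sets_PiM_cong) auto

lemma space_white_noise [simp]: "space white_noise = UNIV"
  by (auto simp: white_noise_def space_PiM)

lemma prob_space_white_noise: "prob_space white_noise"
  unfolding white_noise_def by (intro prob_space_PiM prob_space_gauss)

interpretation white_noise: prob_space white_noise
  by (rule prob_space_white_noise)

lemma measurable_coordinatewise:
  "(\<And>n. (\<lambda>\<omega>. f \<omega> n) \<in> borel_measurable M) \<Longrightarrow> f \<in> M \<rightarrow>\<^sub>M PiM UNIV (\<lambda>_. borel)"
  by (rule measurable_abs_UNIV[of "\<lambda>n \<omega>. f \<omega> n" M "\<lambda>_. borel"])

definition turn :: "nat \<Rightarrow> nat \<Rightarrow> real \<Rightarrow> (nat \<Rightarrow> real) \<Rightarrow> nat \<Rightarrow> real" where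
  "turn i j \<theta> x = x(i := cos \<theta> * x i - sin \<theta> * x j, j := sin \<theta> * x i + cos \<theta> * x j)"

lemma turn_first: "i \<noteq> j \<Longrightarrow> turn i j \<theta> x i = cos \<theta> * x i - sin \<theta> * x j"
  and turn_second: "turn i j \<theta> x j = sin \<theta> * x i + cos \<theta> * x j"
  and turn_other: "n \<noteq> i \<Longrightarrow> n \<noteq> j \<Longrightarrow> turn i j \<theta> x n = x n"
  by (auto simp: turn_def)

lemma turn_turn_minus:
  assumes "i \<noteq> j"
  shows "turn i j \<theta> (turn i j (- \<theta>) x) = x"
proof (rule ext)
  fix n
  have "cos \<theta> * (cos \<theta> * x i - - sin \<theta> * x j) - sin \<theta> * (- sin \<theta> * x i + cos \<theta> * x j)
      = ((sin \<theta>)\<^sup>2 + (cos \<theta>)\<^sup>2) * x i"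
    by algebra
  then have "turn i j \<theta> (turn i j (- \<theta>) x) i = x i"
    by (simp only: turn_first[OF assms] turn_second sin_minus cos_minus sin_cos_squared_add mult_1)
  moreover
  have "sin \<theta> * (cos \<theta> * x i - - sin \<theta> * x j) + cos \<theta> * (- sin \<theta> * x i + cos \<theta> * x j)
      = ((sin \<theta>)\<^sup>2 + (cos \<theta>)\<^sup>2) * x j"
    by algebra
  then have "turn i j \<theta> (turn i j (- \<theta>) x) j = x j"
    by (simp only: turn_first[OF assms] turn_second sin_minus cos_minus sin_cos_squared_add mult_1)
  ultimately show "turn i j \<theta> (turn i j (- \<theta>) x) n = x n"
    by (cases "n = i"; cases "n = j") (simp_all add: turn_other)
qed

lemma measurable_turn:
  assumes [measurable]: "\<theta> \<in> borel_measurable (PiM UNIV (\<lambda>_::nat. borel::real measure))"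
  shows "(\<lambda>x. turn i j (\<theta> x) x) \<in> PiM UNIV (\<lambda>_. borel) \<rightarrow>\<^sub>M PiM UNIV (\<lambda>_. borel)"
proof (rule measurable_coordinatewise)
  fix n
  let ?P = "PiM UNIV (\<lambda>_::nat. borel::real measure)"
  have c: "(\<lambda>x. x m) \<in> borel_measurable ?P" for m
    by (rule measurable_component_singleton) simp
  note trig = measurable_compose[OF assms borel_measurable_sin] measurable_compose[OF assms borel_measurable_cos]
  have "(\<lambda>x. sin (\<theta> x) * x i + cos (\<theta> x) * x j) \<in> borel_measurable ?P"
    by (rule borel_measurable_add; rule borel_measurable_times; (rule c | rule trig))
  moreover have "(\<lambda>x. cos (\<theta> x) * x i - sin (\<theta> x) * x j) \<in> borel_measurable ?P"
    by (rule borel_measurable_diff; rule borel_measurable_times; (rule c | rule trig))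
  ultimately show "(\<lambda>x. turn i j (\<theta> x) x n) \<in> borel_measurable ?P"
    using c[of n] by (cases "n = j"; cases "n = i") (simp_all only: turn_def fun_upd_apply if_True if_False simp_thms)
qed

text \<open>Two coordinates of white noise may be integrated first, with the others held fixed.\<close>

lemma nn_integral_white_noise_split:
  assumes ij: "i \<noteq> j" and [measurable]: "f \<in> borel_measurable (PiM UNIV (\<lambda>_::nat. borel::real measure))"
  shows "(\<integral>\<^sup>+x. f x \<partial>white_noise)
    = (\<integral>\<^sup>+X. (\<integral>\<^sup>+a. \<integral>\<^sup>+b. f (X(j := b, i := a)) \<partial>gauss \<partial>gauss) \<partial>PiM (UNIV - {i, j}) (\<lambda>_. gauss))"
proof -
  let ?I = "UNIV - {i, j}" and ?P = "\<lambda>I. PiM I (\<lambda>_::nat. gauss)"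
  interpret R: prob_space "?P ?I" by (intro prob_space_PiM prob_space_gauss)
  interpret R1: prob_space "?P (insert j ?I)" by (intro prob_space_PiM prob_space_gauss)
  interpret Q: pair_sigma_finite gauss "?P ?I" ..
  interpret Q1: pair_sigma_finite gauss "?P (insert j ?I)" ..
  have I: "insert i (insert j ?I) = UNIV" by auto
  have white: "sets (?P UNIV) = sets (PiM UNIV (\<lambda>_. borel))"
    by (intro sets_PiM_cong) auto
  have [measurable]: "f \<in> borel_measurable (?P UNIV)"
    using measurable_cong_sets[OF white refl] assms(2) by blast
  have upd1: "(\<lambda>(b, X). X(j := b)) \<in> gauss \<Otimes>\<^sub>M ?P ?I \<rightarrow>\<^sub>M ?P (insert j ?I)"
    unfolding split_beta' by (intro measurable_fun_upd[where J="?I"]) auto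
  have upd: "(\<lambda>(a, X). X(i := a)) \<in> gauss \<Otimes>\<^sub>M ?P (insert j ?I) \<rightarrow>\<^sub>M ?P UNIV"
    unfolding split_beta' by (intro measurable_fun_upd[where J="insert j ?I"]) (use I in auto)
  have f1: "(\<lambda>X. \<integral>\<^sup>+a. f (X(i := a)) \<partial>gauss) \<in> borel_measurable (?P (insert j ?I))"
  proof -
    have "(\<lambda>p. f ((snd p)(i := fst p))) \<in> borel_measurable (gauss \<Otimes>\<^sub>M ?P (insert j ?I))"
      using measurable_compose[OF upd, of f] by (simp add: split_beta')
    then have "(\<lambda>p. f ((fst p)(i := snd p))) \<in> borel_measurable (?P (insert j ?I) \<Otimes>\<^sub>M gauss)"
      by (subst (asm) measurable_pair_swap_iff) (simp add: split_beta')
    then show ?thesis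
      by (intro gauss.borel_measurable_nn_integral) (simp add: split_beta')
  qed
  have "(\<integral>\<^sup>+x. f x \<partial>white_noise)
      = (\<integral>\<^sup>+x. f x \<partial>distr (gauss \<Otimes>\<^sub>M ?P (insert j ?I)) (?P UNIV) (\<lambda>(a, X). X(i := a)))"
    using distr_pair_PiM_eq_PiM[of "insert j ?I" "\<lambda>_. gauss" i] unfolding I white_noise_def
    by (simp add: prob_space_gauss)
  also have "\<dots> = (\<integral>\<^sup>+p. f ((snd p)(i := fst p)) \<partial>(gauss \<Otimes>\<^sub>M ?P (insert j ?I)))"
    by (subst nn_integral_distr[OF upd]) (simp_all add: split_beta')
  also have "\<dots> = (\<integral>\<^sup>+X. \<integral>\<^sup>+a. f (X(i := a)) \<partial>gauss \<partial>?P (insert j ?I))"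
    using measurable_compose[OF upd, of f]
    by (subst Q1.nn_integral_snd[symmetric]) (simp_all add: split_beta')
  also have "\<dots> = (\<integral>\<^sup>+X. \<integral>\<^sup>+a. f (X(i := a)) \<partial>gauss
      \<partial>distr (gauss \<Otimes>\<^sub>M ?P ?I) (?P (insert j ?I)) (\<lambda>(b, X). X(j := b)))"
    using distr_pair_PiM_eq_PiM[of ?I "\<lambda>_. gauss" j] by (simp add: prob_space_gauss)
  also have "\<dots> = (\<integral>\<^sup>+p. (\<integral>\<^sup>+a. f ((snd p)(j := fst p, i := a)) \<partial>gauss) \<partial>(gauss \<Otimes>\<^sub>M ?P ?I))"
    by (subst nn_integral_distr[OF upd1]) (use f1 in \<open>simp_all add: split_beta'\<close>)
  also have "\<dots> = (\<integral>\<^sup>+X. \<integral>\<^sup>+b. \<integral>\<^sup>+a. f (X(j := b, i := a)) \<partial>gauss \<partial>gauss \<partial>?P ?I)"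
    using measurable_compose[OF upd1 f1]
    by (subst Q.nn_integral_snd[symmetric]) (simp_all add: split_beta')
  also have "\<dots> = (\<integral>\<^sup>+X. \<integral>\<^sup>+a. \<integral>\<^sup>+b. f (X(j := b, i := a)) \<partial>gauss \<partial>gauss \<partial>?P ?I)"
  proof (rule nn_integral_cong)
    fix X :: "nat \<Rightarrow> real"
    interpret G2: pair_sigma_finite gauss gauss ..
    have "(\<lambda>p. f (X(j := snd p, i := fst p))) \<in> borel_measurable (gauss \<Otimes>\<^sub>M gauss)"
    proof (rule measurable_compose[OF _ assms(2)], rule measurable_coordinatewise)
      fix n
      show "(\<lambda>p. (X(j := snd p, i := fst p)) n) \<in> borel_measurable (gauss \<Otimes>\<^sub>M gauss)"
        by (cases "n = i"; cases "n = j") (simp_all add: measurable_cong_sets[OF sets_gauss refl])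
    qed
    then show "(\<integral>\<^sup>+b. \<integral>\<^sup>+a. f (X(j := b, i := a)) \<partial>gauss \<partial>gauss)
        = (\<integral>\<^sup>+a. \<integral>\<^sup>+b. f (X(j := b, i := a)) \<partial>gauss \<partial>gauss)"
      by (intro G2.Fubini') (simp add: split_beta')
  qed
  finally show ?thesis .
qed

text \<open>
  The angle depends on a coordinate outside the plane of rotation. Given all coordinates outside this
  plane it is constant, and the plane carries a rotation-invariant Gaussian measure.
\<close>

lemma distr_white_noise_turn:
  assumes ij: "i \<noteq> j" "k \<noteq> i" "k \<noteq> j"
    and [measurable]: "\<theta> \<in> borel_measurable borel"
  shows "distr white_noise white_noise (\<lambda>x. turn i j (\<theta> (x k)) x) = white_noise"
proof (rule measure_eqI)
  let ?T = "\<lambda>x. turn i j (\<theta> (x k)) x"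
  have T: "?T \<in> PiM UNIV (\<lambda>_. borel) \<rightarrow>\<^sub>M PiM UNIV (\<lambda>_. borel)"
    by (rule measurable_turn) measurable
  have Tw: "?T \<in> white_noise \<rightarrow>\<^sub>M white_noise"
    using T measurable_cong_sets[OF sets_white_noise sets_white_noise] by blast
  fix A assume "A \<in> sets (distr white_noise white_noise ?T)"
  then have A: "A \<in> sets (PiM UNIV (\<lambda>_. borel))"
    using sets_white_noise by simp
  let ?f = "indicator A :: _ \<Rightarrow> ennreal"
  have f: "?f \<in> borel_measurable (PiM UNIV (\<lambda>_. borel))"
    using A by measurable
  have "emeasure (distr white_noise white_noise ?T) A = (\<integral>\<^sup>+x. ?f (?T x) \<partial>white_noise)"
    using Tw A sets_white_noise
    by (simp add: nn_integral_indicator[symmetric] nn_integral_distr del: nn_integral_indicator)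
  also have "\<dots> = (\<integral>\<^sup>+X. (\<integral>\<^sup>+a. \<integral>\<^sup>+b. ?f (?T (X(j := b, i := a))) \<partial>gauss \<partial>gauss)
        \<partial>PiM (UNIV - {i, j}) (\<lambda>_. gauss))"
    by (rule nn_integral_white_noise_split[OF ij(1)]) (rule measurable_compose[OF T f])
  also have "\<dots> = (\<integral>\<^sup>+X. (\<integral>\<^sup>+a. \<integral>\<^sup>+b. ?f (X(j := b, i := a)) \<partial>gauss \<partial>gauss)
        \<partial>PiM (UNIV - {i, j}) (\<lambda>_. gauss))"
  proof (rule nn_integral_cong)
    fix X :: "nat \<Rightarrow> real"
    define G where "G p = ?f (X(j := snd p, i := fst p))" for p
    have "G \<in> borel_measurable borel"
      unfolding G_def
    proof (rule measurable_compose[OF _ f], rule measurable_coordinatewise)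
      fix n
      show "(\<lambda>p. (X(j := snd p, i := fst p)) n) \<in> borel_measurable borel"
        by (cases "n = i"; cases "n = j") (simp_all add: borel_prod[symmetric])
    qed
    have turned: "?T (X(j := b, i := a))
        = X(j := sin (\<theta> (X k)) * a + cos (\<theta> (X k)) * b, i := cos (\<theta> (X k)) * a - sin (\<theta> (X k)) * b)" for a b
      using ij by (auto simp: turn_def)
    from nn_integral_gauss_rotation[OF \<open>G \<in> borel_measurable borel\<close>, of "\<theta> (X k)"]
    show "(\<integral>\<^sup>+a. \<integral>\<^sup>+b. ?f (?T (X(j := b, i := a))) \<partial>gauss \<partial>gauss)
        = (\<integral>\<^sup>+a. \<integral>\<^sup>+b. ?f (X(j := b, i := a)) \<partial>gauss \<partial>gauss)"
      unfolding turned G_def by simp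
  qed
  also have "\<dots> = (\<integral>\<^sup>+x. ?f x \<partial>white_noise)"
    by (rule nn_integral_white_noise_split[OF ij(1) f, symmetric])
  also have "\<dots> = emeasure white_noise A"
    using A sets_white_noise by simp
  finally show "emeasure (distr white_noise white_noise ?T) A = emeasure white_noise A" .
qed simp

text \<open>
  This is Markov's inequality for \<open>exp (x\<^sub>s\<^sup>2 / 4)\<close>, whose expectation is \<open>\<surd>2\<close>.
\<close>

lemma white_noise_tail:
  assumes "R \<ge> 0"
  shows "measure white_noise {x. R < \<bar>x s\<bar>} \<le> sqrt 2 * exp (- (R\<^sup>2 / 4))"
proof -
  have d: "exp (x\<^sup>2 / 4) * std_normal_density x = sqrt 2 * normal_density 0 (sqrt 2) x" for x
  proof -
    have "exp (x\<^sup>2 / 4) * exp (- x\<^sup>2 / 2) = exp (- x\<^sup>2 / 4)"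
      by (simp add: exp_add[symmetric])
    then show ?thesis
      by (simp add: normal_density_def real_sqrt_mult field_simps)
  qed
  have [measurable]: "{x. R < \<bar>x s\<bar>} \<in> sets white_noise"
    unfolding sets_white_noise
    using measurable_sets[OF measurable_component_singleton[of s UNIV "\<lambda>_. borel"], of "{y. R < \<bar>y\<bar>}"]
    by (simp add: vimage_def space_PiM)
  have "emeasure white_noise {x. R < \<bar>x s\<bar>} = emeasure (distr white_noise gauss (\<lambda>x. x s)) {y. R < \<bar>y\<bar>}"
    by (subst emeasure_distr) (auto simp: white_noise_def vimage_def space_PiM)
  also have "distr white_noise gauss (\<lambda>x. x s) = gauss"
    unfolding white_noise_def by (rule distr_PiM_component) (auto simp: prob_space_gauss)
  also have "emeasure gauss {y. R < \<bar>y\<bar>} = (\<integral>\<^sup>+y. ennreal (std_normal_density y) * indicator {y. R < \<bar>y\<bar>} y \<partial>lborel)"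
    unfolding gauss_def by (rule emeasure_density) auto
  also have "\<dots> \<le> (\<integral>\<^sup>+y. ennreal (sqrt 2 * exp (- (R\<^sup>2 / 4))) * ennreal (normal_density 0 (sqrt 2) y) \<partial>lborel)"
  proof (rule nn_integral_mono)
    fix y :: real
    show "ennreal (std_normal_density y) * indicator {y. R < \<bar>y\<bar>} y
        \<le> ennreal (sqrt 2 * exp (- (R\<^sup>2 / 4))) * ennreal (normal_density 0 (sqrt 2) y)"
    proof (cases "R < \<bar>y\<bar>")
      case True
      then have "R\<^sup>2 \<le> y\<^sup>2"
        using assms by (metis abs_of_nonneg less_imp_le power2_abs power_mono)
      then have "1 \<le> exp (- (R\<^sup>2 / 4)) * exp (y\<^sup>2 / 4)"
        by (simp add: exp_add[symmetric])
      then have "1 * std_normal_density y \<le> exp (- (R\<^sup>2 / 4)) * exp (y\<^sup>2 / 4) * std_normal_density y"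
        by (intro mult_right_mono) simp_all
      also have "\<dots> = sqrt 2 * exp (- (R\<^sup>2 / 4)) * normal_density 0 (sqrt 2) y"
        using d[of y] by (simp add: mult.assoc mult.commute)
      finally show ?thesis
        using True by (simp add: ennreal_mult[symmetric] ennreal_leI)
    qed simp
  qed
  also have "\<dots> = ennreal (sqrt 2 * exp (- (R\<^sup>2 / 4)))"
  proof -
    have "(\<integral>\<^sup>+y. ennreal (normal_density 0 (sqrt 2) y) \<partial>lborel) = 1"
      by (subst nn_integral_eq_integral) (auto simp: integrable_normal_density integral_normal_density)
    then show ?thesis
      by (subst nn_integral_cmult) auto
  qed
  finally show ?thesis
    by (simp add: white_noise.emeasure_eq_measure)
qed

lemma distr_PiM_coordinatewise:
  assumes M: "\<And>i. i \<in> I \<Longrightarrow> prob_space (M i)"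
    and f: "\<And>i. i \<in> I \<Longrightarrow> f i \<in> M i \<rightarrow>\<^sub>M N i"
    and N: "\<And>i. i \<in> I \<Longrightarrow> distr (M i) (N i) (f i) = N i"
  shows "distr (PiM I M) (PiM I N) (\<lambda>\<omega>. \<lambda>i\<in>I. f i (\<omega> i)) = PiM I N"
proof (rule measure_eqI_PiM_infinite[symmetric, OF refl])
  have NP: "prob_space (N i)" if "i \<in> I" for i
    using prob_space.prob_space_distr[OF M f] N that by metis
  then interpret prob_space "PiM I N" by (rule prob_space_PiM)
  show "finite_measure (PiM I N)" by unfold_locales
  have meas: "(\<lambda>\<omega>. \<lambda>i\<in>I. f i (\<omega> i)) \<in> PiM I M \<rightarrow>\<^sub>M PiM I N"
  proof (rule measurable_restrict)
    fix i assume "i \<in> I"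
    then show "(\<lambda>\<omega>. f i (\<omega> i)) \<in> PiM I M \<rightarrow>\<^sub>M N i"
      by (intro measurable_compose[of "\<lambda>\<omega>. \<omega> i" "PiM I M" "M i" "f i"] measurable_component_singleton f)
  qed
  fix A J assume J: "finite J" "J \<subseteq> I" and A: "\<And>i. i \<in> J \<Longrightarrow> A i \<in> sets (N i)"
  have fA: "f i -` A i \<inter> space (M i) \<in> sets (M i)" if "i \<in> J" for i
    using that J A f by (intro measurable_sets[where A="N i"]) auto
  have JI: "i \<in> I" if "i \<in> J" for i using J(2) that by auto
  have "(\<lambda>\<omega>. \<lambda>i\<in>I. f i (\<omega> i)) -` prod_emb I N J (Pi\<^sub>E J A) \<inter> space (PiM I M)
      = prod_emb I M J (Pi\<^sub>E J (\<lambda>i. f i -` A i \<inter> space (M i)))"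
    using measurable_space[OF f]
    by (auto simp: prod_emb_def space_PiM PiE_iff JI intro: JI split: if_splits)
  then have "emeasure (distr (PiM I M) (PiM I N) (\<lambda>\<omega>. \<lambda>i\<in>I. f i (\<omega> i))) (prod_emb I N J (Pi\<^sub>E J A))
      = emeasure (PiM I M) (prod_emb I M J (Pi\<^sub>E J (\<lambda>i. f i -` A i \<inter> space (M i))))"
    using J A by (subst emeasure_distr[OF meas]) (auto intro: sets_PiM_I)
  also have "\<dots> = (\<Prod>i\<in>J. emeasure (M i) (f i -` A i \<inter> space (M i)))"
    using J fA M by (intro emeasure_PiM_emb) auto
  also have "\<dots> = (\<Prod>i\<in>J. emeasure (N i) (A i))"
  proof (intro prod.cong refl)
    fix i assume i: "i \<in> J"
    then have "emeasure (N i) (A i) = emeasure (distr (M i) (N i) (f i)) (A i)"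
      using J N by auto
    also have "\<dots> = emeasure (M i) (f i -` A i \<inter> space (M i))"
      using i J A by (intro emeasure_distr f) auto
    finally show "emeasure (M i) (f i -` A i \<inter> space (M i)) = emeasure (N i) (A i)" by simp
  qed
  also have "\<dots> = emeasure (PiM I N) (prod_emb I N J (Pi\<^sub>E J A))"
    using J A NP by (intro emeasure_PiM_emb[symmetric]) auto
  finally show "emeasure (PiM I N) (prod_emb I N J (Pi\<^sub>E J A))
      = emeasure (distr (PiM I M) (PiM I N) (\<lambda>\<omega>. \<lambda>i\<in>I. f i (\<omega> i))) (prod_emb I N J (Pi\<^sub>E J A))" by simp
qed simp

lemma distr_gauss_scale:
  assumes "0 < c"
  shows "distr gauss (density lborel (normal_density 0 c)) (\<lambda>y. c * y) = density lborel (normal_density 0 c)"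
proof -
  have "distributed gauss lborel (\<lambda>x. x) (normal_density 0 1)"
    unfolding distributed_def gauss_def
    using distr_id2[of lborel "density lborel (\<lambda>x. ennreal (std_normal_density x))"] by (auto simp: measurable_ident_sets)
  from gauss.normal_density_affine[OF this, of c 0] assms
  have "distributed gauss lborel (\<lambda>x. c * x) (normal_density 0 c)" by simp
  then have "distr gauss lborel (\<lambda>x. c * x) = density lborel (normal_density 0 c)"
    by (simp add: distributed_def)
  moreover have "distr gauss (density lborel (normal_density 0 c)) (\<lambda>y. c * y) = distr gauss lborel (\<lambda>y. c * y)"
    by (rule distr_cong) auto
  ultimately show ?thesis by simp
qed

section \<open>Lattices of rotators and their splitting scheme\<close>

lemma abs_sin_minus_self_le: "\<bar>sin x - x\<bar> \<le> x\<^sup>2 / 2" for x :: real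
  using Maclaurin_sin_bound[of x 2] by (simp add: sin_coeff_def eval_nat_numeral)

lemma abs_cos_minus_one_le: "\<bar>cos x - 1\<bar> \<le> x\<^sup>2 / 2" for x :: real
proof -
  have "cos x - 1 = - 2 * (sin (x / 2))\<^sup>2"
    using cos_double_sin[of "x / 2"] by simp
  moreover have "(sin (x / 2))\<^sup>2 \<le> (x / 2)\<^sup>2"
    using abs_sin_x_le_abs_x[of "x / 2"] by (metis abs_ge_zero power2_abs power_mono)
  ultimately show ?thesis
    by (simp add: power_divide)
qed

lemma abs_cos_minus_one_le_abs: "\<bar>cos x - 1\<bar> \<le> \<bar>x\<bar>" for x :: real
proof (cases "\<bar>x\<bar> \<le> 2")
  case True
  then have "x\<^sup>2 / 2 \<le> \<bar>x\<bar>"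
    using mult_right_mono[of "\<bar>x\<bar>" 2 "\<bar>x\<bar>"] by (simp add: power2_eq_square)
  with abs_cos_minus_one_le[of x] show ?thesis by linarith
next
  case False
  then show ?thesis using cos_ge_minus_one[of x] cos_le_one[of x] by linarith
qed

text \<open>
  Gronwall's lemma for a coupling of finite range \<open>D\<close> on the sites \<open>{..S}\<close>. Nothing is known about
  the differences near and beyond \<open>S\<close> except the crude bound \<open>b\<close>. Its influence needs \<open>q\<close>
  iterations to reach a site at distance \<open>q D\<close> from the boundary and arrives there with the weight
  \<open>(L t)\<^sup>q / q!\<close>, where \<open>t = h k\<close>.
\<close>

lemma discrete_gronwall_finite_range:
  fixes d :: "nat \<Rightarrow> nat \<Rightarrow> real"
  assumes init: "\<And>s. s \<le> S \<Longrightarrow> d 0 s = 0"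
    and step: "\<And>k s B. k < N \<Longrightarrow> s + D \<le> S \<Longrightarrow> (\<And>s'. s' \<le> s + D \<Longrightarrow> d k s' \<le> B) \<Longrightarrow>
        d (Suc k) s \<le> d k s + h * (L * B) + h\<^sup>2 * E"
    and crude: "\<And>k s. k \<le> N \<Longrightarrow> s \<le> S \<Longrightarrow> d k s \<le> b"
    and nonneg: "0 \<le> h" "0 \<le> L" "0 \<le> E" "0 \<le> b"
  shows "k \<le> N \<Longrightarrow> s + q * D \<le> S \<Longrightarrow>
    d k s \<le> b * (L * (h * k)) ^ q / fact q + h * E * (h * k) * exp (L * (h * k))"
proof (induction q arbitrary: k s)
  case 0
  have "0 \<le> h * E * (h * k) * exp (L * (h * k))"
    using nonneg by simp
  with crude[of k s] 0 show ?case by simp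
next
  case (Suc q)
  note IH = Suc.IH
  define G where "G k = h * E * (h * real k) * exp (L * (h * real k))" for k
  define P where "P q k = b * (L * (h * real k)) ^ q / fact q" for q k
  have G_step: "G k + h * (L * G k) + h\<^sup>2 * E \<le> G (Suc k)" for k
  proof -
    have "1 + L * h \<le> exp (L * h)" by (rule exp_ge_add_one_self)
    have "G k + h * (L * G k) = h * E * (h * k) * exp (L * (h * k)) * (1 + L * h)"
      by (simp add: G_def algebra_simps)
    also have "\<dots> \<le> h * E * (h * k) * exp (L * (h * k)) * exp (L * h)"
      using nonneg \<open>1 + L * h \<le> exp (L * h)\<close> by (intro mult_left_mono) auto
    also have "\<dots> = h * E * (h * k) * exp (L * (h * Suc k))"
      by (simp add: exp_add[symmetric] algebra_simps)
    finally have 1: "G k + h * (L * G k) \<le> h * E * (h * k) * exp (L * (h * Suc k))" .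
    have "h\<^sup>2 * E * 1 \<le> h\<^sup>2 * E * exp (L * (h * Suc k))"
      using nonneg by (intro mult_left_mono) auto
    with 1 have "G k + h * (L * G k) + h\<^sup>2 * E
        \<le> h * E * (h * k) * exp (L * (h * Suc k)) + h\<^sup>2 * E * exp (L * (h * Suc k))"
      by linarith
    also have "\<dots> = G (Suc k)"
      by (simp add: G_def algebra_simps power2_eq_square)
    finally show ?thesis .
  qed
  have P_step: "P (Suc q) k + h * (L * P q k) \<le> P (Suc q) (Suc k)" for k
  proof -
    have bernoulli: "real k ^ Suc q + (Suc q) * real k ^ q \<le> real (Suc k) ^ Suc q"
    proof -
      have "real (Suc k) ^ n \<ge> real k ^ n + n * real k ^ (n - 1)" for n
      proof (induction n)
        case (Suc n)
        have "real k ^ Suc n + Suc n * real k ^ n \<le> (real k ^ n + n * real k ^ (n - 1)) * Suc k"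
        proof (cases n)
          case (Suc m)
          then show ?thesis by (simp add: algebra_simps)
        qed simp
        also have "\<dots> \<le> real (Suc k) ^ n * Suc k"
          using Suc.IH by (intro mult_right_mono) auto
        finally show ?case by (simp add: mult.commute)
      qed simp
      from this[of "Suc q"] show ?thesis by simp
    qed
    have "b * (L * h) ^ Suc q / fact (Suc q) * (real (Suc q) * real k ^ q)
        = b * (L * h) ^ Suc q * real k ^ q / fact q"
      by (simp only: fact_Suc of_nat_mult of_nat_fact) (simp del: of_nat_Suc add: mult_ac)
    then have "P (Suc q) k + h * (L * P q k)
        = b * (L * h) ^ Suc q / fact (Suc q) * (real k ^ Suc q + (Suc q) * real k ^ q)"
      by (simp only: distrib_left) (simp add: P_def power_mult_distrib mult_ac)
    also have "\<dots> \<le> b * (L * h) ^ Suc q / fact (Suc q) * (real (Suc k) ^ Suc q)"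
      using nonneg bernoulli by (intro mult_left_mono divide_nonneg_nonneg) auto
    also have "\<dots> = P (Suc q) (Suc k)"
      by (simp only: P_def power_mult_distrib mult.assoc times_divide_eq_left)
    finally show ?thesis .
  qed
  from Suc.prems(1) have "d k s \<le> P (Suc q) k + G k"
  proof (induction k)
    case 0
    then show ?case
      using init[of s] Suc.prems(2) by (simp add: P_def G_def)
  next
    case (Suc k)
    have "d (Suc k) s \<le> d k s + h * (L * (P q k + G k)) + h\<^sup>2 * E"
    proof (rule step)
      fix s' assume "s' \<le> s + D"
      then show "d k s' \<le> P q k + G k"
        unfolding P_def G_def using Suc.prems \<open>s + Suc q * D \<le> S\<close> by (intro IH) auto
    qed (use Suc.prems \<open>s + Suc q * D \<le> S\<close> in auto)
    also have "\<dots> \<le> P (Suc q) (Suc k) + G (Suc k)"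
      using Suc.IH Suc.prems P_step[of k] G_step[of k] by (simp add: distrib_left)
    finally show ?case .
  qed
  then show ?case
    by (simp add: P_def G_def)
qed

text \<open>
  A sequence of elementary fields. Field number \<open>m\<close> rotates the coordinates \<open>fi m\<close> and \<open>fj m\<close> into each
  other with the angular speed \<open>fc m\<close> times the coordinate \<open>fk m\<close>. The constant \<open>D\<close> bounds the range
  of the interaction, the number of fields that act on a site, and the mismatch between the numbering
  of the fields and that of the sites.
\<close>

locale rotators =
  fixes fi fj fk :: "nat \<Rightarrow> nat" and fc :: "nat \<Rightarrow> real" and C :: real and D :: nat
  assumes distinct: "fi m \<noteq> fj m" "fk m \<noteq> fi m" "fk m \<noteq> fj m"
    and speed: "\<bar>fc m\<bar> \<le> C"
    and reach: "s = fi m \<or> s = fj m \<Longrightarrow> fi m \<le> s + D \<and> fj m \<le> s + D \<and> fk m \<le> s + D"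
    and order: "s = fi m \<or> s = fj m \<Longrightarrow> m < D * (s + 1)"
    and sites: "fi m < m + D" "fj m < m + D" "fk m < m + D"
    and multiplicity: "card {m. s = fi m \<or> s = fj m} \<le> D"
begin

definition touch :: "nat \<Rightarrow> nat set" where
  "touch s = {m. s = fi m \<or> s = fj m}"

definition force :: "nat \<Rightarrow> (nat \<Rightarrow> real) \<Rightarrow> nat \<Rightarrow> real" where
  "force m x s =
    (if s = fi m then - fc m * x (fk m) * x (fj m)
     else if s = fj m then fc m * x (fk m) * x (fi m) else 0)"

definition field :: "(nat \<Rightarrow> real) \<Rightarrow> nat \<Rightarrow> real" where
  "field x s = (\<Sum>m\<in>touch s. force m x s)"

definition rot :: "real \<Rightarrow> nat \<Rightarrow> (nat \<Rightarrow> real) \<Rightarrow> nat \<Rightarrow> real" where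
  "rot h m x = turn (fi m) (fj m) (h * fc m * x (fk m)) x"

text \<open>
  One time step applies the flows of the elementary fields one after the other, and \<open>unsweep\<close> undoes
  it; \<open>orbit h n k\<close> is the \<open>k\<close>-th power of the step, for integers \<open>k\<close> of either sign.
\<close>

primrec sweep :: "real \<Rightarrow> nat \<Rightarrow> (nat \<Rightarrow> real) \<Rightarrow> nat \<Rightarrow> real" where
  "sweep h 0 x = x"
| "sweep h (Suc m) x = rot h m (sweep h m x)"

primrec unsweep :: "real \<Rightarrow> nat \<Rightarrow> (nat \<Rightarrow> real) \<Rightarrow> nat \<Rightarrow> real" where
  "unsweep h 0 x = x"
| "unsweep h (Suc m) x = unsweep h m (rot (- h) m x)"

definition orbit :: "real \<Rightarrow> nat \<Rightarrow> int \<Rightarrow> (nat \<Rightarrow> real) \<Rightarrow> nat \<Rightarrow> real" where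
  "orbit h n k = (if 0 \<le> k then sweep h n ^^ nat k else unsweep h n ^^ nat (- k))"

lemma finite_touch: "finite (touch s)"
proof (rule finite_subset)
  show "touch s \<subseteq> {..<D * (s + 1)}" using order by (auto simp: touch_def)
qed simp

lemma D_pos: "0 < D"
  using order[of "fi 0" 0] by (cases D) auto

lemma C_nonneg: "0 \<le> C"
  using speed[of 0] by linarith

lemma rot_rot_minus: "rot h m (rot (- h) m x) = x"
proof -
  have "rot (- h) m x (fk m) = x (fk m)"
    using distinct[of m] by (simp add: rot_def turn_other)
  then show ?thesis
    using turn_turn_minus[OF distinct(1), of m "h * fc m * x (fk m)" x] by (simp add: rot_def)
qed

lemma sweep_unsweep: "sweep h n (unsweep h n x) = x"
  by (induction n arbitrary: x) (simp_all add: rot_rot_minus)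

lemma unsweep_sweep: "unsweep h n (sweep h n x) = x"
  using rot_rot_minus[of "- h"] by (induction n arbitrary: x) simp_all

lemma orbit_0 [simp]: "orbit h n 0 x = x"
  by (simp add: orbit_def)

lemma orbit_succ: "orbit h n (k + 1) x = sweep h n (orbit h n k x)"
proof (cases "0 \<le> k")
  case True
  then have "nat (k + 1) = Suc (nat k)" by simp
  with True show ?thesis by (simp add: orbit_def)
next
  case False
  then have *: "nat (- k) = Suc (nat (- (k + 1)))" by simp
  show ?thesis
  proof (cases "k = - 1")
    case True
    then show ?thesis by (simp add: orbit_def sweep_unsweep)
  next
    case k: False
    then have "\<not> 0 \<le> k + 1" using False by simp
    with False show ?thesis by (simp add: orbit_def * sweep_unsweep)
  qed
qed

lemma orbit_add: "orbit h n (k + j) x = orbit h n k (orbit h n j x)"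
proof (induction k rule: int_induct[where k=0])
  case (step1 k)
  then show ?case using orbit_succ[of h n "k + j" x] orbit_succ[of h n k]
    by (simp add: algebra_simps)
next
  case (step2 k)
  have "sweep h n (orbit h n (k - 1 + j) x) = sweep h n (orbit h n (k - 1) (orbit h n j x))"
    using orbit_succ[of h n "k - 1 + j" x] orbit_succ[of h n "k - 1"] step2
    by (simp add: algebra_simps)
  then show ?case by (metis unsweep_sweep)
qed simp

lemma abs_prod_diff_le:
  fixes a b a' b' :: real
  assumes "\<bar>a\<bar> \<le> R" "\<bar>b'\<bar> \<le> R" "\<bar>a - a'\<bar> \<le> \<delta>" "\<bar>b - b'\<bar> \<le> \<delta>"
  shows "\<bar>a * b - a' * b'\<bar> \<le> 2 * R * \<delta>"
proof -
  have "a * b - a' * b' = a * (b - b') + (a - a') * b'"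
    by (simp add: algebra_simps)
  also have "\<bar>\<dots>\<bar> \<le> \<bar>a\<bar> * \<bar>b - b'\<bar> + \<bar>a - a'\<bar> * \<bar>b'\<bar>"
    by (metis abs_mult abs_triangle_ineq)
  also have "\<dots> \<le> R * \<delta> + \<delta> * R"
    using assms by (intro add_mono mult_mono) auto
  finally show ?thesis by (simp add: algebra_simps)
qed

lemma force_lipschitz:
  assumes "\<And>s'. s' \<in> {fi m, fj m, fk m} \<Longrightarrow> \<bar>x s'\<bar> \<le> R \<and> \<bar>y s'\<bar> \<le> R \<and> \<bar>x s' - y s'\<bar> \<le> \<delta>"
  shows "\<bar>force m x s - force m y s\<bar> \<le> 2 * C * R * \<delta>"
proof -
  have R: "0 \<le> R" "0 \<le> \<delta>" using assms[of "fi m"] by auto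
  have "\<bar>x (fk m) * x s' - y (fk m) * y s'\<bar> \<le> 2 * R * \<delta>" if "s' = fi m \<or> s' = fj m" for s'
    using assms[of "fk m"] assms[of s'] that by (intro abs_prod_diff_le) auto
  then have *: "\<bar>fc m\<bar> * \<bar>x (fk m) * x s' - y (fk m) * y s'\<bar> \<le> C * (2 * R * \<delta>)"
    if "s' = fi m \<or> s' = fj m" for s'
    using that speed[of m] C_nonneg by (intro mult_mono) auto
  have "\<bar>fc m * x (fk m) * x s' - fc m * y (fk m) * y s'\<bar> \<le> 2 * C * R * \<delta>"
    if "s' = fi m \<or> s' = fj m" for s'
    using *[OF that] by (simp add: abs_mult[symmetric] algebra_simps)
  note this[of "fi m"] this[of "fj m"]
  then show ?thesis
    using R C_nonneg unfolding force_def by (auto simp: abs_minus_commute)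
qed

lemma sum_touch_le:
  fixes g :: "nat \<Rightarrow> real" and B :: real
  assumes "\<And>m. m \<in> touch s \<Longrightarrow> g m \<le> B" "0 \<le> B"
  shows "(\<Sum>m\<in>touch s. g m) \<le> real D * B"
proof -
  have "(\<Sum>m\<in>touch s. g m) \<le> (\<Sum>m\<in>touch s. B)"
    using assms by (intro sum_mono) auto
  also have "\<dots> = real (card (touch s)) * B" by simp
  also have "\<dots> \<le> real D * B"
    using multiplicity[of s] assms(2) by (intro mult_right_mono) (auto simp: touch_def)
  finally show ?thesis .
qed

lemma field_lipschitz:
  assumes "\<And>s'. s' \<le> s + D \<Longrightarrow> \<bar>x s'\<bar> \<le> R \<and> \<bar>y s'\<bar> \<le> R \<and> \<bar>x s' - y s'\<bar> \<le> \<delta>"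
  shows "\<bar>field x s - field y s\<bar> \<le> 2 * real D * C * R * \<delta>"
proof -
  have R: "0 \<le> R" "0 \<le> \<delta>" using assms[of s] by auto
  have "\<bar>field x s - field y s\<bar> \<le> (\<Sum>m\<in>touch s. \<bar>force m x s - force m y s\<bar>)"
    unfolding field_def sum_subtractf[symmetric] by (rule sum_abs)
  also have "\<dots> \<le> real D * (2 * C * R * \<delta>)"
  proof (rule sum_touch_le)
    fix m assume "m \<in> touch s"
    then show "\<bar>force m x s - force m y s\<bar> \<le> 2 * C * R * \<delta>"
      using reach[of s m] by (intro force_lipschitz assms) (auto simp: touch_def)
  qed (use R C_nonneg in auto)
  finally show ?thesis by (simp add: algebra_simps)
qed

lemma field_le:
  assumes "\<And>s'. s' \<le> s + D \<Longrightarrow> \<bar>x s'\<bar> \<le> R"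
  shows "\<bar>field x s\<bar> \<le> real D * C * R\<^sup>2"
proof -
  have R: "0 \<le> R" using assms[of s] by auto
  have "\<bar>field x s\<bar> \<le> (\<Sum>m\<in>touch s. \<bar>force m x s\<bar>)"
    unfolding field_def by (rule sum_abs)
  also have "\<dots> \<le> real D * (C * R\<^sup>2)"
  proof (rule sum_touch_le)
    fix m assume m: "m \<in> touch s"
    have "\<bar>fc m\<bar> * \<bar>x (fk m)\<bar> * \<bar>x s'\<bar> \<le> C * R * R" if "s' = fi m \<or> s' = fj m" for s'
      using that m reach[of s m] speed[of m] C_nonneg R
      by (intro mult_mono assms mult_nonneg_nonneg) (auto simp: touch_def)
    then show "\<bar>force m x s\<bar> \<le> C * R\<^sup>2"
      using R C_nonneg by (auto simp: force_def abs_mult power2_eq_square mult.assoc)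
  qed (use R C_nonneg in auto)
  finally show ?thesis by (simp add: algebra_simps)
qed

lemma rot_error:
  assumes "\<And>s'. s' \<in> {fi m, fj m, fk m} \<Longrightarrow> \<bar>x s'\<bar> \<le> R" and h: "0 \<le> h"
  shows "\<bar>rot h m x s - x s - h * force m x s\<bar> \<le> h\<^sup>2 * C\<^sup>2 * R ^ 3"
    and "\<bar>rot h m x s - x s\<bar> \<le> 2 * h * C * R\<^sup>2"
proof -
  define \<theta> where "\<theta> = h * fc m * x (fk m)"
  have xi: "\<bar>x (fi m)\<bar> \<le> R" and xj: "\<bar>x (fj m)\<bar> \<le> R" and xk: "\<bar>x (fk m)\<bar> \<le> R"
    using assms by auto
  then have R: "0 \<le> R" by linarith
  have \<theta>: "\<bar>\<theta>\<bar> \<le> h * C * R"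
    unfolding \<theta>_def abs_mult using h speed[of m] xk C_nonneg by (intro mult_mono mult_nonneg_nonneg) auto
  then have \<theta>2: "\<theta>\<^sup>2 \<le> (h * C * R)\<^sup>2"
    by (metis abs_ge_zero power2_abs power_mono)
  have second: "\<bar>(cos \<theta> - 1) * u\<bar> + \<bar>(sin \<theta> - \<theta>) * v\<bar> \<le> h\<^sup>2 * C\<^sup>2 * R ^ 3"
    if "\<bar>u\<bar> \<le> R" "\<bar>v\<bar> \<le> R" for u v
  proof -
    have "\<bar>(cos \<theta> - 1) * u\<bar> + \<bar>(sin \<theta> - \<theta>) * v\<bar> \<le> \<theta>\<^sup>2 / 2 * R + \<theta>\<^sup>2 / 2 * R"
      unfolding abs_mult using that R abs_cos_minus_one_le[of \<theta>] abs_sin_minus_self_le[of \<theta>]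
      by (intro add_mono mult_mono) auto
    also have "\<dots> = \<theta>\<^sup>2 * R" by simp
    also have "\<dots> \<le> (h * C * R)\<^sup>2 * R"
      using \<theta>2 R by (rule mult_right_mono)
    finally show ?thesis by (simp add: power_mult_distrib eval_nat_numeral mult_ac)
  qed
  have first: "\<bar>(cos \<theta> - 1) * u\<bar> + \<bar>sin \<theta> * v\<bar> \<le> 2 * h * C * R\<^sup>2"
    if "\<bar>u\<bar> \<le> R" "\<bar>v\<bar> \<le> R" for u v
  proof -
    have "\<bar>(cos \<theta> - 1) * u\<bar> + \<bar>sin \<theta> * v\<bar> \<le> \<bar>\<theta>\<bar> * R + \<bar>\<theta>\<bar> * R"
      unfolding abs_mult using that R abs_cos_minus_one_le_abs[of \<theta>] abs_sin_x_le_abs_x[of \<theta>]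
      by (intro add_mono mult_mono) auto
    also have "\<dots> = 2 * \<bar>\<theta>\<bar> * R" by simp
    also have "\<dots> \<le> 2 * (h * C * R) * R"
      using \<theta> R by (intro mult_right_mono) auto
    finally show ?thesis by (simp add: power2_eq_square mult_ac)
  qed
  consider "s = fi m" | "s = fj m" | "s \<noteq> fi m" "s \<noteq> fj m" by blast
  then have "\<bar>rot h m x s - x s - h * force m x s\<bar> \<le> h\<^sup>2 * C\<^sup>2 * R ^ 3
      \<and> \<bar>rot h m x s - x s\<bar> \<le> 2 * h * C * R\<^sup>2"
  proof cases
    case 1
    have "rot h m x s - x s = (cos \<theta> - 1) * x (fi m) - sin \<theta> * x (fj m)"
      using 1 distinct(1)[of m] by (simp add: rot_def turn_first \<theta>_def algebra_simps)
    moreover have "rot h m x s - x s - h * force m x s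
        = (cos \<theta> - 1) * x (fi m) - (sin \<theta> - \<theta>) * x (fj m)"
      using 1 distinct(1)[of m] by (simp add: rot_def turn_first \<theta>_def force_def algebra_simps)
    ultimately show ?thesis
      using first[OF xi xj] second[OF xi xj] by linarith
  next
    case 2
    have "rot h m x s - x s = (cos \<theta> - 1) * x (fj m) + sin \<theta> * x (fi m)"
      using 2 distinct(1)[of m] by (simp add: rot_def turn_second \<theta>_def algebra_simps)
    moreover have "rot h m x s - x s - h * force m x s
        = (cos \<theta> - 1) * x (fj m) + (sin \<theta> - \<theta>) * x (fi m)"
      using 2 distinct(1)[of m] by (simp add: rot_def turn_second \<theta>_def force_def algebra_simps)
    ultimately show ?thesis
      using first[OF xj xi] second[OF xj xi] by linarith
  next
    case 3
    then show ?thesis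
      using h C_nonneg R by (simp add: rot_def turn_other force_def)
  qed
  then show "\<bar>rot h m x s - x s - h * force m x s\<bar> \<le> h\<^sup>2 * C\<^sup>2 * R ^ 3"
    and "\<bar>rot h m x s - x s\<bar> \<le> 2 * h * C * R\<^sup>2" by auto
qed

lemma rot_untouched: "m \<notin> touch s \<Longrightarrow> rot h m x s = x s"
  by (simp add: rot_def turn_other touch_def)

text \<open>
  The bound is imposed on all intermediate states of the step, at every site that the first \<open>n\<close>
  rotations involve.
\<close>

definition tame :: "real \<Rightarrow> nat \<Rightarrow> real \<Rightarrow> (nat \<Rightarrow> real) \<Rightarrow> bool" where
  "tame h n R x \<longleftrightarrow> (\<forall>m\<le>n. \<forall>s<n + D. \<bar>sweep h m x s\<bar> \<le> R)"

lemma tame_sweep: "tame h n R x \<Longrightarrow> m \<le> n \<Longrightarrow> s < n + D \<Longrightarrow> \<bar>sweep h m x s\<bar> \<le> R"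
  by (simp only: tame_def)

lemma tame_bound: "tame h n R x \<Longrightarrow> s < n + D \<Longrightarrow> \<bar>x s\<bar> \<le> R"
  using tame_sweep[of h n R x 0 s] by (simp only: sweep.simps le0)

lemma sweep_move:
  assumes "tame h n R x" "0 \<le> h" "m \<le> n"
  shows "\<bar>sweep h m x s - x s\<bar> \<le> 2 * real D * h * C * R\<^sup>2"
proof -
  have "sweep h m x s - x s = (\<Sum>p<m. rot h p (sweep h p x) s - sweep h p x s)"
    using sum_lessThan_telescope[of "\<lambda>p. sweep h p x s" m] by (simp only: sweep.simps)
  also have "\<dots> = (\<Sum>p\<in>{..<m} \<inter> touch s. rot h p (sweep h p x) s - sweep h p x s)"
    by (intro sum.mono_neutral_right) (auto simp: rot_untouched)
  finally have "\<bar>sweep h m x s - x s\<bar> \<le> (\<Sum>p\<in>{..<m} \<inter> touch s. \<bar>rot h p (sweep h p x) s - sweep h p x s\<bar>)"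
    by (simp only: sum_abs)
  also have "\<dots> \<le> (\<Sum>p\<in>{..<m} \<inter> touch s. 2 * h * C * R\<^sup>2)"
  proof (rule sum_mono)
    fix p assume "p \<in> {..<m} \<inter> touch s"
    then have "p \<le> n" "p + D \<le> n + D" using assms(3) by auto
    then have bound: "\<bar>sweep h p x s'\<bar> \<le> R" if "s' \<in> {fi p, fj p, fk p}" for s'
      using that sites[of p] by (intro tame_sweep[OF assms(1)]) auto
    show "\<bar>rot h p (sweep h p x) s - sweep h p x s\<bar> \<le> 2 * h * C * R\<^sup>2"
      by (rule rot_error(2)[OF bound assms(2)])
  qed
  also have "\<dots> \<le> (\<Sum>p\<in>touch s. 2 * h * C * R\<^sup>2)"
    using assms(2) C_nonneg by (intro sum_mono2 finite_touch) auto
  also have "\<dots> \<le> real D * (2 * h * C * R\<^sup>2)"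
    using assms(2) C_nonneg by (intro sum_touch_le) auto
  finally show ?thesis by (simp add: algebra_simps)
qed

text \<open>
  Each site takes part in at most \<open>D\<close> of the rotations of a sweep, so in one sweep it feels the
  full vector field up to an error of second order in \<open>h\<close>.
\<close>

lemma sweep_error:
  assumes tame: "tame h n R x" and h: "0 \<le> h" and s: "D * (s + 1) \<le> n"
  shows "\<bar>sweep h n x s - x s - h * field x s\<bar> \<le> h\<^sup>2 * (5 * (real D)\<^sup>2 * C\<^sup>2 * R ^ 3)"
proof -
  have R: "0 \<le> R" using tame_bound[OF tame, of 0] D_pos by simp
  \<comment> \<open>The sweep contains every rotation that acts on the site \<open>s\<close>.\<close>
  have sub: "touch s \<subseteq> {..<n}"
    using order[of s] s by (fastforce simp: touch_def)
  have "sweep h n x s - x s = (\<Sum>p<n. rot h p (sweep h p x) s - sweep h p x s)"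
    using sum_lessThan_telescope[of "\<lambda>p. sweep h p x s" n] by (simp only: sweep.simps)
  also have "\<dots> = (\<Sum>p\<in>touch s. rot h p (sweep h p x) s - sweep h p x s)"
    using sub by (intro sum.mono_neutral_right) (auto simp: rot_untouched)
  finally have "sweep h n x s - x s - h * field x s
      = (\<Sum>p\<in>touch s. rot h p (sweep h p x) s - sweep h p x s - h * force p x s)"
    by (simp add: field_def sum_distrib_left sum_subtractf)
  then have "\<bar>sweep h n x s - x s - h * field x s\<bar>
      \<le> (\<Sum>p\<in>touch s. \<bar>rot h p (sweep h p x) s - sweep h p x s - h * force p x s\<bar>)"
    by (simp only: sum_abs)
  also have "\<dots> \<le> real D * (h\<^sup>2 * (5 * real D * C\<^sup>2 * R ^ 3))"
  proof (rule sum_touch_le)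
    fix p assume "p \<in> touch s"
    then have p: "p < n" using sub by auto
    have bound: "\<bar>sweep h p x s'\<bar> \<le> R" "\<bar>x s'\<bar> \<le> R" if "s' \<in> {fi p, fj p, fk p}" for s'
      using that sites[of p] p by (auto intro!: tame_sweep[OF tame] tame_bound[OF tame])
    have "\<bar>rot h p (sweep h p x) s - sweep h p x s - h * force p (sweep h p x) s\<bar> \<le> h\<^sup>2 * C\<^sup>2 * R ^ 3"
      by (rule rot_error(1)[OF bound(1) h])
    moreover
    have "\<bar>force p (sweep h p x) s - force p x s\<bar> \<le> 2 * C * R * (2 * real D * h * C * R\<^sup>2)"
      using sweep_move[OF tame h, of p] p bound by (intro force_lipschitz) simp
    then have "\<bar>h * force p (sweep h p x) s - h * force p x s\<bar> \<le> h * (2 * C * R * (2 * real D * h * C * R\<^sup>2))"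
      using h by (simp add: right_diff_distrib[symmetric] abs_mult mult_left_mono)
    moreover have "h * (2 * C * R * (2 * real D * h * C * R\<^sup>2)) = h\<^sup>2 * (4 * real D * C\<^sup>2 * R ^ 3)"
      by (simp add: eval_nat_numeral algebra_simps)
    moreover have "h\<^sup>2 * C\<^sup>2 * R ^ 3 \<le> h\<^sup>2 * (real D * C\<^sup>2 * R ^ 3)"
    proof -
      have "1 * (C\<^sup>2 * R ^ 3) \<le> real D * (C\<^sup>2 * R ^ 3)"
        using D_pos R by (intro mult_right_mono) auto
      then have "h\<^sup>2 * (1 * (C\<^sup>2 * R ^ 3)) \<le> h\<^sup>2 * (D * (C\<^sup>2 * R ^ 3))"
        by (intro mult_left_mono) auto
      then show ?thesis by (simp add: mult.assoc)
    qed
    moreover have "h\<^sup>2 * (real D * C\<^sup>2 * R ^ 3) + h\<^sup>2 * (4 * real D * C\<^sup>2 * R ^ 3) = h\<^sup>2 * (5 * real D * C\<^sup>2 * R ^ 3)"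
      by (simp add: algebra_simps)
    ultimately show "\<bar>rot h p (sweep h p x) s - sweep h p x s - h * force p x s\<bar>
        \<le> h\<^sup>2 * (5 * real D * C\<^sup>2 * R ^ 3)"
      by linarith
  qed (use R h in auto)
  finally show ?thesis by (simp add: power2_eq_square algebra_simps)
qed

definition tame_orbit :: "real \<Rightarrow> nat \<Rightarrow> real \<Rightarrow> nat \<Rightarrow> (nat \<Rightarrow> real) \<Rightarrow> bool" where
  "tame_orbit h n R N x \<longleftrightarrow> (\<forall>k. \<bar>k\<bar> \<le> int N \<longrightarrow> tame h n R (orbit h n k x))"

lemma orbit_move:
  assumes "tame_orbit h n R N x" "0 \<le> h" "\<bar>k\<bar> \<le> int N"
  shows "\<bar>orbit h n (k + 1) x s - orbit h n k x s\<bar> \<le> 2 * real D * h * C * R\<^sup>2"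
  using assms unfolding orbit_succ by (intro sweep_move) (auto simp: tame_orbit_def)

text \<open>
  The relation holds in both directions of time, with \<open>\<sigma>\<close> as the direction: backwards, the field is
  evaluated at the other end of the step, at a cost of second order in \<open>h\<close>.
\<close>

lemma orbit_euler:
  assumes orb: "tame_orbit h n R N x" and h: "0 \<le> h" and s: "D * (s + 1) \<le> n"
    and \<sigma>: "\<sigma> = 1 \<or> \<sigma> = - 1" and k: "\<bar>k\<bar> \<le> int N" "\<bar>k + \<sigma>\<bar> \<le> int N"
  shows "\<bar>orbit h n (k + \<sigma>) x s - orbit h n k x s - of_int \<sigma> * h * field (orbit h n k x) s\<bar>
    \<le> h\<^sup>2 * (9 * (real D)\<^sup>2 * C\<^sup>2 * R ^ 3)"
proof -
  let ?V = "\<lambda>k. orbit h n k x"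
  have tame: "tame h n R (?V k)" "tame h n R (?V (k + \<sigma>))"
    using orb k by (auto simp: tame_orbit_def)
  have R: "0 \<le> R" using tame_bound[OF tame(1), of 0] D_pos by simp
  have sn: "s + D < n + D" using s D_pos by (cases D) auto
  have le: "h\<^sup>2 * (5 * (real D)\<^sup>2 * C\<^sup>2 * R ^ 3) \<le> h\<^sup>2 * (9 * (real D)\<^sup>2 * C\<^sup>2 * R ^ 3)"
    using R by (intro mult_left_mono mult_right_mono) auto
  from \<sigma> show ?thesis
  proof
    assume "\<sigma> = 1"
    with sweep_error[OF tame(1) h s] le show ?thesis by (simp add: orbit_succ)
  next
    assume \<sigma>: "\<sigma> = - 1"
    have succ: "?V k = sweep h n (?V (k + \<sigma>))"
      using orbit_succ[of h n "k + \<sigma>" x] \<sigma> by simp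
    have 1: "\<bar>?V k s - ?V (k + \<sigma>) s - h * field (?V (k + \<sigma>)) s\<bar> \<le> h\<^sup>2 * (5 * (real D)\<^sup>2 * C\<^sup>2 * R ^ 3)"
      unfolding succ using sweep_error[OF tame(2) h s] .
    have "\<bar>field (?V (k + \<sigma>)) s - field (?V k) s\<bar> \<le> 2 * real D * C * R * (2 * real D * h * C * R\<^sup>2)"
    proof (rule field_lipschitz)
      fix s' assume "s' \<le> s + D"
      then show "\<bar>?V (k + \<sigma>) s'\<bar> \<le> R \<and> \<bar>?V k s'\<bar> \<le> R \<and> \<bar>?V (k + \<sigma>) s' - ?V k s'\<bar> \<le> 2 * real D * h * C * R\<^sup>2"
        using tame_bound[OF tame(1), of s'] tame_bound[OF tame(2), of s'] sn
          sweep_move[OF tame(2) h order_refl, of s'] succ by (simp add: abs_minus_commute)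
    qed
    then have "h * \<bar>field (?V (k + \<sigma>)) s - field (?V k) s\<bar> \<le> h * (2 * real D * C * R * (2 * real D * h * C * R\<^sup>2))"
      using h by (rule mult_left_mono)
    also have "\<dots> = h\<^sup>2 * (4 * (real D)\<^sup>2 * C\<^sup>2 * R ^ 3)"
      by (simp add: eval_nat_numeral algebra_simps)
    finally have 2: "\<bar>h * field (?V (k + \<sigma>)) s - h * field (?V k) s\<bar> \<le> h\<^sup>2 * (4 * (real D)\<^sup>2 * C\<^sup>2 * R ^ 3)"
      using h by (simp add: right_diff_distrib[symmetric] abs_mult)
    have "h\<^sup>2 * (5 * (real D)\<^sup>2 * C\<^sup>2 * R ^ 3) + h\<^sup>2 * (4 * (real D)\<^sup>2 * C\<^sup>2 * R ^ 3) = h\<^sup>2 * (9 * (real D)\<^sup>2 * C\<^sup>2 * R ^ 3)"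
      by (simp add: algebra_simps)
    with 1 2 \<sigma> show ?thesis by simp
  qed
qed

lemma abs_signed_diff:
  fixes c u v :: real and \<sigma> :: int
  assumes "\<sigma> = 1 \<or> \<sigma> = - 1" "0 \<le> c"
  shows "\<bar>of_int \<sigma> * c * u - of_int \<sigma> * c * v\<bar> = c * \<bar>u - v\<bar>"
  using assms by (auto simp: right_diff_distrib[symmetric] abs_mult abs_minus_commute)

text \<open>
  The comparison of two levels: two steps of the fine orbit make up one coarse step to second order, and
  up to the site \<open>S\<close> both orbits feel the same field.
\<close>

lemma orbit_refinement:
  assumes coarse: "tame_orbit h n R N x" and fine: "tame_orbit (h / 2) n' R (2 * N) x"
    and h: "0 \<le> h" and S: "D * (S + 1) \<le> n" "D * (S + 1) \<le> n'"
    and k: "\<bar>k\<bar> \<le> int N" and s: "s + q * D \<le> S"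
  defines "t \<equiv> h * \<bar>real_of_int k\<bar>"
  shows "\<bar>orbit h n k x s - orbit (h / 2) n' (2 * k) x s\<bar>
    \<le> 2 * R * (2 * real D * C * R * t) ^ q / fact q
      + h * (18 * (real D)\<^sup>2 * C\<^sup>2 * R ^ 3) * t * exp (2 * real D * C * R * t)"
proof -
  let ?V = "\<lambda>k. orbit h n k x" and ?W = "\<lambda>k. orbit (h / 2) n' k x"
  define \<sigma> :: int where "\<sigma> = (if 0 \<le> k then 1 else - 1)"
  define E where "E = 9 * (real D)\<^sup>2 * C\<^sup>2 * R ^ 3"
  have \<sigma>: "\<sigma> = 1 \<or> \<sigma> = - 1" by (simp add: \<sigma>_def)
  have k\<sigma>: "\<sigma> * int (nat \<bar>k\<bar>) = k" by (simp add: \<sigma>_def)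
  have "tame h n R x"
    using coarse[unfolded tame_orbit_def, rule_format, of 0] by simp
  then have R: "0 \<le> R" using tame_bound[of h n R x 0] D_pos by simp
  have half_nonneg: "0 \<le> h / 2" using h by simp
  have V: "\<bar>?V k s\<bar> \<le> R" if "\<bar>k\<bar> \<le> int N" "s < n + D" for k s
    using coarse that by (auto simp: tame_orbit_def intro: tame_bound)
  have W: "\<bar>?W k s\<bar> \<le> R" if "\<bar>k\<bar> \<le> int (2 * N)" "s < n' + D" for k s
    using fine that by (auto simp: tame_orbit_def intro: tame_bound)
  have Sn: "S < n" "S < n'" using S D_pos by (cases D; auto)+
  define d where "d m s = \<bar>?V (\<sigma> * int m) s - ?W (2 * (\<sigma> * int m)) s\<bar>" for m s
  have "d (nat \<bar>k\<bar>) s \<le> 2 * R * (2 * real D * C * R * (h * real (nat \<bar>k\<bar>))) ^ q / fact q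
      + h * (2 * E) * (h * real (nat \<bar>k\<bar>)) * exp (2 * real D * C * R * (h * real (nat \<bar>k\<bar>)))"
  proof (rule discrete_gronwall_finite_range[where N=N and S=S and D=D])
    fix m s assume ms: "m \<le> N" "s \<le> S"
    have "\<bar>\<sigma> * int m\<bar> \<le> int N" "\<bar>2 * (\<sigma> * int m)\<bar> \<le> int (2 * N)"
      using \<sigma> ms by auto
    with V[of "\<sigma> * int m" s] W[of "2 * (\<sigma> * int m)" s] ms Sn show "d m s \<le> 2 * R"
      by (simp add: d_def)
  next
    fix m s B
    assume m: "m < N" and s: "s + D \<le> S" and B: "\<And>s'. s' \<le> s + D \<Longrightarrow> d m s' \<le> B"
    let ?k = "\<sigma> * int m"
    have range: "\<bar>?k\<bar> \<le> int N" "\<bar>?k + \<sigma>\<bar> \<le> int N" "\<bar>2 * ?k\<bar> \<le> int (2 * N)"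
      "\<bar>2 * ?k + \<sigma>\<bar> \<le> int (2 * N)" "\<bar>2 * ?k + \<sigma> + \<sigma>\<bar> \<le> int (2 * N)"
      using \<sigma> m by auto
    have "D * (s + 1) \<le> D * (S + 1)" using s by (intro mult_left_mono) auto
    from order_trans[OF this S(1)] order_trans[OF this S(2)]
    have sn: "D * (s + 1) \<le> n" "D * (s + 1) \<le> n'" .
    have 1: "\<bar>?V (?k + \<sigma>) s - ?V ?k s - of_int \<sigma> * h * field (?V ?k) s\<bar> \<le> h\<^sup>2 * E"
      unfolding E_def by (rule orbit_euler[OF coarse h sn(1) \<sigma> range(1,2)])
    have 2: "\<bar>?W (2 * ?k + \<sigma>) s - ?W (2 * ?k) s - of_int \<sigma> * (h / 2) * field (?W (2 * ?k)) s\<bar> \<le> (h / 2)\<^sup>2 * E"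
      unfolding E_def by (rule orbit_euler[OF fine _ sn(2) \<sigma> range(3,4)]) (use h in auto)
    have 3: "\<bar>?W (2 * ?k + \<sigma> + \<sigma>) s - ?W (2 * ?k + \<sigma>) s - of_int \<sigma> * (h / 2) * field (?W (2 * ?k + \<sigma>)) s\<bar>
        \<le> (h / 2)\<^sup>2 * E"
      unfolding E_def by (rule orbit_euler[OF fine _ sn(2) \<sigma> range(4,5)]) (use h in auto)
    have "\<bar>field (?W (2 * ?k + \<sigma>)) s - field (?W (2 * ?k)) s\<bar> \<le> 2 * real D * C * R * (2 * real D * (h / 2) * C * R\<^sup>2)"
    proof (rule field_lipschitz)
      fix s' assume s': "s' \<le> s + D"
      have "\<bar>?W (2 * ?k + \<sigma>) s' - ?W (2 * ?k) s'\<bar> \<le> 2 * real D * (h / 2) * C * R\<^sup>2"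
        using \<sigma>
      proof
        assume "\<sigma> = 1"
        then show ?thesis using orbit_move[OF fine _ range(3), of s'] h by simp
      next
        assume "\<sigma> = - 1"
        then show ?thesis using orbit_move[OF fine _ range(4), of s'] h by (simp add: abs_minus_commute)
      qed
      then show "\<bar>?W (2 * ?k + \<sigma>) s'\<bar> \<le> R \<and> \<bar>?W (2 * ?k) s'\<bar> \<le> R
          \<and> \<bar>?W (2 * ?k + \<sigma>) s' - ?W (2 * ?k) s'\<bar> \<le> 2 * real D * (h / 2) * C * R\<^sup>2"
        using W[OF range(3), of s'] W[OF range(4), of s'] s' s Sn by simp
    qed
    then have "(h / 2) * \<bar>field (?W (2 * ?k + \<sigma>)) s - field (?W (2 * ?k)) s\<bar>
        \<le> (h / 2) * (2 * real D * C * R * (2 * real D * (h / 2) * C * R\<^sup>2))"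
      using h by (intro mult_left_mono) auto
    also have "\<dots> = h\<^sup>2 * ((real D)\<^sup>2 * C\<^sup>2 * R ^ 3)"
      by (simp add: eval_nat_numeral algebra_simps)
    finally have 4: "\<bar>of_int \<sigma> * (h / 2) * field (?W (2 * ?k + \<sigma>)) s - of_int \<sigma> * (h / 2) * field (?W (2 * ?k)) s\<bar>
        \<le> h\<^sup>2 * ((real D)\<^sup>2 * C\<^sup>2 * R ^ 3)"
      unfolding abs_signed_diff[OF \<sigma> half_nonneg] .
    have "\<bar>field (?V ?k) s - field (?W (2 * ?k)) s\<bar> \<le> 2 * real D * C * R * B"
    proof (rule field_lipschitz)
      fix s' assume s': "s' \<le> s + D"
      then show "\<bar>?V ?k s'\<bar> \<le> R \<and> \<bar>?W (2 * ?k) s'\<bar> \<le> R \<and> \<bar>?V ?k s' - ?W (2 * ?k) s'\<bar> \<le> B"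
        using V[OF range(1), of s'] W[OF range(3), of s'] B[OF s'] s Sn by (simp add: d_def)
    qed
    then have "h * \<bar>field (?V ?k) s - field (?W (2 * ?k)) s\<bar> \<le> h * (2 * real D * C * R * B)"
      using h by (rule mult_left_mono)
    then have 5: "\<bar>of_int \<sigma> * h * field (?V ?k) s - of_int \<sigma> * h * field (?W (2 * ?k)) s\<bar> \<le> h * (2 * real D * C * R * B)"
      unfolding abs_signed_diff[OF \<sigma> h] .
    have 6: "2 * ((h / 2)\<^sup>2 * E) + h\<^sup>2 * ((real D)\<^sup>2 * C\<^sup>2 * R ^ 3) \<le> h\<^sup>2 * E"
    proof -
      have "h\<^sup>2 * E - (2 * ((h / 2)\<^sup>2 * E) + h\<^sup>2 * ((real D)\<^sup>2 * C\<^sup>2 * R ^ 3)) = 7 / 2 * (h\<^sup>2 * (real D)\<^sup>2 * C\<^sup>2 * R ^ 3)"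
        by (simp add: E_def field_simps)
      also have "\<dots> \<ge> 0" using R by simp
      finally show ?thesis by linarith
    qed
    have "d (Suc m) s = \<bar>?V (?k + \<sigma>) s - ?W (2 * ?k + \<sigma> + \<sigma>) s\<bar>"
      by (simp add: d_def algebra_simps)
    moreover have "d m s = \<bar>?V ?k s - ?W (2 * ?k) s\<bar>"
      by (simp add: d_def)
    moreover have half: "of_int \<sigma> * h * field (?W (2 * ?k)) s
        = of_int \<sigma> * (h / 2) * field (?W (2 * ?k)) s + of_int \<sigma> * (h / 2) * field (?W (2 * ?k)) s"
      by simp
    ultimately have "d (Suc m) s \<le> d m s + h * (2 * real D * C * R * B) + 2 * (h\<^sup>2 * E)"
      using 1 2 3 4 5 6 by linarith
    then show "d (Suc m) s \<le> d m s + h * (2 * real D * C * R * B) + h\<^sup>2 * (2 * E)"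
      by simp
  next
    show "0 \<le> 2 * E" using R by (simp add: E_def)
  qed (use h R C_nonneg k s in \<open>auto simp: d_def\<close>)
  then show ?thesis
    unfolding d_def k\<sigma> t_def E_def using k by (simp add: mult.assoc)
qed

end

section \<open>The approximations on white noise\<close>

definition preserves_white_noise :: "((nat \<Rightarrow> real) \<Rightarrow> nat \<Rightarrow> real) \<Rightarrow> bool" where
  "preserves_white_noise g \<longleftrightarrow>
    g \<in> white_noise \<rightarrow>\<^sub>M white_noise \<and> distr white_noise white_noise g = white_noise"

lemma preserves_white_noise_compose:
  assumes "preserves_white_noise f" "preserves_white_noise g"
  shows "preserves_white_noise (\<lambda>x. f (g x))"
proof -
  have [measurable]: "f \<in> white_noise \<rightarrow>\<^sub>M white_noise" "g \<in> white_noise \<rightarrow>\<^sub>M white_noise"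
    and f: "distr white_noise white_noise f = white_noise"
    and g: "distr white_noise white_noise g = white_noise"
    using assms by (auto simp: preserves_white_noise_def)
  have "distr white_noise white_noise (\<lambda>x. f (g x)) = distr (distr white_noise white_noise g) white_noise f"
    by (subst distr_distr) (auto simp: comp_def)
  also have "\<dots> = white_noise" by (simp add: f g)
  finally show ?thesis by (simp add: preserves_white_noise_def)
qed

lemma preserves_white_noise_ident: "preserves_white_noise (\<lambda>x. x)"
  by (simp add: preserves_white_noise_def)

lemma preserves_white_noise_funpow:
  "preserves_white_noise f \<Longrightarrow> preserves_white_noise (f ^^ n)"
  by (induction n)
    (simp_all add: preserves_white_noise_ident preserves_white_noise_compose id_def comp_def)

text \<open>
  Factorial decay beats subexponential growth: this is one term of the exponential series at \<open>2 x\<close>.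
\<close>

lemma abs_power_divide_fact_le:
  fixes x :: real
  assumes "0 \<le> x"
  shows "x ^ n / fact n \<le> exp (2 * x) / 2 ^ n"
proof -
  have "(2 * x) ^ n / fact n \<le> (\<Sum>k<Suc n. (2 * x) ^ k / fact k)"
    using assms by (simp add: sum_nonneg)
  also have "\<dots> = (\<Sum>k<Suc n. (2 * x) ^ k /\<^sub>R fact k)"
    by (intro sum.cong) (simp_all add: divide_inverse mult.commute)
  also have "\<dots> \<le> exp (2 * x)"
    unfolding exp_def using assms by (intro sum_le_suminf summable_exp_generic) auto
  finally show ?thesis
    by (simp add: power_mult_distrib field_simps)
qed

lemma exp_sqrt_subexponential:
  fixes B :: real
  assumes "0 < B"
  shows "(\<lambda>l. (2 / 3) ^ l * (sqrt (8 * real (Suc l)) ^ 3 * exp (B * sqrt (8 * real (Suc l))))) \<longlonglongrightarrow> 0"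
  using assms by real_asymp

context rotators begin

lemma preserves_rot: "preserves_white_noise (rot h m)"
  unfolding preserves_white_noise_def
proof
  have *: "rot h m = (\<lambda>x. turn (fi m) (fj m) (h * fc m * x (fk m)) x)"
    by (simp add: rot_def fun_eq_iff)
  show "distr white_noise white_noise (rot h m) = white_noise"
    unfolding * using distinct[of m] by (intro distr_white_noise_turn[of _ _ _ "\<lambda>y. h * fc m * y"]) auto
  have "rot h m \<in> PiM UNIV (\<lambda>_. borel) \<rightarrow>\<^sub>M PiM UNIV (\<lambda>_. borel)"
    unfolding * by (rule measurable_turn) measurable
  then show "rot h m \<in> white_noise \<rightarrow>\<^sub>M white_noise"
    using measurable_cong_sets[OF sets_white_noise sets_white_noise] by blast
qed

lemma preserves_sweep: "preserves_white_noise (sweep h n)"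
proof (induction n)
  case 0
  have "sweep h 0 = (\<lambda>x. x)" by auto
  then show ?case by (simp add: preserves_white_noise_ident)
next
  case (Suc n)
  have "sweep h (Suc n) = (\<lambda>x. rot h n (sweep h n x))" by auto
  then show ?case
    by (simp add: preserves_white_noise_compose[OF preserves_rot Suc])
qed

lemma preserves_unsweep: "preserves_white_noise (unsweep h n)"
proof (induction n)
  case 0
  have "unsweep h 0 = (\<lambda>x. x)" by auto
  then show ?case by (simp add: preserves_white_noise_ident)
next
  case (Suc n)
  have "unsweep h (Suc n) = (\<lambda>x. unsweep h n (rot (- h) n x))" by auto
  then show ?case
    by (simp add: preserves_white_noise_compose[OF Suc preserves_rot])
qed

lemma preserves_orbit: "preserves_white_noise (orbit h n k)"
  by (simp add: orbit_def preserves_white_noise_funpow preserves_sweep preserves_unsweep)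

lemma measurable_orbit: "(\<lambda>x. orbit h n k x s) \<in> borel_measurable white_noise"
proof -
  have "orbit h n k \<in> white_noise \<rightarrow>\<^sub>M PiM UNIV (\<lambda>_. borel)"
    using preserves_orbit[of h n k] measurable_cong_sets[OF refl sets_white_noise]
    by (auto simp: preserves_white_noise_def)
  from measurable_compose[OF this measurable_component_singleton[of s]] show ?thesis by simp
qed

text \<open>The union bound over the intermediate states, each of which is white noise.\<close>

lemma prob_not_tame_orbit:
  assumes "0 \<le> R"
  shows "{x. \<not> tame_orbit h n R N x} \<in> sets white_noise"
    and "measure white_noise {x. \<not> tame_orbit h n R N x}
      \<le> real ((2 * N + 1) * (Suc n * (n + D))) * (sqrt 2 * exp (- (R\<^sup>2 / 4)))"
proof -
  let ?I = "{- int N..int N} \<times> {..n} \<times> {..<n + D}"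
  define A where "A i = {x. R < \<bar>sweep h (fst (snd i)) (orbit h n (fst i) x) (snd (snd i))\<bar>}" for i
  have range: "\<bar>k\<bar> \<le> int N \<longleftrightarrow> k \<in> {- int N..int N}" for k by auto
  have UN: "{x. \<not> (\<forall>k\<in>K. \<forall>m\<in>L. \<forall>s\<in>S. \<not> Q k m s x)}
      = (\<Union>i\<in>K \<times> L \<times> S. {x. Q (fst i) (fst (snd i)) (snd (snd i)) x})"
    for K :: "int set" and L S :: "nat set" and Q :: "int \<Rightarrow> nat \<Rightarrow> nat \<Rightarrow> (nat \<Rightarrow> real) \<Rightarrow> bool"
    by force
  have "tame_orbit h n R N x \<longleftrightarrow> (\<forall>k\<in>{- int N..int N}. \<forall>m\<in>{..n}. \<forall>s\<in>{..<n + D}.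
      \<not> R < \<bar>sweep h m (orbit h n k x) s\<bar>)" for x
    unfolding tame_orbit_def tame_def range by (simp only: Ball_def atMost_iff lessThan_iff not_less)
  then have eq: "{x. \<not> tame_orbit h n R N x} = (\<Union>i\<in>?I. A i)"
    unfolding A_def UN[of _ _ _ "\<lambda>k m s x. R < \<bar>sweep h m (orbit h n k x) s\<bar>", symmetric]
    by (simp only:)
  have A: "A i \<in> sets white_noise \<and> measure white_noise (A i) \<le> sqrt 2 * exp (- (R\<^sup>2 / 4))" for i
  proof -
    obtain k m s where i: "i = (k, m, s)" by (cases i) auto
    define g where "g x = sweep h m (orbit h n k x)" for x
    have "preserves_white_noise g"
      unfolding g_def by (rule preserves_white_noise_compose[OF preserves_sweep preserves_orbit])
    then have g: "g \<in> white_noise \<rightarrow>\<^sub>M white_noise" "distr white_noise white_noise g = white_noise"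
      by (auto simp: preserves_white_noise_def)
    have tail: "{x. R < \<bar>x s\<bar>} \<in> sets white_noise"
      unfolding sets_white_noise
      using measurable_sets[OF measurable_component_singleton[of s UNIV "\<lambda>_. borel"], of "{y. R < \<bar>y\<bar>}"]
      by (simp add: vimage_def space_PiM)
    have Ai: "A i = g -` {x. R < \<bar>x s\<bar>} \<inter> space white_noise"
      by (auto simp: A_def i g_def)
    have "measure white_noise (A i) = measure (distr white_noise white_noise g) {x. R < \<bar>x s\<bar>}"
      unfolding Ai by (rule measure_distr[symmetric]) (use g tail in auto)
    also have "\<dots> \<le> sqrt 2 * exp (- (R\<^sup>2 / 4))"
      unfolding g(2) by (rule white_noise_tail[OF assms])
    finally show ?thesis
      using measurable_sets[OF g(1) tail] by (simp add: Ai)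
  qed
  show "{x. \<not> tame_orbit h n R N x} \<in> sets white_noise"
    unfolding eq using A by (intro sets.finite_UN) auto
  have "measure white_noise {x. \<not> tame_orbit h n R N x} \<le> (\<Sum>i\<in>?I. measure white_noise (A i))"
    unfolding eq using A by (intro white_noise.finite_measure_subadditive_finite) auto
  also have "\<dots> \<le> (\<Sum>i\<in>?I. sqrt 2 * exp (- (R\<^sup>2 / 4)))"
    using A by (intro sum_mono) auto
  also have "\<dots> = real (card ?I) * (sqrt 2 * exp (- (R\<^sup>2 / 4)))"
    by simp
  also have "card ?I = (2 * N + 1) * (Suc n * (n + D))"
    by (simp add: card_cartesian_product nat_add_distrib nat_mult_distrib)
  finally show "measure white_noise {x. \<not> tame_orbit h n R N x}
      \<le> real ((2 * N + 1) * (Suc n * (n + D))) * (sqrt 2 * exp (- (R\<^sup>2 / 4)))" .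
qed

text \<open>
  Level \<open>l\<close> contains all rotations that act on the sites up to \<open>(D + 1) l\<close>. This leaves room for \<open>l\<close>
  Gronwall iterations between that boundary and the sites up to \<open>l\<close>.
\<close>

definition rots :: "nat \<Rightarrow> nat" where
  "rots l = D * ((D + 1) * l + 1)"

text \<open>
  With this radius the Gaussian tail is \<open>exp (- 2 l)\<close>, which beats the \<open>2\<^sup>l\<close> time steps of level \<open>l\<close>.
\<close>

definition radius :: "nat \<Rightarrow> real" where
  "radius l = sqrt (8 * real l)"

definition level :: "nat \<Rightarrow> int \<Rightarrow> (nat \<Rightarrow> real) \<Rightarrow> nat \<Rightarrow> real" where
  "level l = orbit (1 / 2 ^ l) (rots l)"

lemma AE_tame_orbit:
  "AE x in white_noise. \<forall>T::nat. \<forall>\<^sub>F l in sequentially. tame_orbit (1 / 2 ^ l) (rots l) (radius l) (T * 2 ^ l) x"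
  unfolding AE_all_countable
proof
  fix T :: nat
  define A where "A l = {x. \<not> tame_orbit (1 / 2 ^ l) (rots l) (radius l) (T * 2 ^ l) x}" for l
  define b where "b l = real ((2 * (T * 2 ^ l) + 1) * (Suc (rots l) * (rots l + D))) * (sqrt 2 * exp (- ((radius l)\<^sup>2 / 4)))" for l
  have R: "0 \<le> radius l" for l by (simp add: radius_def)
  have "summable (\<lambda>l. measure white_noise (A l))"
  proof (rule summable_comparison_test_bigo)
    show "summable (\<lambda>l. norm (1 / (2::real) ^ l))"
    proof -
      have "(\<lambda>l. norm (1 / (2::real) ^ l)) = (\<lambda>l. (1 / 2) ^ l)"
        by (simp add: power_one_over fun_eq_iff)
      moreover have "summable (\<lambda>l. (1 / 2 :: real) ^ l)"
        by (rule summable_geometric) simp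
      ultimately show ?thesis by (simp only:)
    qed
    have "measure white_noise (A l) \<le> b l" for l
      unfolding A_def b_def by (rule prob_not_tame_orbit(2)[OF R])
    from order_trans[OF this abs_ge_self] have "(\<lambda>l. measure white_noise (A l)) \<in> O(b)"
      by (intro bigoI[of _ 1] always_eventually) simp
    also have "b \<in> O(\<lambda>l. 1 / (2::real) ^ l)"
    proof -
      define c d where "c = 2 * real T + 1" and "d = real D"
      have pos: "0 < c" "0 < d" using D_pos by (auto simp: c_def d_def)
      define r where "r l = (2::real) ^ l * (real l + 1)\<^sup>2 * (1 / 5) ^ l" for l :: nat
      define K where "K = 8 * c * (d + 1) ^ 4"
      have b_le: "\<bar>b l\<bar> \<le> K * r l" for l
      proof -
        let ?p = "(d * ((d + 1) * l + 1) + 1) * (d * ((d + 1) * l + 1) + d)"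
        have 1: "(2::real) * (T * 2 ^ l) + 1 \<le> c * 2 ^ l"
          by (simp add: c_def algebra_simps)
        have 2: "sqrt 2 * exp (- ((radius l)\<^sup>2 / 4)) \<le> 2 * (1 / 5) ^ l"
        proof (rule mult_mono)
          have R4: "- ((radius l)\<^sup>2 / 4) = real l * (- 2)" by (simp add: radius_def)
          have "exp (- ((radius l)\<^sup>2 / 4)) = exp (- 2) ^ l"
            unfolding R4 by (rule exp_of_nat_mult)
          also have "exp (- 2) \<le> (1 / 5 :: real)"
          proof -
            have "(5 :: real) \<le> exp 2"
              using exp_lower_Taylor_quadratic[of 2] by simp
            then show ?thesis by (simp add: exp_minus inverse_eq_divide frac_le)
          qed
          then have "exp (- 2) ^ l \<le> (1 / 5 :: real) ^ l"
            by (intro power_mono) simp_all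
          finally show "exp (- ((radius l)\<^sup>2 / 4)) \<le> (1 / 5) ^ l" .
          show "sqrt 2 \<le> (2 :: real)" by (rule real_le_lsqrt) auto
        qed auto
        have 3: "?p \<le> (2 * (d + 1)\<^sup>2 * (real l + 1)) * (2 * (d + 1)\<^sup>2 * (real l + 1))"
          using pos by (intro mult_mono) (auto simp: algebra_simps power2_eq_square)
        have "((2::real) * (T * 2 ^ l) + 1) * ?p * (sqrt 2 * exp (- ((radius l)\<^sup>2 / 4)))
            \<le> (c * 2 ^ l) * ((2 * (d + 1)\<^sup>2 * (real l + 1)) * (2 * (d + 1)\<^sup>2 * (real l + 1))) * (2 * (1 / 5) ^ l)"
          by (rule mult_mono[OF mult_mono[OF 1 3] 2]) (use pos in auto)
        also have "\<dots> = K * r l"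
          by (simp add: K_def r_def power2_eq_square eval_nat_numeral)
        finally have "((2::real) * (T * 2 ^ l) + 1) * ?p * (sqrt 2 * exp (- ((radius l)\<^sup>2 / 4))) \<le> K * r l" .
        moreover have "b l = ((2::real) * (T * 2 ^ l) + 1) * ?p * (sqrt 2 * exp (- ((radius l)\<^sup>2 / 4)))"
          by (simp only: b_def rots_def d_def of_nat_mult of_nat_add of_nat_Suc of_nat_1 of_nat_numeral
            of_nat_power add.commute mult.assoc)
        moreover have "0 \<le> b l" by (simp add: b_def)
        ultimately show ?thesis by linarith
      qed
      have "\<bar>b l\<bar> \<le> K * \<bar>r l\<bar>" for l
        using b_le[of l] by (simp add: r_def)
      then have "b \<in> O(r)"
        by (intro bigoI[of _ K] always_eventually) simp
      also have "r \<in> O(\<lambda>l. 1 / (2::real) ^ l)"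
      proof (rule bigoI_tendsto)
        have "r l / (1 / 2 ^ l) = (real l + 1)\<^sup>2 * (4 / 5) ^ l" for l
        proof -
          have "(2::real) ^ l * 2 ^ l * (1 / 5) ^ l = (4 / 5) ^ l"
            unfolding power_mult_distrib[symmetric] by simp
          then show ?thesis by (simp add: r_def mult_ac)
        qed
        moreover have "(\<lambda>l. (real l + 1)\<^sup>2 * (4 / 5) ^ l) \<longlonglongrightarrow> 0"
          by real_asymp
        ultimately show "(\<lambda>l. r l / (1 / 2 ^ l)) \<longlonglongrightarrow> 0" by (simp only:)
      qed simp
      finally show ?thesis .
    qed
    finally show "(\<lambda>l. measure white_noise (A l)) \<in> O(\<lambda>l. 1 / (2::real) ^ l)" .
  qed
  then have "AE x in white_noise. \<forall>\<^sub>F l in sequentially. x \<in> space white_noise - A l"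
    using prob_not_tame_orbit(1)[OF R]
    by (intro borel_cantelli_AE1) (auto simp: A_def white_noise.emeasure_eq_measure)
  then show "AE x in white_noise. \<forall>\<^sub>F l in sequentially. tame_orbit (1 / 2 ^ l) (rots l) (radius l) (T * 2 ^ l) x"
    by (simp add: A_def)
qed

text \<open>
  What the limit \<open>l \<rightarrow> \<infinity>\<close> uses of level \<open>l\<close>: a bound, small steps, the Euler relation, and closeness to
  the next level. The next level has the index \<open>2 k\<close> or \<open>2 k + 1\<close> at a time with index \<open>k\<close>. The
  number of sites involved grows with \<open>l\<close>.
\<close>

definition tracked :: "nat \<Rightarrow> nat \<Rightarrow> (nat \<Rightarrow> real) \<Rightarrow> bool" where
  "tracked T l x \<longleftrightarrow>
    (\<forall>k s. \<bar>k\<bar> \<le> int (T * 2 ^ l) \<longrightarrow> s \<le> l \<longrightarrow>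
      \<bar>level l k x s\<bar> \<le> radius l \<and>
      \<bar>level l (k + 1) x s - level l k x s\<bar> \<le> (3 / 4) ^ l \<and>
      \<bar>level l (k + 1) x s - level l k x s - field (level l k x) s / 2 ^ l\<bar> \<le> (3 / 4) ^ l / 2 ^ l \<and>
      \<bar>level (Suc l) (2 * k) x s - level l k x s\<bar> \<le> (3 / 4) ^ l \<and>
      \<bar>level (Suc l) (2 * k + 1) x s - level l k x s\<bar> \<le> (3 / 4) ^ l)"

lemma tame_orbit_mono: "tame_orbit h n R N x \<Longrightarrow> R \<le> R' \<Longrightarrow> tame_orbit h n R' N x"
  unfolding tame_orbit_def tame_def by (meson order_trans)

text \<open>
  All errors are at most a constant times \<open>2\<^sup>-\<^sup>l R\<^sup>3 exp (B R)\<close> with \<open>R\<close> of order \<open>\<surd>l\<close>, and this is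
  eventually below \<open>(3/4)\<^sup>l / 2\<close>.
\<close>

lemma eventually_tracked:
  assumes tame: "\<forall>\<^sub>F l in sequentially. tame_orbit (1 / 2 ^ l) (rots l) (radius l) (T * 2 ^ l) x"
  shows "\<forall>\<^sub>F l in sequentially. tracked T l x"
proof -
  define A where "A = real D * C"
  have A: "0 \<le> A" using C_nonneg by (simp add: A_def)
  define B where "B = 4 * A * real T + 1"
  have B: "0 < B" using A by (auto simp: B_def intro: add_nonneg_pos)
  define G where "G = 2 + 18 * A\<^sup>2 * real T + 5 * A\<^sup>2 + 2 * A"
  have G: "0 < G" using A by (auto simp: G_def intro!: add_pos_nonneg)
  define P where "P l = radius (Suc l) ^ 3 * exp (B * radius (Suc l))" for l
  have "(\<lambda>l. G * ((2 / 3) ^ l * P l)) \<longlonglongrightarrow> G * 0"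
    unfolding P_def radius_def by (intro tendsto_mult tendsto_const exp_sqrt_subexponential B)
  then have "\<forall>\<^sub>F l in sequentially. G * ((2 / 3) ^ l * P l) < 1 / 2"
    by (rule order_tendstoD(2)) simp
  moreover have "\<forall>\<^sub>F l in sequentially. tame_orbit (1 / 2 ^ Suc l) (rots (Suc l)) (radius (Suc l)) (T * 2 ^ Suc l) x"
    using tame by (rule eventually_compose_filterlim[OF _ filterlim_Suc])
  ultimately show ?thesis
    using tame
  proof eventually_elim
    case (elim l)
    let ?h = "1 / 2 ^ l :: real" and ?R = "radius (Suc l)"
    have R: "1 \<le> ?R" by (simp add: radius_def)
    have R3: "?R \<le> ?R ^ 3" "?R\<^sup>2 \<le> ?R ^ 3" "1 \<le> ?R ^ 3"
      using R self_le_power[of ?R 3] power_increasing[of 2 3 ?R] one_le_power[of ?R 3] by auto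
    have small: "?h * (G * P l) \<le> (3 / 4) ^ l / 2"
    proof -
      have "(3 / 4 :: real) ^ l * (2 / 3) ^ l = (1 / 2) ^ l"
        by (subst power_mult_distrib[symmetric]) simp
      then have "?h = (3 / 4) ^ l * (2 / 3) ^ l"
        by (simp add: power_one_over)
      then have "?h * (G * P l) = (3 / 4) ^ l * (G * ((2 / 3) ^ l * P l))"
        by simp
      also have "\<dots> \<le> (3 / 4) ^ l * (1 / 2)"
        using elim(1) by (intro mult_left_mono) auto
      finally show ?thesis by simp
    qed
    have e1: "1 \<le> exp (B * ?R)" using B R by simp
    have R3P: "?R ^ 3 \<le> P l"
      using mult_left_mono[OF e1, of "?R ^ 3"] R by (simp add: P_def)
    have move: "2 * real D * ?h * C * ?R\<^sup>2 \<le> (3 / 4) ^ l / 2"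
    proof -
      have "2 * A * ?R\<^sup>2 \<le> G * P l"
        using A R R3 R3P by (intro mult_mono) (auto simp: G_def)
      then have "?h * (2 * A * ?R\<^sup>2) \<le> ?h * (G * P l)" by (intro mult_left_mono) auto
      moreover have "2 * real D * ?h * C * ?R\<^sup>2 = ?h * (2 * A * ?R\<^sup>2)" by (simp add: A_def)
      ultimately show ?thesis using small by linarith
    qed
    have tame: "tame_orbit ?h (rots l) ?R (T * 2 ^ l) x"
      by (rule tame_orbit_mono[OF elim(3)]) (simp add: radius_def)
    have tame': "tame_orbit (?h / 2) (rots (Suc l)) ?R (2 * (T * 2 ^ l)) x"
      using elim(2) by (simp add: mult_ac)
    have h: "0 \<le> ?h" "0 \<le> ?h / 2" by auto
    show ?case
      unfolding tracked_def
    proof (intro allI impI)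
      fix k :: int and s :: nat
      assume k: "\<bar>k\<bar> \<le> int (T * 2 ^ l)" and s: "s \<le> l"
      define t where "t = ?h * \<bar>real_of_int k\<bar>"
      have t: "0 \<le> t" "t \<le> real T"
      proof -
        have "real_of_int \<bar>k\<bar> \<le> real_of_int (int (T * 2 ^ l))"
          using k by (simp only: of_int_le_iff)
        then have "\<bar>real_of_int k\<bar> \<le> real T * 2 ^ l" by simp
        then show "t \<le> real T" by (simp add: t_def field_simps)
      qed (simp add: t_def)
      have S: "D * ((D + 1) * l + 1) \<le> rots l" "D * ((D + 1) * l + 1) \<le> rots (Suc l)"
        unfolding rots_def by (intro mult_left_mono; simp)+
      have sD: "D * (s + 1) \<le> rots l" "s < rots l + D"
      proof -
        have "s + 1 \<le> (D + 1) * l + 1" using s by (simp add: trans_le_add2)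
        then show *: "D * (s + 1) \<le> rots l" unfolding rots_def by (rule mult_left_mono) simp
        have "s < D * (s + 1)" using D_pos by (cases D) auto
        with * show "s < rots l + D" by linarith
      qed
      have "tame ?h (rots l) (radius l) (level l k x)"
        using elim(3) k by (auto simp: tame_orbit_def level_def)
      then have 1: "\<bar>level l k x s\<bar> \<le> radius l"
        using sD(2) by (rule tame_bound)
      have 2: "\<bar>level l (k + 1) x s - level l k x s\<bar> \<le> (3 / 4) ^ l"
        using orbit_move[OF tame h(1) k, of s] move by (simp add: level_def)
      have 3: "\<bar>level l (k + 1) x s - level l k x s - field (level l k x) s / 2 ^ l\<bar> \<le> (3 / 4) ^ l / 2 ^ l"
      proof -
        have "tame ?h (rots l) ?R (level l k x)"
          using tame k by (auto simp: tame_orbit_def level_def)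
        from sweep_error[OF this h(1) sD(1)]
        have "\<bar>level l (k + 1) x s - level l k x s - ?h * field (level l k x) s\<bar>
            \<le> ?h\<^sup>2 * (5 * (real D)\<^sup>2 * C\<^sup>2 * ?R ^ 3)"
          by (simp add: level_def orbit_succ)
        also have "5 * (real D)\<^sup>2 * C\<^sup>2 * ?R ^ 3 \<le> G * P l"
        proof -
          have "5 * A\<^sup>2 * ?R ^ 3 \<le> G * P l"
            using A R R3P by (intro mult_mono) (auto simp: G_def)
          then show ?thesis by (simp add: A_def power_mult_distrib mult_ac)
        qed
        also have "?h\<^sup>2 * (G * P l) = ?h * (?h * (G * P l))"
          by (simp add: power2_eq_square)
        also have "\<dots> \<le> ?h * ((3 / 4) ^ l)"
          by (intro mult_left_mono order_trans[OF small]) simp_all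
        finally show ?thesis by simp
      qed
      have 4: "\<bar>level (Suc l) (2 * k) x s - level l k x s\<bar> \<le> (3 / 4) ^ l / 2"
      proof -
        let ?X = "2 * real D * C * ?R * t"
        have X: "0 \<le> ?X" "2 * ?X \<le> B * ?R" "?X \<le> B * ?R"
        proof -
          show "0 \<le> ?X" using C_nonneg R t by simp
          have "4 * A * ?R * t \<le> 4 * A * ?R * T"
            using A R t by (intro mult_left_mono) auto
          also have "\<dots> \<le> B * ?R" using R by (simp add: B_def algebra_simps)
          finally show *: "2 * ?X \<le> B * ?R" by (simp add: A_def mult_ac)
          with \<open>0 \<le> ?X\<close> show "?X \<le> B * ?R" by linarith
        qed
        have "s + l * D \<le> (D + 1) * l" using s by (simp add: mult.commute)
        from orbit_refinement[OF tame tame' h(1) S k this]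
        have "\<bar>level (Suc l) (2 * k) x s - level l k x s\<bar>
            \<le> 2 * ?R * ?X ^ l / fact l + ?h * (18 * (real D)\<^sup>2 * C\<^sup>2 * ?R ^ 3) * t * exp ?X"
          by (simp add: level_def t_def abs_minus_commute mult.commute)
        also have "\<dots> \<le> ?h * (2 * P l) + ?h * (18 * A\<^sup>2 * T * P l)"
        proof (rule add_mono)
          have "2 * ?R * ?X ^ l / fact l = 2 * ?R * (?X ^ l / fact l)" by simp
          also have "\<dots> \<le> 2 * ?R * (exp (2 * ?X) / 2 ^ l)"
            using abs_power_divide_fact_le[OF X(1), of l] R by (intro mult_left_mono) auto
          also have "\<dots> = ?h * (2 * (?R * exp (2 * ?X)))" by simp
          also have "\<dots> \<le> ?h * (2 * P l)"
            unfolding P_def using R R3 X by (intro mult_left_mono mult_mono) auto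
          finally show "2 * ?R * ?X ^ l / fact l \<le> ?h * (2 * P l)" .
          have "18 * A\<^sup>2 * t * (?R ^ 3 * exp ?X) \<le> 18 * A\<^sup>2 * T * P l"
            unfolding P_def using R X t by (intro mult_mono) auto
          then have "?h * (18 * A\<^sup>2 * t * (?R ^ 3 * exp ?X)) \<le> ?h * (18 * A\<^sup>2 * T * P l)"
            by (intro mult_left_mono) auto
          then show "?h * (18 * (real D)\<^sup>2 * C\<^sup>2 * ?R ^ 3) * t * exp ?X \<le> ?h * (18 * A\<^sup>2 * T * P l)"
            by (simp add: A_def power_mult_distrib mult_ac)
        qed
        also have "\<dots> = ?h * ((2 + 18 * A\<^sup>2 * T) * P l)"
          by (simp add: algebra_simps)
        also have "\<dots> \<le> ?h * (G * P l)"
          using A R R3P R3 by (intro mult_left_mono mult_right_mono) (auto simp: G_def)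
        finally show ?thesis using small by linarith
      qed
      have "\<bar>2 * k\<bar> \<le> int (2 * (T * 2 ^ l))" using k by auto
      from orbit_move[OF tame' h(2) this, of s]
      have "\<bar>level (Suc l) (2 * k + 1) x s - level (Suc l) (2 * k) x s\<bar> \<le> 2 * real D * (?h / 2) * C * ?R\<^sup>2"
        by (simp add: level_def mult.commute)
      also have "\<dots> \<le> 2 * real D * ?h * C * ?R\<^sup>2"
        using C_nonneg by (intro mult_right_mono mult_left_mono) (auto simp: field_simps)
      finally have 5: "\<bar>level (Suc l) (2 * k + 1) x s - level l k x s\<bar> \<le> (3 / 4) ^ l"
        using move 4 by linarith
      have "(3 / 4) ^ l / 2 \<le> (3 / 4 :: real) ^ l" by simp
      with 1 2 3 4 5 show "\<bar>level l k x s\<bar> \<le> radius l \<and>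
          \<bar>level l (k + 1) x s - level l k x s\<bar> \<le> (3 / 4) ^ l \<and>
          \<bar>level l (k + 1) x s - level l k x s - field (level l k x) s / 2 ^ l\<bar> \<le> (3 / 4) ^ l / 2 ^ l \<and>
          \<bar>level (Suc l) (2 * k) x s - level l k x s\<bar> \<le> (3 / 4) ^ l \<and>
          \<bar>level (Suc l) (2 * k + 1) x s - level l k x s\<bar> \<le> (3 / 4) ^ l"
        by linarith
    qed
  qed
qed

lemma AE_eventually_tracked: "AE x in white_noise. \<forall>T. \<forall>\<^sub>F l in sequentially. tracked T l x"
  using AE_tame_orbit by eventually_elim (blast intro: eventually_tracked)

end

section \<open>The limiting dynamics\<close>

lemma convergent_of_geometric_increments:
  fixes a :: "nat \<Rightarrow> real"
  assumes inc: "\<And>l. l0 \<le> l \<Longrightarrow> \<bar>a (Suc l) - a l\<bar> \<le> (3 / 4) ^ l"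
  shows "a \<longlonglongrightarrow> lim a" and "l0 \<le> l \<Longrightarrow> \<bar>lim a - a l\<bar> \<le> 4 * (3 / 4) ^ l"
proof -
  have tail: "\<bar>a m - a l\<bar> \<le> 4 * (3 / 4) ^ l - 4 * (3 / 4) ^ m" if "l0 \<le> l" "l \<le> m" for l m
    using that(2)
  proof (induction m rule: dec_induct)
    case (step m)
    then show ?case using inc[of m] that(1) by simp
  qed simp
  have tail': "\<bar>a m - a l\<bar> \<le> 4 * (3 / 4) ^ l" if "l0 \<le> l" "l \<le> m" for l m
    using tail[OF that] zero_le_power[of "3 / 4 :: real" m] by linarith
  have "Cauchy a"
  proof (rule metric_CauchyI)
    fix e :: real assume "0 < e"
    have "(\<lambda>l. 8 * (3 / 4 :: real) ^ l) \<longlonglongrightarrow> 8 * 0"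
      by (intro tendsto_mult tendsto_const LIMSEQ_realpow_zero) auto
    then have "\<forall>\<^sub>F l in sequentially. 8 * (3 / 4 :: real) ^ l < e"
      using \<open>0 < e\<close> by (intro order_tendstoD(2)) auto
    then obtain l1 where l1: "\<And>l. l1 \<le> l \<Longrightarrow> 8 * (3 / 4 :: real) ^ l < e"
      by (auto simp: eventually_sequentially)
    define l where "l = max l0 l1"
    have "dist (a m) (a n) < e" if "l \<le> m" "l \<le> n" for m n
      using tail'[of l m] tail'[of l n] l1[of l] that by (simp add: l_def dist_real_def)
    then show "\<exists>M. \<forall>m\<ge>M. \<forall>n\<ge>M. dist (a m) (a n) < e" by blast
  qed
  then show lim: "a \<longlonglongrightarrow> lim a"
    by (simp add: Cauchy_convergent_iff convergent_LIMSEQ_iff)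
  assume "l0 \<le> l"
  have "(\<lambda>m. \<bar>a m - a l\<bar>) \<longlonglongrightarrow> \<bar>lim a - a l\<bar>"
    by (intro tendsto_intros lim)
  then show "\<bar>lim a - a l\<bar> \<le> 4 * (3 / 4) ^ l"
    by (rule tendsto_upperbound)
      (use tail'[OF \<open>l0 \<le> l\<close>] in \<open>auto simp: eventually_sequentially\<close>)
qed

lemma abs_floor_scaled_le:
  assumes "\<bar>t\<bar> \<le> real T"
  shows "\<bar>\<lfloor>t * 2 ^ l\<rfloor>\<bar> \<le> int (T * 2 ^ l)"
proof -
  have t: "- real T \<le> t" "t \<le> real T" using assms by auto
  have "of_int (- int (T * 2 ^ l)) \<le> t * 2 ^ l" "t * 2 ^ l \<le> of_int (int (T * 2 ^ l))"
    using mult_right_mono[OF t(1), of "2 ^ l"] mult_right_mono[OF t(2), of "2 ^ l"] by simp_all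
  then have "- int (T * 2 ^ l) \<le> \<lfloor>t * 2 ^ l\<rfloor>" "\<lfloor>t * 2 ^ l\<rfloor> \<le> int (T * 2 ^ l)"
    by (linarith | simp add: le_floor_iff)+
  then show ?thesis by linarith
qed

lemma floor_scaled_tendsto: "(\<lambda>l. of_int \<lfloor>t * 2 ^ l\<rfloor> / 2 ^ l) \<longlonglongrightarrow> (t :: real)"
proof (rule real_tendsto_sandwich)
  show "\<forall>\<^sub>F l in sequentially. t - (1 / 2) ^ l \<le> of_int \<lfloor>t * 2 ^ l\<rfloor> / 2 ^ l"
  proof (rule always_eventually, rule allI)
    fix l
    have "(t * 2 ^ l - 1) / 2 ^ l \<le> of_int \<lfloor>t * 2 ^ l\<rfloor> / 2 ^ l"
      by (intro divide_right_mono) (linarith | simp)+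
    then show "t - (1 / 2) ^ l \<le> of_int \<lfloor>t * 2 ^ l\<rfloor> / 2 ^ l"
      by (simp add: diff_divide_distrib power_one_over)
  qed
  show "\<forall>\<^sub>F l in sequentially. of_int \<lfloor>t * 2 ^ l\<rfloor> / 2 ^ l \<le> t"
    by (rule always_eventually) (simp add: divide_le_eq)
  have "(\<lambda>l. t - (1 / 2) ^ l) \<longlonglongrightarrow> t - 0"
    by (intro tendsto_diff tendsto_const LIMSEQ_realpow_zero) auto
  then show "(\<lambda>l. t - (1 / 2) ^ l) \<longlonglongrightarrow> t" by simp
qed simp

lemma sum_of_increments_le:
  fixes v :: "int \<Rightarrow> real"
  assumes "\<And>k. k0 \<le> k \<Longrightarrow> k < k1 \<Longrightarrow> \<bar>v (k + 1) - v k - c\<bar> \<le> e" and "k0 \<le> k1"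
  shows "\<bar>v k1 - v k0 - of_int (k1 - k0) * c\<bar> \<le> of_int (k1 - k0) * e"
proof -
  have "k \<le> k1 \<longrightarrow> \<bar>v k - v k0 - of_int (k - k0) * c\<bar> \<le> of_int (k - k0) * e" if "k0 \<le> k" for k
    using that
  proof (induction k rule: int_ge_induct)
    case (step k)
    then show ?case using assms(1)[of k] by (auto simp: algebra_simps)
  qed simp
  with assms(2) show ?thesis by simp
qed

context rotators
begin

definition flow :: "real \<Rightarrow> (nat \<Rightarrow> real) \<Rightarrow> nat \<Rightarrow> real" where
  "flow t x s = lim (\<lambda>l. level l \<lfloor>t * 2 ^ l\<rfloor> x s)"

definition regular :: "(nat \<Rightarrow> real) \<Rightarrow> bool" where
  "regular x \<longleftrightarrow> (\<forall>T. \<forall>\<^sub>F l in sequentially. tracked T l x)"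

lemma trackedD:
  assumes "tracked T l x" "\<bar>k\<bar> \<le> int (T * 2 ^ l)" "s \<le> l"
  shows "\<bar>level l k x s\<bar> \<le> radius l"
    and "\<bar>level l (k + 1) x s - level l k x s\<bar> \<le> (3 / 4) ^ l"
    and "\<bar>level l (k + 1) x s - level l k x s - field (level l k x) s / 2 ^ l\<bar> \<le> (3 / 4) ^ l / 2 ^ l"
    and "\<bar>level (Suc l) (2 * k) x s - level l k x s\<bar> \<le> (3 / 4) ^ l"
    and "\<bar>level (Suc l) (2 * k + 1) x s - level l k x s\<bar> \<le> (3 / 4) ^ l"
  using assms unfolding tracked_def by simp_all

lemma flow_approx:
  assumes "regular x"
  obtains l0 where "\<And>l. l0 \<le> l \<Longrightarrow> tracked T l x"
    and "\<And>l t s. l0 \<le> l \<Longrightarrow> s \<le> l \<Longrightarrow> \<bar>t\<bar> \<le> real T \<Longrightarrow>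
      \<bar>flow t x s - level l \<lfloor>t * 2 ^ l\<rfloor> x s\<bar> \<le> 4 * (3 / 4) ^ l"
    and "\<And>t s. \<bar>t\<bar> \<le> real T \<Longrightarrow> (\<lambda>l. level l \<lfloor>t * 2 ^ l\<rfloor> x s) \<longlonglongrightarrow> flow t x s"
proof -
  from assms obtain l0 where l0: "\<And>l. l0 \<le> l \<Longrightarrow> tracked T l x"
    by (auto simp: regular_def eventually_sequentially)
  have inc: "\<bar>level (Suc l) \<lfloor>t * 2 ^ Suc l\<rfloor> x s - level l \<lfloor>t * 2 ^ l\<rfloor> x s\<bar> \<le> (3 / 4) ^ l"
    if "max l0 s \<le> l" "\<bar>t\<bar> \<le> real T" for l t s
  proof -
    have sl: "s \<le> l" "tracked T l x" using that l0 by auto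
    have "\<lfloor>t * 2 ^ Suc l\<rfloor> = 2 * \<lfloor>t * 2 ^ l\<rfloor> \<or> \<lfloor>t * 2 ^ Suc l\<rfloor> = 2 * \<lfloor>t * 2 ^ l\<rfloor> + 1"
      unfolding power_Suc mult.left_commute[of t 2] by linarith
    then show ?thesis
    proof
      assume "\<lfloor>t * 2 ^ Suc l\<rfloor> = 2 * \<lfloor>t * 2 ^ l\<rfloor>"
      then show ?thesis
        using trackedD(4)[OF sl(2) abs_floor_scaled_le[OF that(2)] sl(1)] by (simp only:)
    next
      assume "\<lfloor>t * 2 ^ Suc l\<rfloor> = 2 * \<lfloor>t * 2 ^ l\<rfloor> + 1"
      then show ?thesis
        using trackedD(5)[OF sl(2) abs_floor_scaled_le[OF that(2)] sl(1)] by (simp only:)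
    qed
  qed
  show thesis
  proof (rule that[OF l0])
    fix l t s assume l: "l0 \<le> l" "s \<le> l" and t: "\<bar>t\<bar> \<le> real T"
    show "\<bar>flow t x s - level l \<lfloor>t * 2 ^ l\<rfloor> x s\<bar> \<le> 4 * (3 / 4) ^ l"
      unfolding flow_def
      by (rule convergent_of_geometric_increments(2)[of "max l0 s" "\<lambda>l. level l \<lfloor>t * 2 ^ l\<rfloor> x s", OF inc[OF _ t]])
        (use l in simp_all)
  next
    fix t s assume t: "\<bar>t\<bar> \<le> real T"
    show "(\<lambda>l. level l \<lfloor>t * 2 ^ l\<rfloor> x s) \<longlonglongrightarrow> flow t x s"
      unfolding flow_def
      by (rule convergent_of_geometric_increments(1)[of "max l0 s" "\<lambda>l. level l \<lfloor>t * 2 ^ l\<rfloor> x s", OF inc[OF _ t]])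
  qed
qed

text \<open>
  At the site \<open>s\<close> the level \<open>l\<^sub>0 + s\<close> is already accurate, and it is bounded by its radius.
\<close>

lemma flow_growth:
  assumes "regular x"
  shows "\<exists>A\<ge>0. \<forall>t s. \<bar>t\<bar> \<le> real T \<longrightarrow> \<bar>flow t x s\<bar> \<le> A * (real s + 1)"
proof -
  obtain l0 where l0: "\<And>l. l0 \<le> l \<Longrightarrow> tracked T l x"
    and approx: "\<And>l t s. l0 \<le> l \<Longrightarrow> s \<le> l \<Longrightarrow> \<bar>t\<bar> \<le> real T \<Longrightarrow>
      \<bar>flow t x s - level l \<lfloor>t * 2 ^ l\<rfloor> x s\<bar> \<le> 4 * (3 / 4) ^ l"
    and conv: "\<And>t s. \<bar>t\<bar> \<le> real T \<Longrightarrow> (\<lambda>l. level l \<lfloor>t * 2 ^ l\<rfloor> x s) \<longlonglongrightarrow> flow t x s"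
    by (rule flow_approx[OF assms, of T]) (rule that; assumption)
  define A where "A = 8 * real l0 + 13"
  have "\<bar>flow t x s\<bar> \<le> A * (real s + 1)" if t: "\<bar>t\<bar> \<le> real T" for t s
  proof -
    let ?l = "l0 + s"
    have "\<bar>level ?l \<lfloor>t * 2 ^ ?l\<rfloor> x s\<bar> \<le> radius ?l"
      using t by (intro trackedD(1)[OF l0] abs_floor_scaled_le) auto
    moreover have "\<bar>flow t x s - level ?l \<lfloor>t * 2 ^ ?l\<rfloor> x s\<bar> \<le> 4 * (3 / 4) ^ ?l"
      using t by (intro approx) auto
    moreover have "(3 / 4) ^ ?l \<le> (1::real)" by (rule power_le_one) auto
    moreover have "radius ?l \<le> 8 * real ?l + 1"
      unfolding radius_def by (rule real_le_lsqrt) (auto simp: power2_eq_square algebra_simps)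
    ultimately have "\<bar>flow t x s\<bar> \<le> 8 * real ?l + 5" by linarith
    also have "\<dots> \<le> A * (real s + 1)" by (simp add: A_def algebra_simps)
    finally show ?thesis .
  qed
  then show ?thesis by (intro exI[of _ A]) (auto simp: A_def)
qed

lemma field_approx:
  assumes "regular x"
  obtains K where "\<forall>\<^sub>F l in sequentially. \<forall>k. \<bar>k\<bar> \<le> int (T * 2 ^ l) \<longrightarrow>
      \<bar>level l (k + 1) x s - level l k x s - field (flow (of_int k / 2 ^ l) x) s / 2 ^ l\<bar>
        \<le> K * (3 / 4) ^ l / 2 ^ l"
proof -
  obtain l0 where l0: "\<And>l. l0 \<le> l \<Longrightarrow> tracked T l x"
    and approx: "\<And>l t s. l0 \<le> l \<Longrightarrow> s \<le> l \<Longrightarrow> \<bar>t\<bar> \<le> real T \<Longrightarrow>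
      \<bar>flow t x s - level l \<lfloor>t * 2 ^ l\<rfloor> x s\<bar> \<le> 4 * (3 / 4) ^ l"
    and conv: "\<And>t s. \<bar>t\<bar> \<le> real T \<Longrightarrow> (\<lambda>l. level l \<lfloor>t * 2 ^ l\<rfloor> x s) \<longlonglongrightarrow> flow t x s"
    by (rule flow_approx[OF assms, of T]) (rule that; assumption)
  obtain A where A: "0 \<le> A" "\<And>t s. \<bar>t\<bar> \<le> real T \<Longrightarrow> \<bar>flow t x s\<bar> \<le> A * (real s + 1)"
    using flow_growth[OF assms, of T] by blast
  define R where "R = A * (real (s + D) + 1) + 4"
  define K where "K = 2 * real D * C * R * 4 + 1"
  have "\<bar>level l (k + 1) x s - level l k x s - field (flow (of_int k / 2 ^ l) x) s / 2 ^ l\<bar>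
      \<le> K * (3 / 4) ^ l / 2 ^ l"
    if l: "max l0 (s + D) \<le> l" and k: "\<bar>k\<bar> \<le> int (T * 2 ^ l)" for l k
  proof -
    define t where "t = (of_int k / 2 ^ l :: real)"
    have fl: "\<lfloor>t * 2 ^ l\<rfloor> = k" by (simp add: t_def)
    have t: "\<bar>t\<bar> \<le> real T"
    proof -
      have "real_of_int \<bar>k\<bar> \<le> real_of_int (int (T * 2 ^ l))"
        using k by (simp only: of_int_le_iff)
      then show ?thesis by (simp add: t_def divide_le_eq)
    qed
    have "\<bar>field (level l k x) s - field (flow t x) s\<bar> \<le> 2 * real D * C * R * (4 * (3 / 4) ^ l)"
    proof (rule field_lipschitz)
      fix s' assume s': "s' \<le> s + D"
      have 1: "\<bar>flow t x s' - level l k x s'\<bar> \<le> 4 * (3 / 4) ^ l"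
        using approx[of l s' t] l s' t by (simp add: fl)
      have 2: "\<bar>flow t x s'\<bar> \<le> R - 4"
      proof -
        have "A * (real s' + 1) \<le> A * (real (s + D) + 1)"
          using s' A(1) by (intro mult_left_mono) auto
        with A(2)[OF t, of s'] show ?thesis by (simp add: R_def)
      qed
      have "(3 / 4) ^ l \<le> (1::real)" by (rule power_le_one) auto
      with 1 2 show "\<bar>level l k x s'\<bar> \<le> R \<and> \<bar>flow t x s'\<bar> \<le> R \<and> \<bar>level l k x s' - flow t x s'\<bar> \<le> 4 * (3 / 4) ^ l"
        by linarith
    qed
    then have "\<bar>field (level l k x) s - field (flow t x) s\<bar> / 2 ^ l \<le> 2 * real D * C * R * (4 * (3 / 4) ^ l) / 2 ^ l"
      by (rule divide_right_mono) simp
    then have "\<bar>field (level l k x) s / 2 ^ l - field (flow t x) s / 2 ^ l\<bar>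
        \<le> 2 * real D * C * R * (4 * (3 / 4) ^ l) / 2 ^ l"
      by (simp add: diff_divide_distrib[symmetric])
    moreover have "\<bar>level l (k + 1) x s - level l k x s - field (level l k x) s / 2 ^ l\<bar> \<le> (3 / 4) ^ l / 2 ^ l"
      using l by (intro trackedD(3)[OF l0 k]) auto
    moreover have "K * (3 / 4) ^ l / 2 ^ l = 2 * real D * C * R * (4 * (3 / 4) ^ l) / 2 ^ l + (3 / 4) ^ l / 2 ^ l"
      by (simp add: K_def field_simps)
    ultimately show ?thesis
      unfolding t_def by linarith
  qed
  then show thesis
    by (intro that[of K] eventually_sequentiallyI[of "max l0 (s + D)"]) blast
qed

text \<open>
  Summed over the grid points between \<open>t'\<close> and \<open>t\<close>, the Euler relation of level \<open>l\<close> becomes this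
  mean value inequality in the limit. It yields first the continuity of the limit and then its
  derivative.
\<close>

lemma flow_mean_value:
  assumes reg: "regular x" and ab: "- real T \<le> a" "a < t'" "t' \<le> t" "t \<le> b" "b \<le> real T"
    and near: "\<And>r. a \<le> r \<Longrightarrow> r \<le> b \<Longrightarrow> \<bar>field (flow r x) s - \<gamma>\<bar> \<le> \<epsilon>"
  shows "\<bar>flow t x s - flow t' x s - (t - t') * \<gamma>\<bar> \<le> (t - t') * \<epsilon>"
proof -
  obtain K where K: "\<forall>\<^sub>F l in sequentially. \<forall>k. \<bar>k\<bar> \<le> int (T * 2 ^ l) \<longrightarrow>
      \<bar>level l (k + 1) x s - level l k x s - field (flow (of_int k / 2 ^ l) x) s / 2 ^ l\<bar>
        \<le> K * (3 / 4) ^ l / 2 ^ l"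
    by (rule field_approx[OF reg])
  have conv: "(\<lambda>l. level l \<lfloor>r * 2 ^ l\<rfloor> x s) \<longlonglongrightarrow> flow r x s" if "\<bar>r\<bar> \<le> real T" for r
    by (rule flow_approx[OF reg, of T]) (use that in blast)
  define k0 k1 where "k0 l = \<lfloor>t' * 2 ^ l\<rfloor>" and "k1 l = \<lfloor>t * 2 ^ l\<rfloor>" for l :: nat
  define p where "p l = of_int (k1 l) / 2 ^ l - of_int (k0 l) / (2 ^ l :: real)" for l
  have p: "p \<longlonglongrightarrow> t - t'"
    unfolding p_def k0_def k1_def by (intro tendsto_diff floor_scaled_tendsto)
  \<comment> \<open>The gap between \<open>a\<close> and \<open>t'\<close> leaves room for the grid point below \<open>t'\<close>.\<close>
  have "\<forall>\<^sub>F l in sequentially. a < of_int (k0 l) / 2 ^ l"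
    unfolding k0_def using ab by (intro order_tendstoD(1)[OF floor_scaled_tendsto])
  with K have "\<forall>\<^sub>F l in sequentially.
      \<bar>level l (k1 l) x s - level l (k0 l) x s - p l * \<gamma>\<bar> \<le> p l * (\<epsilon> + K * (3 / 4) ^ l)"
  proof eventually_elim
    case (elim l)
    have le: "k0 l \<le> k1 l"
      unfolding k0_def k1_def using ab by (intro floor_mono mult_right_mono) auto
    have "\<bar>level l (k + 1) x s - level l k x s - \<gamma> / 2 ^ l\<bar> \<le> (\<epsilon> + K * (3 / 4) ^ l) / 2 ^ l"
      if k: "k0 l \<le> k" "k < k1 l" for k
    proof -
      define r where "r = (of_int k / 2 ^ l :: real)"
      have "of_int (k0 l) / 2 ^ l \<le> r"
        unfolding r_def using k by (intro divide_right_mono) auto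
      moreover have "r \<le> of_int (k1 l) / 2 ^ l"
        unfolding r_def using k by (intro divide_right_mono) auto
      moreover have "of_int (k1 l) / 2 ^ l \<le> t"
        by (simp add: k1_def divide_le_eq)
      ultimately have r: "a \<le> r" "r \<le> b" "\<bar>r\<bar> \<le> real T"
        using elim(2) ab by auto
      have "\<bar>k\<bar> \<le> int (T * 2 ^ l)"
        using abs_floor_scaled_le[OF r(3), of l] by (simp add: r_def)
      then have "\<bar>level l (k + 1) x s - level l k x s - field (flow r x) s / 2 ^ l\<bar> \<le> K * (3 / 4) ^ l / 2 ^ l"
        using elim(1) by (simp add: r_def)
      moreover have "\<bar>field (flow r x) s / 2 ^ l - \<gamma> / 2 ^ l\<bar> \<le> \<epsilon> / 2 ^ l"
        using divide_right_mono[OF near[OF r(1,2)], of "2 ^ l"]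
        by (simp add: diff_divide_distrib[symmetric])
      ultimately show ?thesis
        unfolding add_divide_distrib by linarith
    qed
    from sum_of_increments_le[of "k0 l" "k1 l" "\<lambda>k. level l k x s", OF this le]
    show ?case
      by (simp add: p_def diff_divide_distrib[symmetric])
  qed
  moreover have "(\<lambda>l. \<bar>level l (k1 l) x s - level l (k0 l) x s - p l * \<gamma>\<bar>) \<longlonglongrightarrow> \<bar>flow t x s - flow t' x s - (t - t') * \<gamma>\<bar>"
    unfolding k0_def k1_def using ab by (intro tendsto_intros conv p) auto
  moreover have "(\<lambda>l. p l * (\<epsilon> + K * (3 / 4) ^ l)) \<longlonglongrightarrow> (t - t') * (\<epsilon> + K * 0)"
    by (intro tendsto_intros p LIMSEQ_realpow_zero) auto
  ultimately show ?thesis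
    by (intro tendsto_le[OF sequentially_bot, where g="\<lambda>l. \<bar>level l (k1 l) x s - level l (k0 l) x s - p l * \<gamma>\<bar>"]) auto
qed

lemma continuous_flow:
  assumes "regular x"
  shows "isCont (\<lambda>t. flow t x s) t"
proof -
  define T where "T = nat \<lceil>\<bar>t\<bar>\<rceil> + 2"
  have T: "\<bar>t\<bar> + 2 \<le> real T" unfolding T_def by linarith
  obtain A where A: "0 \<le> A" "\<And>t s. \<bar>t\<bar> \<le> real T \<Longrightarrow> \<bar>flow t x s\<bar> \<le> A * (real s + 1)"
    using flow_growth[OF assms, of T] by blast
  define L where "L = real D * C * (A * (real (s + D) + 1))\<^sup>2"
  have bound: "\<bar>field (flow r x) s - 0\<bar> \<le> L" if "- real T \<le> r" "r \<le> real T" for r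
  proof -
    have r: "\<bar>r\<bar> \<le> real T" using that by auto
    have "\<bar>flow r x s'\<bar> \<le> A * (real (s + D) + 1)" if s': "s' \<le> s + D" for s'
    proof -
      have "A * (real s' + 1) \<le> A * (real (s + D) + 1)"
        using s' A(1) by (intro mult_left_mono) auto
      moreover have "\<bar>flow r x s'\<bar> \<le> A * (real s' + 1)"
        by (rule A(2)[OF r])
      ultimately show ?thesis by linarith
    qed
    then show ?thesis unfolding L_def by (simp add: field_le)
  qed
  have lip: "\<bar>flow r x s - flow r' x s\<bar> \<le> L * \<bar>r - r'\<bar>" if "\<bar>r - t\<bar> \<le> 1" "\<bar>r' - t\<bar> \<le> 1" for r r'
  proof (cases "r \<le> r'")
    case True
    then show ?thesis
      using flow_mean_value[OF assms, of T "- real T" r r' "real T" s 0 L] bound that T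
      by (simp add: abs_minus_commute mult.commute)
  next
    case False
    then show ?thesis
      using flow_mean_value[OF assms, of T "- real T" r' r "real T" s 0 L] bound that T
      by (simp add: mult.commute)
  qed
  have "((\<lambda>r. flow r x s - flow t x s) \<longlongrightarrow> 0) (at t)"
  proof (rule Lim_null_comparison)
    have "\<forall>\<^sub>F r in at t. \<bar>r - t\<bar> < 1"
      using eventually_at_ball[of 1 t UNIV] by (simp add: dist_real_def abs_minus_commute)
    then show "\<forall>\<^sub>F r in at t. norm (flow r x s - flow t x s) \<le> L * \<bar>r - t\<bar>"
      by eventually_elim (use lip in simp)
    have "((\<lambda>r. L * \<bar>r - t\<bar>) \<longlongrightarrow> L * \<bar>t - t\<bar>) (at t)"
      by (intro tendsto_intros)
    then show "((\<lambda>r. L * \<bar>r - t\<bar>) \<longlongrightarrow> 0) (at t)" by simp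
  qed
  then show ?thesis
    by (simp add: isCont_def LIM_zero_iff)
qed

lemma continuous_field_flow:
  assumes "regular x"
  shows "isCont (\<lambda>t. field (flow t x) s) t"
  unfolding field_def
proof (intro continuous_sum)
  fix m assume "m \<in> touch s"
  show "isCont (\<lambda>t. force m (flow t x) s) t"
    unfolding force_def by (cases "s = fi m"; cases "s = fj m")
      (auto intro!: continuous_mult continuous_minus continuous_const continuous_flow[OF assms])
qed

theorem flow_derivative:
  assumes reg: "regular x"
  shows "((\<lambda>t. flow t x s) has_real_derivative field (flow t x) s) (at t)"
  unfolding has_field_derivative_def has_derivative_at_alt
proof (intro conjI allI impI)
  show "bounded_linear ((*) (field (flow t x) s))"
    by (rule bounded_linear_mult_right)
  define T where "T = nat \<lceil>\<bar>t\<bar>\<rceil> + 2"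
  have T: "\<bar>t\<bar> + 2 \<le> real T" unfolding T_def by linarith
  fix e :: real assume "0 < e"
  with continuous_field_flow[OF reg, where s=s and t=t] obtain d where d: "0 < d"
    "\<And>r. \<bar>r - t\<bar> < d \<Longrightarrow> \<bar>field (flow r x) s - field (flow t x) s\<bar> < e"
    unfolding continuous_at_eps_delta by (metis real_norm_def dist_real_def)
  define c where "c = min 1 (d / 2)"
  have c: "0 < c" "c \<le> 1" "c < d" using d(1) by (auto simp: c_def min_def)
  have near: "\<bar>field (flow r x) s - field (flow t x) s\<bar> \<le> e" if "t - c \<le> r" "r \<le> t + c" for r
  proof -
    have "\<bar>r - t\<bar> < d" using that c by linarith
    from d(2)[OF this] show ?thesis by simp
  qed
  have "norm (flow r x s - flow t x s - field (flow t x) s * (r - t)) \<le> e * norm (r - t)"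
    if "norm (r - t) < c" for r
  proof (cases "t \<le> r")
    case True
    then show ?thesis
      using flow_mean_value[OF reg, of T "t - c" t r "t + c" s "field (flow t x) s" e] near that T c
      by (simp add: mult.commute)
  next
    case False
    then show ?thesis
      using flow_mean_value[OF reg, of T "t - c" r t "t + c" s "field (flow t x) s" e] near that T c
      by (simp add: abs_if algebra_simps split: if_splits)
  qed
  with c(1) show "\<exists>d>0. \<forall>r. norm (r - t) < d \<longrightarrow>
      norm (flow r x s - flow t x s - field (flow t x) s * (r - t)) \<le> e * norm (r - t)"
    by blast
qed

lemma field_flow_growth:
  assumes "regular x"
  shows "\<exists>L\<ge>0. \<forall>t s. \<bar>t\<bar> \<le> real T \<longrightarrow> \<bar>field (flow t x) s\<bar> \<le> L * (real s + 1)\<^sup>2"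
proof -
  obtain A where A: "0 \<le> A" "\<And>t s. \<bar>t\<bar> \<le> real T \<Longrightarrow> \<bar>flow t x s\<bar> \<le> A * (real s + 1)"
    using flow_growth[OF assms, of T] by blast
  define L where "L = real D * C * (A * (real D + 1))\<^sup>2"
  have "\<bar>field (flow t x) s\<bar> \<le> L * (real s + 1)\<^sup>2" if t: "\<bar>t\<bar> \<le> real T" for t s
  proof -
    have "\<bar>field (flow t x) s\<bar> \<le> real D * C * (A * (real D + 1) * (real s + 1))\<^sup>2"
    proof (rule field_le)
      fix s' assume "s' \<le> s + D"
      then have "real s' \<le> real s + real D" by linarith
      moreover have "0 \<le> real D * real s" by simp
      moreover have "(real D + 1) * (real s + 1) = real D * real s + real D + real s + 1"
        by (simp add: algebra_simps)
      ultimately have "real s' + 1 \<le> (real D + 1) * (real s + 1)"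
        by linarith
      then have "A * (real s' + 1) \<le> A * ((real D + 1) * (real s + 1))"
        using A(1) by (rule mult_left_mono)
      with A(2)[OF t, of s'] show "\<bar>flow t x s'\<bar> \<le> A * (real D + 1) * (real s + 1)"
        by (simp only: mult.assoc)
    qed
    then show ?thesis by (simp add: L_def power_mult_distrib mult_ac)
  qed
  moreover have "0 \<le> L" using C_nonneg by (simp add: L_def)
  ultimately show ?thesis by blast
qed

lemma flow_lipschitz:
  assumes reg: "regular x" and L: "\<And>t s. \<bar>t\<bar> \<le> real T \<Longrightarrow> \<bar>field (flow t x) s\<bar> \<le> L * (real s + 1)\<^sup>2"
    and t: "\<bar>t\<bar> \<le> real T" "\<bar>t'\<bar> \<le> real T"
  shows "\<bar>flow t x s - flow t' x s\<bar> \<le> L * (real s + 1)\<^sup>2 * \<bar>t - t'\<bar>"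
proof -
  have "norm (flow t x s - flow t' x s) \<le> L * (real s + 1)\<^sup>2 * norm (t - t')"
  proof (rule field_differentiable_bound[of "{- real T..real T}" "\<lambda>t. flow t x s" "\<lambda>t. field (flow t x) s"])
    show "convex {- real T..real T}" by simp
    fix z assume "z \<in> {- real T..real T}"
    then show "norm (field (flow z x) s) \<le> L * (real s + 1)\<^sup>2" using L[of z s] by auto
    show "((\<lambda>t. flow t x s) has_real_derivative field (flow z x) s) (at z within {- real T..real T})"
      by (rule has_field_derivative_at_within[OF flow_derivative[OF reg]])
  qed (use t in auto)
  then show ?thesis by simp
qed

lemma flow_0: "flow 0 x = x"
  by (rule ext) (simp add: flow_def level_def)

lemma AE_regular: "AE x in white_noise. regular x"
  unfolding regular_def by (rule AE_eventually_tracked)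

end

section \<open>Stationarity of the limit\<close>

lemma tendsto_coordinatewise:
  fixes f :: "'w \<Rightarrow> 'i \<Rightarrow> 'a::topological_space"
  assumes "\<And>i. ((\<lambda>w. f w i) \<longlongrightarrow> l i) F"
  shows "(f \<longlongrightarrow> l) F"
proof -
  have "limitin (product_topology (\<lambda>_. euclidean) UNIV) f l F"
    using assms by (simp add: limitin_componentwise)
  then show ?thesis
    by (simp only: euclidean_product_topology limitin_canonical_iff)
qed

text \<open>
  Almost sure limits of two sequences with equal laws have equal laws: the laws of the limits agree
  on the functions \<open>max 0 (1 - m dist(\<cdot>, S))\<close>, which decrease to the indicator of the closed set \<open>S\<close>.
\<close>

lemma distr_eq_of_AE_limits:
  fixes Z Z' :: "nat \<Rightarrow> 'w \<Rightarrow> 'a::metric_space"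
  assumes "prob_space M"
    and Z [measurable]: "\<And>n. Z n \<in> borel_measurable M" "Y \<in> borel_measurable M"
    and Z' [measurable]: "\<And>n. Z' n \<in> borel_measurable M" "Y' \<in> borel_measurable M"
    and lim: "AE w in M. (\<lambda>n. Z n w) \<longlonglongrightarrow> Y w" "AE w in M. (\<lambda>n. Z' n w) \<longlonglongrightarrow> Y' w"
    and eq: "\<And>n. distr M borel (Z n) = distr M borel (Z' n)"
  shows "distr M borel Y = distr M borel Y'"
proof -
  interpret prob_space M by fact
  interpret D: prob_space "distr M borel Y" by (rule prob_space_distr) (rule Z)
  interpret D': prob_space "distr M borel Y'" by (rule prob_space_distr) (rule Z')
  have closed_eq: "emeasure (distr M borel Y) S = emeasure (distr M borel Y') S"
    if S: "closed S" "S \<noteq> {}" for S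
  proof -
    define \<phi> where "\<phi> m z = max 0 (1 - real m * infdist z S)" for m z
    have \<phi>_cont: "continuous_on UNIV (\<phi> m)" for m
      unfolding \<phi>_def by (intro continuous_intros)
    then have [measurable]: "\<phi> m \<in> borel_measurable borel" for m
      by (rule borel_measurable_continuous_onI)
    have \<phi>_le: "\<bar>\<phi> m z\<bar> \<le> 1" for m z
      using infdist_nonneg[of z S] by (simp add: \<phi>_def)
    have \<phi>_lim: "(\<lambda>m. \<phi> m z) \<longlonglongrightarrow> indicator S z" for z
    proof (cases "z \<in> S")
      case True
      then show ?thesis by (simp add: \<phi>_def)
    next
      case False
      then have "0 < infdist z S"
        using S infdist_nonneg[of z S] in_closed_iff_infdist_zero[OF S, of z] by linarith
      then have "\<forall>\<^sub>F m in sequentially. 1 < real m * infdist z S"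
        by real_asymp
      then have "\<forall>\<^sub>F m in sequentially. \<phi> m z = 0"
        by eventually_elim (simp add: \<phi>_def)
      with False show ?thesis
        by (simp add: tendsto_eventually)
    qed
    have prelim: "(\<lambda>n. \<integral>w. \<phi> m (X n w) \<partial>M) \<longlonglongrightarrow> (\<integral>w. \<phi> m (V w) \<partial>M)"
      if [measurable]: "\<And>n. X n \<in> borel_measurable M" "V \<in> borel_measurable M"
        and X: "AE w in M. (\<lambda>n. X n w) \<longlonglongrightarrow> V w" for X V m
    proof (rule integral_dominated_convergence[where w="\<lambda>_. 1"])
      show "AE w in M. (\<lambda>n. \<phi> m (X n w)) \<longlonglongrightarrow> \<phi> m (V w)"
        using X
      proof eventually_elim
        case (elim w)
        from \<phi>_cont have "isCont (\<phi> m) (V w)"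
          by (simp add: continuous_on_eq_continuous_at)
        then show ?case using elim by (rule isCont_tendsto_compose)
      qed
      show "AE w in M. norm (\<phi> m (X n w)) \<le> 1" for n
        using \<phi>_le by simp
    qed measurable
    have Z_eq: "(\<integral>w. \<phi> m (Z n w) \<partial>M) = (\<integral>w. \<phi> m (Z' n w) \<partial>M)" for m n
    proof -
      have "(\<integral>w. \<phi> m (Z n w) \<partial>M) = integral\<^sup>L (distr M borel (Z n)) (\<phi> m)"
        by (rule integral_distr[symmetric]) measurable
      also have "\<dots> = (\<integral>w. \<phi> m (Z' n w) \<partial>M)"
        unfolding eq by (rule integral_distr) measurable
      finally show ?thesis .
    qed
    have \<phi>_eq: "(\<integral>w. \<phi> m (Y w) \<partial>M) = (\<integral>w. \<phi> m (Y' w) \<partial>M)" for m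
      using LIMSEQ_unique[OF prelim[OF Z lim(1), of m, unfolded Z_eq] prelim[OF Z' lim(2), of m]] .
    have S_sets [measurable]: "S \<in> sets borel" using S(1) by (rule borel_closed)
    have measure_lim: "(\<lambda>m. \<integral>w. \<phi> m (V w) \<partial>M) \<longlonglongrightarrow> measure (distr M borel V) S"
      if [measurable]: "V \<in> borel_measurable M" for V
    proof -
      have "(\<lambda>m. \<integral>w. \<phi> m (V w) \<partial>M) \<longlonglongrightarrow> (\<integral>w. indicator S (V w) \<partial>M)"
        by (rule integral_dominated_convergence[where w="\<lambda>_. 1"])
          (use \<phi>_le \<phi>_lim in \<open>auto intro!: borel_measurable_indicator'\<close>)
      also have "(\<integral>w. indicator S (V w) \<partial>M) = (\<integral>z. (indicator S z :: real) \<partial>distr M borel V)"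
        by (subst integral_distr) auto
      also have "\<dots> = measure (distr M borel V) S"
        by simp
      finally show ?thesis .
    qed
    have "measure (distr M borel Y) S = measure (distr M borel Y') S"
      using measure_lim[of Y] measure_lim[of Y'] by (simp add: \<phi>_eq LIMSEQ_unique)
    then show ?thesis by (simp add: D.emeasure_eq_measure D'.emeasure_eq_measure)
  qed
  show ?thesis
  proof (rule measure_eqI_generator_eq[where E="Collect closed" and \<Omega>=UNIV and A="\<lambda>_. UNIV"])
    show "Int_stable (Collect closed)"
      by (auto simp: Int_stable_def)
    show "sets (distr M borel Y) = sigma_sets UNIV (Collect closed)"
      "sets (distr M borel Y') = sigma_sets UNIV (Collect closed)"
      by (simp_all add: borel_eq_closed)
    fix S assume "S \<in> Collect (closed :: 'a set \<Rightarrow> bool)"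
    then show "emeasure (distr M borel Y) S = emeasure (distr M borel Y') S"
      using closed_eq[of S] by (cases "S = {}") auto
  qed auto
qed

context rotators
begin

lemma measurable_level: "(\<lambda>x. level l k x s) \<in> borel_measurable white_noise"
  unfolding level_def by (rule measurable_orbit)

lemma measurable_flow: "(\<lambda>x. flow t x s) \<in> borel_measurable white_noise"
  unfolding flow_def by (intro borel_measurable_lim_metric measurable_level)

lemma measurable_flow_family: "(\<lambda>x p. flow (\<tau> p) x) \<in> borel_measurable white_noise"
  for \<tau> :: "nat \<Rightarrow> real"
  by (intro measurable_coordinatewise_then_product measurable_flow)

text \<open>
  At level \<open>l\<close> the shift of time by a multiple of \<open>2\<^sup>-\<^sup>l\<close> amounts to starting from another white noise,
  so it preserves the joint law exactly. The times \<open>\<tau>\<close> are indexed by \<open>nat\<close> to make the space of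
  values metrizable.
\<close>

lemma flow_stationary:
  fixes \<tau> :: "nat \<Rightarrow> real"
  shows "distr white_noise borel (\<lambda>x p. flow (\<tau> p + h) x) = distr white_noise borel (\<lambda>x p. flow (\<tau> p) x)"
proof (rule distr_eq_of_AE_limits)
  let ?k = "\<lambda>l t. \<lfloor>t * 2 ^ l\<rfloor>"
  define Z where "Z l x p = level l (?k l (\<tau> p) + ?k l h) x" for l x p
  define Z' where "Z' l x p = level l (?k l (\<tau> p)) x" for l x p
  show "prob_space white_noise" by (rule prob_space_white_noise)
  show "Z l \<in> borel_measurable white_noise" "Z' l \<in> borel_measurable white_noise" for l
    unfolding Z_def Z'_def by (intro measurable_coordinatewise_then_product measurable_level)+
  show "(\<lambda>x p. flow (\<tau> p + h) x) \<in> borel_measurable white_noise"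
    "(\<lambda>x p. flow (\<tau> p) x) \<in> borel_measurable white_noise"
    by (rule measurable_flow_family)+
  show "distr white_noise borel (Z l) = distr white_noise borel (Z' l)" for l
  proof -
    let ?g = "level l (?k l h)"
    have g: "?g \<in> white_noise \<rightarrow>\<^sub>M white_noise" "distr white_noise white_noise ?g = white_noise"
      using preserves_orbit by (auto simp: preserves_white_noise_def level_def)
    have Z'_meas: "Z' l \<in> borel_measurable white_noise"
      unfolding Z'_def by (intro measurable_coordinatewise_then_product measurable_level)
    have "Z l = Z' l \<circ> ?g"
      by (simp add: fun_eq_iff Z_def Z'_def level_def orbit_add)
    then have "distr white_noise borel (Z l) = distr (distr white_noise white_noise ?g) borel (Z' l)"
      using distr_distr[OF Z'_meas g(1)] by simp
    then show ?thesis by (simp add: g(2))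
  qed
  show "AE x in white_noise. (\<lambda>l. Z' l x) \<longlonglongrightarrow> (\<lambda>p. flow (\<tau> p) x)"
    using AE_regular
  proof eventually_elim
    case (elim x)
    show ?case
    proof (intro tendsto_coordinatewise)
      fix p s
      obtain T where T: "\<bar>\<tau> p\<bar> \<le> real T" using real_arch_simple by blast
      have "(\<lambda>l. level l \<lfloor>\<tau> p * 2 ^ l\<rfloor> x s) \<longlonglongrightarrow> flow (\<tau> p) x s"
        by (rule flow_approx[OF elim, of T]) (use T in blast)
      then show "(\<lambda>l. Z' l x p s) \<longlonglongrightarrow> flow (\<tau> p) x s"
        by (simp add: Z'_def)
    qed
  qed
  show "AE x in white_noise. (\<lambda>l. Z l x) \<longlonglongrightarrow> (\<lambda>p. flow (\<tau> p + h) x)"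
    using AE_regular
  proof eventually_elim
    case (elim x)
    show ?case
    proof (intro tendsto_coordinatewise)
      fix p s
      obtain T1 T2 where T12: "\<bar>\<tau> p\<bar> \<le> real T1" "\<bar>h\<bar> \<le> real T2"
        using real_arch_simple by blast
      define T where "T = T1 + T2"
      have T': "\<bar>\<tau> p + h\<bar> \<le> real T" using T12 by (simp add: T_def)
      have conv: "(\<lambda>l. level l \<lfloor>(\<tau> p + h) * 2 ^ l\<rfloor> x s) \<longlonglongrightarrow> flow (\<tau> p + h) x s"
        by (rule flow_approx[OF elim, of T]) (use T' in blast)
      \<comment> \<open>The sum of the floors may fall short of the floor of the sum by one step.\<close>
      have "(\<lambda>l. Z l x p s - level l \<lfloor>(\<tau> p + h) * 2 ^ l\<rfloor> x s) \<longlonglongrightarrow> 0"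
      proof (rule Lim_null_comparison)
        have "\<forall>\<^sub>F l in sequentially. tracked T l x"
          using elim by (simp add: regular_def)
        then show "\<forall>\<^sub>F l in sequentially. norm (Z l x p s - level l \<lfloor>(\<tau> p + h) * 2 ^ l\<rfloor> x s) \<le> (3 / 4) ^ l"
          using eventually_ge_at_top[of s]
        proof eventually_elim
          case (elim l)
          let ?j = "?k l (\<tau> p) + ?k l h"
          have "\<bar>?j\<bar> \<le> int (T * 2 ^ l)"
            using abs_floor_scaled_le[OF T12(1), of l] abs_floor_scaled_le[OF T12(2), of l]
            unfolding T_def distrib_right of_nat_add by linarith
          from trackedD(2)[OF elim(1) this elim(2)]
          have step: "\<bar>level l (?j + 1) x s - level l ?j x s\<bar> \<le> (3 / 4) ^ l" .
          have "\<lfloor>(\<tau> p + h) * 2 ^ l\<rfloor> = ?j \<or> \<lfloor>(\<tau> p + h) * 2 ^ l\<rfloor> = ?j + 1"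
            unfolding distrib_right by linarith
          then show ?case
          proof
            assume "\<lfloor>(\<tau> p + h) * 2 ^ l\<rfloor> = ?j"
            then show ?thesis by (simp add: Z_def)
          next
            assume "\<lfloor>(\<tau> p + h) * 2 ^ l\<rfloor> = ?j + 1"
            then show ?thesis
              using step by (simp only: Z_def real_norm_def abs_minus_commute)
          qed
        qed
        show "(\<lambda>l. (3 / 4 :: real) ^ l) \<longlonglongrightarrow> 0"
          by (rule LIMSEQ_realpow_zero) auto
      qed
      from tendsto_add[OF this conv] show "(\<lambda>l. Z l x p s) \<longlonglongrightarrow> flow (\<tau> p + h) x s"
        by simp
    qed
  qed
qed

end

section \<open>The SABRA model as a lattice of rotators\<close>

text \<open>
  Shell \<open>n + 1\<close> occupies the sites \<open>2 n\<close> and \<open>2 n + 1\<close>. The triad of the shells \<open>q + 1\<close>, \<open>q + 2\<close>,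
  \<open>q + 3\<close> occupies the six sites from \<open>2 q\<close> on, and its interaction consists of four real triads
  \<open>(x, y, z)\<close> with coefficients \<open>c\<^sub>1 + c\<^sub>2 + c\<^sub>3 = 0\<close>. Each of these is the sum of a rotation of
  \<open>(x, z)\<close> driven by \<open>y\<close> and a rotation of \<open>(y, z)\<close> driven by \<open>x\<close>. The tables list the resulting
  eight rotations, by their offsets in the triad.
\<close>

definition rot_first :: "nat \<Rightarrow> nat" where
  "rot_first m = 2 * (m div 8) + [0, 2, 0, 3, 1, 2, 1, 3] ! (m mod 8)"

definition rot_second :: "nat \<Rightarrow> nat" where
  "rot_second m = 2 * (m div 8) + [5, 5, 4, 4, 4, 4, 5, 5] ! (m mod 8)"

definition rot_driver :: "nat \<Rightarrow> nat" where
  "rot_driver m = 2 * (m div 8) + [2, 0, 3, 0, 2, 1, 3, 1] ! (m mod 8)"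

text \<open>
  Here \<open>p\<close> and \<open>q\<close> are the coefficients of the first two shells of a triad. The order of the signs is that
  of the real triads \<open>(P1, Q1, S2)\<close>, \<open>(P1, Q2, S1)\<close>, \<open>(P2, Q1, S1)\<close>, \<open>(P2, Q2, S2)\<close>.
\<close>

definition rot_speed :: "real \<Rightarrow> real \<Rightarrow> nat \<Rightarrow> real" where
  "rot_speed p q m = [p, q, - p, - q, - p, - q, - p, - q] ! (m mod 8)"

lemmas rot_defs = rot_first_def rot_second_def rot_driver_def rot_speed_def

lemma mod_8_cases:
  "m mod 8 = 0 \<or> m mod 8 = 1 \<or> m mod 8 = 2 \<or> m mod 8 = 3 \<or> m mod 8 = 4
    \<or> m mod 8 = 5 \<or> m mod 8 = 6 \<or> m mod 8 = (7 :: nat)"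
  by presburger

lemma rotators_sabra: "rotators rot_first rot_second rot_driver (rot_speed p q) (\<bar>p\<bar> + \<bar>q\<bar>) 24"
proof
  fix m s
  show "rot_first m \<noteq> rot_second m" "rot_driver m \<noteq> rot_first m" "rot_driver m \<noteq> rot_second m"
    "\<bar>rot_speed p q m\<bar> \<le> \<bar>p\<bar> + \<bar>q\<bar>"
    unfolding rot_defs using mod_8_cases[of m] by (elim disjE; simp)+
  have near: "2 * (m div 8) \<le> rot_first m \<and> rot_first m \<le> 2 * (m div 8) + 5"
    "2 * (m div 8) \<le> rot_second m \<and> rot_second m \<le> 2 * (m div 8) + 5"
    "2 * (m div 8) \<le> rot_driver m \<and> rot_driver m \<le> 2 * (m div 8) + 5" for m
    unfolding rot_defs using mod_8_cases[of m] by (elim disjE; simp)+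
  have window: "2 * (m div 8) \<le> s \<and> s \<le> 2 * (m div 8) + 5"
    if "s = rot_first m \<or> s = rot_second m" for m
    using that near[of m] by metis
  have m8: "8 * (m div 8) \<le> m" "m < 8 * (m div 8) + 8" for m :: nat
    by presburger+
  show "rot_first m < m + 24" "rot_second m < m + 24" "rot_driver m < m + 24"
    using near[of m] m8[of m] by linarith+
  show "rot_first m \<le> s + 24 \<and> rot_second m \<le> s + 24 \<and> rot_driver m \<le> s + 24"
    if "s = rot_first m \<or> s = rot_second m"
    using window[OF that] near[of m] by linarith
  show "m < 24 * (s + 1)" if "s = rot_first m \<or> s = rot_second m"
  proof -
    define d where "d = m div 8"
    have "2 * d \<le> s" "m < 8 * d + 8"
      using window[OF that] m8[of m] by (simp_all add: d_def)
    then show ?thesis by simp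
  qed
  have s2: "2 * (s div 2) \<le> s" "s < 2 * (s div 2) + 2" by presburger+
  have "{m. s = rot_first m \<or> s = rot_second m} \<subseteq> {8 * (s div 2 - 2)..<8 * (s div 2) + 8}"
  proof
    fix m assume "m \<in> {m. s = rot_first m \<or> s = rot_second m}"
    then have "2 * (m div 8) \<le> s \<and> s \<le> 2 * (m div 8) + 5" using window by simp
    then have "s div 2 \<le> m div 8 + 2" "m div 8 \<le> s div 2" using s2 by linarith+
    then show "m \<in> {8 * (s div 2 - 2)..<8 * (s div 2) + 8}"
      unfolding atLeastLessThan_iff using m8[of m] by linarith
  qed
  then have "card {m. s = rot_first m \<or> s = rot_second m} \<le> card {8 * (s div 2 - 2)..<8 * (s div 2) + 8}"
    by (rule card_mono[rotated]) simp
  also have "\<dots> \<le> 24" unfolding card_atLeastLessThan by linarith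
  finally show "card {m. s = rot_first m \<or> s = rot_second m} \<le> 24" .
qed

lemma rot_apply:
  assumes "r < 8"
  shows "rot_first (8 * n + r) = 2 * n + [0, 2, 0, 3, 1, 2, 1, 3] ! r"
    and "rot_second (8 * n + r) = 2 * n + [5, 5, 4, 4, 4, 4, 5, 5] ! r"
    and "rot_driver (8 * n + r) = 2 * n + [2, 0, 3, 0, 2, 1, 3, 1] ! r"
    and "rot_speed p q (8 * n + r) = [p, q, - p, - q, - p, - q, - p, - q] ! r"
  using assms by (simp_all add: rot_defs)

lemma sum_lessThan_add:
  fixes f :: "nat \<Rightarrow> real"
  shows "(\<Sum>m<k + l. f m) = (\<Sum>m<k. f m) + (\<Sum>r<l. f (k + r))"
  by (induction l) simp_all

lemma sum_blocks_of_8: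
  fixes f :: "nat \<Rightarrow> real"
  shows "(\<Sum>m<8 * N. f m) = (\<Sum>q<N. \<Sum>r<8. f (8 * q + r))"
proof (induction N)
  case (Suc N)
  have "8 * Suc N = 8 * N + 8" by simp
  with Suc show ?case by (simp only: sum_lessThan_add sum.lessThan_Suc)
qed simp

context
  fixes p q :: real
begin

interpretation R: rotators rot_first rot_second rot_driver "rot_speed p q" "\<bar>p\<bar> + \<bar>q\<bar>" 24
  by (rule rotators_sabra)

text \<open>
  The complex triad interaction in real components: \<open>(P1, P2)\<close>, \<open>(Q1, Q2)\<close> and \<open>(S1, S2)\<close> are its three
  shells, and \<open>p\<close>, \<open>q\<close>, \<open>p + q\<close> their coefficients.
\<close>

definition triad_force :: "(nat \<Rightarrow> real) \<Rightarrow> nat \<Rightarrow> nat \<Rightarrow> real" where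
  "triad_force x n s = (let P1 = x (2 * n); P2 = x (2 * n + 1); Q1 = x (2 * n + 2);
      Q2 = x (2 * n + 3); S1 = x (2 * n + 4); S2 = x (2 * n + 5) in
    if s = 2 * n then p * (Q2 * S1 - Q1 * S2)
    else if s = 2 * n + 1 then p * (Q1 * S1 + Q2 * S2)
    else if s = 2 * n + 2 then q * (P2 * S1 - P1 * S2)
    else if s = 2 * n + 3 then q * (P1 * S1 + P2 * S2)
    else if s = 2 * n + 4 then - (p + q) * (P1 * Q2 + P2 * Q1)
    else if s = 2 * n + 5 then (p + q) * (P1 * Q1 - P2 * Q2)
    else 0)"

lemma triad_force_eq: "(\<Sum>r<8. R.force (8 * n + r) x s) = triad_force x n s"
proof -
  define f where "f r = (let i = 2 * n + [0, 2, 0, 3, 1, 2, 1, 3] ! r; j = 2 * n + [5, 5, 4, 4, 4, 4, 5, 5] ! r;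
      k = 2 * n + [2, 0, 3, 0, 2, 1, 3, 1] ! r; c = [p, q, - p, - q, - p, - q, - p, - q] ! r in
      if s = i then - c * x k * x j else if s = j then c * x k * x i else 0)" for r
  have "(\<Sum>r<8. R.force (8 * n + r) x s) = (\<Sum>r<8. f r)"
    by (intro sum.cong refl) (simp add: R.force_def rot_apply f_def Let_def)
  also have "\<dots> = f 0 + f 1 + f 2 + f 3 + f 4 + f 5 + f 6 + f 7"
    by (simp add: eval_nat_numeral)
  also have "\<dots> = triad_force x n s"
  proof -
    consider "s = 2 * n" | "s = 2 * n + 1" | "s = 2 * n + 2" | "s = 2 * n + 3" | "s = 2 * n + 4"
      | "s = 2 * n + 5" | "s \<noteq> 2 * n" "s \<noteq> 2 * n + 1" "s \<noteq> 2 * n + 2" "s \<noteq> 2 * n + 3"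
        "s \<noteq> 2 * n + 4" "s \<noteq> 2 * n + 5" by blast
    then show ?thesis
      by cases (simp_all add: f_def triad_force_def Let_def algebra_simps)
  qed
  finally show ?thesis .
qed

lemma field_eq_triads:
  assumes "s < 2 * n"
  shows "R.field x s = (\<Sum>k<n. triad_force x k s)"
proof -
  have "R.touch s \<subseteq> {..<8 * n}"
  proof
    fix m assume "m \<in> R.touch s"
    then have "2 * (m div 8) \<le> s" by (auto simp: R.touch_def rot_defs)
    with assms have "m div 8 < n" by linarith
    then show "m \<in> {..<8 * n}" by (simp add: div_less_iff_less_mult mult.commute)
  qed
  then have "R.field x s = (\<Sum>m<8 * n. R.force m x s)"
    unfolding R.field_def
    by (intro sum.mono_neutral_left) (auto simp: R.force_def R.touch_def)
  then show ?thesis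
    by (simp add: sum_blocks_of_8 triad_force_eq)
qed

text \<open>
  The sites \<open>2 n\<close> and \<open>2 n + 1\<close> are the first pair of triad \<open>n\<close>, the second pair of triad \<open>n - 1\<close> and the
  third pair of triad \<open>n - 2\<close>, as far as these exist.
\<close>

lemma field_shell:
  assumes "s = 2 * n \<or> s = 2 * n + 1"
  shows "R.field x s = triad_force x n s
    + (if 1 \<le> n then triad_force x (n - 1) s else 0) + (if 2 \<le> n then triad_force x (n - 2) s else 0)"
proof -
  have "R.field x s = (\<Sum>k<Suc n. triad_force x k s)"
    using assms by (intro field_eq_triads) auto
  also have "\<dots> = (\<Sum>k\<in>{k. k \<le> n \<and> n \<le> k + 2}. triad_force x k s)"
    using assms by (intro sum.mono_neutral_right) (auto simp: triad_force_def Let_def)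
  also have "\<dots> = triad_force x n s
    + (if 1 \<le> n then triad_force x (n - 1) s else 0) + (if 2 \<le> n then triad_force x (n - 2) s else 0)"
  proof -
    consider "n = 0" | "n = 1" | l where "n = l + 2"
      by (metis One_nat_def add_2_eq_Suc' not0_implies_Suc)
    then show ?thesis
    proof cases
      case 1
      then have "{k. k \<le> n \<and> n \<le> k + 2} = {0}" by auto
      with 1 show ?thesis by simp
    next
      case 2
      then have "{k. k \<le> n \<and> n \<le> k + 2} = {1, 0}" by auto
      with 2 show ?thesis by simp
    next
      case (3 l)
      then have "{k. k \<le> n \<and> n \<le> k + 2} = {l + 2, l + 1, l}" by auto
      with 3 show ?thesis by simp
    qed
  qed
  finally show ?thesis .
qed

end

lemma measurable_vec_lambda:
  fixes f :: "'w \<Rightarrow> 'n::finite \<Rightarrow> real"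
  assumes "\<And>i. (\<lambda>x. f x i) \<in> borel_measurable M"
  shows "(\<lambda>x. \<chi> i. f x i) \<in> borel_measurable M"
proof (rule borel_measurable_euclidean_space[THEN iffD2], rule ballI)
  fix e :: "real ^ 'n" assume "e \<in> Basis"
  then obtain i where "e = axis i 1" by (auto simp: Basis_vec_def)
  then show "(\<lambda>x. (\<chi> i. f x i) \<bullet> e) \<in> borel_measurable M"
    using assms[of i] by (simp add: inner_axis)
qed

text \<open>
  The power is absorbed by half of the geometric decay: with \<open>r = exp (- 4 \<epsilon>)\<close>, the term
  \<open>(\<epsilon> (n + 1))\<^sup>4\<close> is at most a constant times \<open>exp (2 \<epsilon> (n + 1))\<close>.
\<close>

lemma summable_polynomial_geometric:
  fixes r :: real
  assumes "0 < r" "r < 1"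
  shows "summable (\<lambda>n. real (Suc n) ^ 4 * r ^ n)"
proof -
  define \<epsilon> where "\<epsilon> = - ln r / 4"
  have \<epsilon>: "0 < \<epsilon>" using assms by (simp add: \<epsilon>_def)
  have r: "r = exp (- 4 * \<epsilon>)" using assms by (simp add: \<epsilon>_def)
  have bound: "real (Suc n) ^ 4 * r ^ n \<le> (24 / 16 / \<epsilon> ^ 4 * exp (2 * \<epsilon>)) * exp (- 2 * \<epsilon>) ^ n" for n
  proof -
    have fact4: "fact 4 = (24 :: real)" by (simp add: eval_nat_numeral)
    have "(\<epsilon> * real (Suc n)) ^ 4 / fact 4 \<le> exp (2 * (\<epsilon> * Suc n)) / 2 ^ 4"
      using \<epsilon> by (intro abs_power_divide_fact_le) auto
    then have "\<epsilon> ^ 4 * real (Suc n) ^ 4 / 24 \<le> exp (2 * (\<epsilon> * Suc n)) / 16"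
      unfolding power_mult_distrib fact4 by simp
    moreover have "m \<le> 24 / 16 / e * E" if "e * m / 24 \<le> E / 16" "0 < e" for e m E :: real
      using that by (simp add: field_simps)
    ultimately have "real (Suc n) ^ 4 \<le> 24 / 16 / \<epsilon> ^ 4 * exp (2 * (\<epsilon> * Suc n))"
      using \<epsilon> by (metis zero_less_power)
    then have "real (Suc n) ^ 4 * r ^ n \<le> 24 / 16 / \<epsilon> ^ 4 * exp (2 * (\<epsilon> * Suc n)) * r ^ n"
      using assms by (intro mult_right_mono) auto
    also have "\<dots> = 24 / 16 / \<epsilon> ^ 4 * (exp (2 * (\<epsilon> * Suc n)) * exp (real n * (- 4 * \<epsilon>)))"
      unfolding exp_of_nat_mult r[symmetric] by simp
    also have "exp (2 * (\<epsilon> * Suc n)) * exp (real n * (- 4 * \<epsilon>)) = exp (2 * \<epsilon>) * exp (real n * (- 2 * \<epsilon>))"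
      unfolding exp_add[symmetric] by (simp add: algebra_simps)
    finally show ?thesis unfolding exp_of_nat_mult by (simp add: mult.assoc)
  qed
  have "summable (\<lambda>n. (24 / 16 / \<epsilon> ^ 4 * exp (2 * \<epsilon>)) * exp (- 2 * \<epsilon>) ^ n)"
    using \<epsilon> by (intro summable_mult summable_geometric) auto
  then show ?thesis
    by (rule summable_comparison_test'[where N=0]) (use bound assms in auto)
qed

locale sabra =
  fixes k0 lam a b \<nu> :: real
  assumes k0: "0 < k0" and lam: "1 < lam"
    and coefficients: "a + b * lam^2 = (a + b) * lam^4"
    and \<nu>: "0 < \<nu>"
begin

definition sd :: "nat \<Rightarrow> real" where
  "sd n = sqrt (1 / (\<nu> * lambda_seq k0 lam n))"

definition \<kappa> :: real where
  "\<kappa> = sqrt (1 / \<nu>)"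

lemma lambda_seq_eq: "lambda_seq k0 lam n = (k0 * lam ^ n)\<^sup>2"
  by (simp add: lambda_seq_def power_mult_distrib power_even_eq)

lemma k_seq_eq: "k_seq k0 lam n = k0 * lam ^ n"
  using k0 lam by (simp add: k_seq_def lambda_seq_eq)

lemma sd_eq: "sd n = \<kappa> / (k0 * lam ^ n)"
  using k_seq_eq[of n] by (simp add: sd_def \<kappa>_def k_seq_def real_sqrt_divide real_sqrt_mult)

lemma \<kappa>_pos: "0 < \<kappa>"
  using \<nu> by (simp add: \<kappa>_def)

lemma sd_pos: "0 < sd n"
  using \<kappa>_pos k0 lam by (simp add: sd_eq)

interpretation R: rotators rot_first rot_second rot_driver "rot_speed (\<kappa> * a / lam\<^sup>2) (\<kappa> * b)"
    "\<bar>\<kappa> * a / lam\<^sup>2\<bar> + \<bar>\<kappa> * b\<bar>" 24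
  by (rule rotators_sabra)

definition site :: "nat \<Rightarrow> 2 \<Rightarrow> nat" where
  "site n i = 2 * (n - 1) + (if i = 1 then 0 else 1)"

definition shells :: "(nat \<Rightarrow> real) \<Rightarrow> state" where
  "shells x = (\<lambda>n\<in>{1..}. \<chi> i. sd n * x (site n i))"

lemma cmp_of_nat: "1 \<le> n \<Longrightarrow> cmp u (int n) i = u n $ i"
  by (simp add: cmp_def)

lemma cmp_nonpos: "m \<le> 0 \<Longrightarrow> cmp u m i = 0"
  by (simp add: cmp_def)

lemma sum_of_speeds: "\<kappa> * a / lam\<^sup>2 + \<kappa> * b = \<kappa> * ((a + b) * lam\<^sup>2)"
proof -
  have "lam\<^sup>2 * (\<kappa> * a / lam\<^sup>2 + \<kappa> * b) = \<kappa> * (a + b * lam\<^sup>2)"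
    using lam by (simp add: field_simps)
  also have "\<dots> = lam\<^sup>2 * (\<kappa> * ((a + b) * lam\<^sup>2))"
    unfolding coefficients by (simp add: eval_nat_numeral)
  finally show ?thesis using lam by simp
qed

text \<open>
  The two components of \<open>B\<close> in rescaled variables, as identities between numbers: \<open>w\<close> and \<open>v\<close> stand for the
  shells \<open>n - 1\<close> and \<open>n - 2\<close>, and \<open>y\<close> and \<open>z\<close> for the shells \<open>n + 1\<close> and \<open>n + 2\<close>.
\<close>

lemma bracket_first:
  fixes k1 k2 k3 s0 s1 s2 s3 s4 e1 e2 e3 y1 y2 z1 z2 w1 w2 v1 v2 :: real
  assumes "k1 * (s1 * s2) = s0 * e1" "k2 * (s3 * s1) = s0 * e2" "k3 * (s3 * s4) = s0 * e3"
    and "a * e1 + b * e2 = (a + b) * e3"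
  shows "a * k1 * (- (s1 * y2) * (s2 * z1) + (s1 * y1) * (s2 * z2))
      + b * k2 * (- (s3 * w2) * (s1 * y1) + (s3 * w1) * (s1 * y2))
      + a * k3 * ((s3 * w2) * (s4 * v1) + (s3 * w1) * (s4 * v2))
      + b * k3 * ((s4 * v2) * (s3 * w1) + (s4 * v1) * (s3 * w2))
    = - s0 * (a * e1 * (y2 * z1 - y1 * z2) + b * e2 * (w2 * y1 - w1 * y2)
        - (a * e1 + b * e2) * (v1 * w2 + v2 * w1))"
  using assms by algebra

lemma bracket_second:
  fixes k1 k2 k3 s0 s1 s2 s3 s4 e1 e2 e3 y1 y2 z1 z2 w1 w2 v1 v2 :: real
  assumes "k1 * (s1 * s2) = s0 * e1" "k2 * (s3 * s1) = s0 * e2" "k3 * (s3 * s4) = s0 * e3"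
    and "a * e1 + b * e2 = (a + b) * e3"
  shows "- a * k1 * ((s1 * y1) * (s2 * z1) + (s1 * y2) * (s2 * z2))
      - b * k2 * ((s3 * w1) * (s1 * y1) + (s3 * w2) * (s1 * y2))
      - a * k3 * ((s3 * w1) * (s4 * v1) - (s3 * w2) * (s4 * v2))
      - b * k3 * ((s4 * v1) * (s3 * w1) - (s4 * v2) * (s3 * w2))
    = - s0 * (a * e1 * (y1 * z1 + y2 * z2) + b * e2 * (w1 * y1 + w2 * y2)
        + (a * e1 + b * e2) * (v1 * w1 - v2 * w2))"
  using assms by algebra

text \<open>
  In the rescaled variables the coefficients of \<open>B\<close> no longer depend on the shell, and the relation
  between \<open>a\<close>, \<open>b\<close> and \<open>\<lambda>\<close> says that the three coefficients of a triad add up to zero.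
\<close>

lemma B_shells:
  assumes "1 \<le> n"
  shows "B k0 lam a b (shells x) (shells x) n = (\<chi> i. - sd n * R.field x (site n i))"
proof -
  obtain N where n: "n = Suc N" using assms by (cases n) auto
  let ?u = "shells x" and ?k = "k_seq k0 lam"
  \<comment> \<open>For \<open>2 \<le> N\<close> this is \<open>sd (N - 1)\<close>; otherwise it multiplies components that vanish.\<close>
  define s4 where "s4 = sd N * lam"
  define y where "y i = x (2 * N + 2 + i)" for i
  define z where "z i = x (2 * N + 4 + i)" for i
  define w where "w i = (if 1 \<le> N then x (2 * (N - 1) + i) else 0)" for i
  define v where "v i = (if 2 \<le> N then x (2 * (N - 2) + i) else 0)" for i
  define e1 e2 e3 where "e1 = \<kappa> / lam\<^sup>2" and "e2 = \<kappa>" and "e3 = \<kappa> * lam\<^sup>2"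
  have scaling: "?k (n + 1) * (sd (n + 1) * sd (n + 2)) = sd n * e1"
      "?k n * (sd N * sd (n + 1)) = sd n * e2" "?k (n - 1) * (sd N * s4) = sd n * e3"
    using k0 lam by (simp_all add: n k_seq_eq sd_eq s4_def e1_def e2_def e3_def field_simps power2_eq_square)
  have speeds: "a * e1 + b * e2 = (a + b) * e3"
    using sum_of_speeds by (simp add: e1_def e2_def e3_def mult_ac)
  have u: "cmp ?u (int m) 1 = sd m * x (2 * (m - 1))" "cmp ?u (int m) 2 = sd m * x (2 * (m - 1) + 1)"
    if "1 \<le> m" for m
    using that by (simp_all add: cmp_of_nat shells_def site_def)
  have next1: "cmp ?u (int n + 1) 1 = sd (n + 1) * y 0" "cmp ?u (int n + 1) 2 = sd (n + 1) * y 1"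
    using u[of "n + 1"] by (simp_all add: n y_def)
  have next2: "cmp ?u (int n + 2) 1 = sd (n + 2) * z 0" "cmp ?u (int n + 2) 2 = sd (n + 2) * z 1"
    using u[of "n + 2"] by (simp_all add: n z_def eval_nat_numeral)
  have prev1: "cmp ?u (int n - 1) 1 = sd N * w 0" "cmp ?u (int n - 1) 2 = sd N * w 1"
    using u[of N] by (auto simp: n w_def cmp_nonpos)
  have prev2: "cmp ?u (int n - 2) 1 = s4 * v 0" "cmp ?u (int n - 2) 2 = s4 * v 1"
  proof -
    have "sd (N - 1) = s4" if "2 \<le> N"
      using that lam k0 by (cases N) (simp_all add: s4_def sd_eq)
    moreover have "int n - 2 = int (N - 1)" if "2 \<le> N" using that by (simp add: n of_nat_diff)
    ultimately show "cmp ?u (int n - 2) 1 = s4 * v 0" "cmp ?u (int n - 2) 2 = s4 * v 1"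
      using u[of "N - 1"] by (auto simp: n v_def cmp_nonpos numeral_2_eq_2)
  qed
  have pq: "\<kappa> * a / lam\<^sup>2 = a * e1" "\<kappa> * b = b * e2" by (simp_all add: e1_def e2_def)
  have "B1 k0 lam a b ?u ?u n = - sd n * (a * e1 * (y 1 * z 0 - y 0 * z 1) + b * e2 * (w 1 * y 0 - w 0 * y 1)
        - (a * e1 + b * e2) * (v 0 * w 1 + v 1 * w 0))"
    unfolding B1_def Let_def next1 next2 prev1 prev2 by (rule bracket_first[OF scaling speeds])
  also have "\<dots> = - sd n * R.field x (2 * N)"
  proof -
    have "triad_force p q x N (2 * N) = p * (y 1 * z 0 - y 0 * z 1)" for p q
      by (simp add: triad_force_def y_def z_def eval_nat_numeral)
    moreover have "(if 1 \<le> N then triad_force p q x (N - 1) (2 * N) else 0) = q * (w 1 * y 0 - w 0 * y 1)" for p q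
      by (cases N) (simp_all add: triad_force_def y_def w_def eval_nat_numeral)
    moreover have "(if 2 \<le> N then triad_force p q x (N - 2) (2 * N) else 0) = - (p + q) * (v 0 * w 1 + v 1 * w 0)" for p q
    proof (cases "2 \<le> N")
      case True
      then obtain l where "N = l + 2" by (metis add.commute le_Suc_ex)
      then show ?thesis by (simp add: triad_force_def w_def v_def eval_nat_numeral)
    qed (simp add: v_def)
    ultimately have "R.field x (2 * N) = a * e1 * (y 1 * z 0 - y 0 * z 1) + b * e2 * (w 1 * y 0 - w 0 * y 1)
        + - (a * e1 + b * e2) * (v 0 * w 1 + v 1 * w 0)"
      by (simp only: field_shell[OF disjI1[OF refl]] pq)
    then show ?thesis by (simp only:) (simp add: algebra_simps)
  qed
  finally have first: "B1 k0 lam a b ?u ?u n = - sd n * R.field x (2 * N)" .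
  have "B2 k0 lam a b ?u ?u n = - sd n * (a * e1 * (y 0 * z 0 + y 1 * z 1) + b * e2 * (w 0 * y 0 + w 1 * y 1)
        + (a * e1 + b * e2) * (v 0 * w 0 - v 1 * w 1))"
    unfolding B2_def Let_def next1 next2 prev1 prev2 by (rule bracket_second[OF scaling speeds])
  also have "\<dots> = - sd n * R.field x (2 * N + 1)"
  proof -
    have "triad_force p q x N (2 * N + 1) = p * (y 0 * z 0 + y 1 * z 1)" for p q
      by (simp add: triad_force_def y_def z_def eval_nat_numeral)
    moreover have "(if 1 \<le> N then triad_force p q x (N - 1) (2 * N + 1) else 0) = q * (w 0 * y 0 + w 1 * y 1)" for p q
      by (cases N) (simp_all add: triad_force_def y_def w_def eval_nat_numeral)
    moreover have "(if 2 \<le> N then triad_force p q x (N - 2) (2 * N + 1) else 0) = (p + q) * (v 0 * w 0 - v 1 * w 1)" for p q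
    proof (cases "2 \<le> N")
      case True
      then obtain l where "N = l + 2" by (metis add.commute le_Suc_ex)
      then show ?thesis by (simp add: triad_force_def w_def v_def eval_nat_numeral)
    qed (simp add: v_def)
    ultimately have "R.field x (2 * N + 1) = a * e1 * (y 0 * z 0 + y 1 * z 1) + b * e2 * (w 0 * y 0 + w 1 * y 1)
        + (a * e1 + b * e2) * (v 0 * w 0 - v 1 * w 1)"
      by (simp only: field_shell[OF disjI2[OF refl]] pq)
    then show ?thesis by (simp only:)
  qed
  finally have second: "B2 k0 lam a b ?u ?u n = - sd n * R.field x (2 * N + 1)" .
  show ?thesis
    using assms first second by (simp add: B_def vec_eq_iff forall_2 site_def n)
qed

section \<open>The Gaussian measure as an image of white noise\<close>

text \<open>
  Recovers the white noise from a state, so that the process can start from a random state.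
\<close>

definition unshells :: "state \<Rightarrow> nat \<Rightarrow> real" where
  "unshells u s = u (s div 2 + 1) $ (if even s then 1 else 2) / sd (s div 2 + 1)"

lemma unshells_shells: "unshells (shells x) = x"
proof
  fix s :: nat
  have "s = 2 * (s div 2) + (if even s then 0 else 1)" by presburger
  then show "unshells (shells x) s = x s"
    using sd_pos[of "s div 2 + 1"] by (auto simp: unshells_def shells_def site_def split: if_splits)
qed

lemma measurable_shells: "shells \<in> PiM UNIV (\<lambda>_. borel) \<rightarrow>\<^sub>M states"
  unfolding shells_def states_def
proof (intro measurable_restrict measurable_vec_lambda borel_measurable_times borel_measurable_const)
  fix n i
  show "(\<lambda>x. x (site n i)) \<in> borel_measurable (PiM UNIV (\<lambda>_. borel))"
    by (rule measurable_component_singleton) simp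
qed

lemma measurable_unshells: "unshells \<in> states \<rightarrow>\<^sub>M white_noise"
proof -
  have "unshells \<in> states \<rightarrow>\<^sub>M PiM UNIV (\<lambda>_. borel)"
  proof (rule measurable_coordinatewise)
    fix s
    have "(\<lambda>u. u (s div 2 + 1)) \<in> states \<rightarrow>\<^sub>M borel"
      unfolding states_def by (rule measurable_component_singleton) simp
    moreover have "(\<lambda>v. v $ (if even s then 1 else 2)) \<in> borel_measurable (borel :: (real ^ 2) measure)"
      by (intro borel_measurable_continuous_onI continuous_intros)
    ultimately have "(\<lambda>u. u (s div 2 + 1) $ (if even s then 1 else 2)) \<in> borel_measurable states"
      by (rule measurable_compose)
    then
    show "(\<lambda>u. unshells u s) \<in> borel_measurable states"
      unfolding unshells_def by (intro borel_measurable_divide borel_measurable_const)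
  qed
  then show ?thesis using measurable_cong_sets[OF refl sets_white_noise] by blast
qed

lemma distr_shells: "distr white_noise states shells = gibbs k0 lam \<nu>"
proof -
  let ?I = "{1..} \<times> (UNIV :: 2 set)"
  define N where "N = (\<lambda>p :: nat \<times> 2. density lborel (normal_density 0 (sd (fst p))))"
  have setsN: "sets (N p) = sets borel" for p by (simp add: N_def)
  define g where "g = (\<lambda>x :: nat \<times> 2 \<Rightarrow> real. \<lambda>n\<in>{1::nat..}. \<chi> i. x (n, i))"
  have gibbs: "gibbs k0 lam \<nu> = distr (PiM ?I N) states g"
    by (simp add: gibbs_def N_def g_def sd_def case_prod_unfold)
  have g: "g \<in> PiM ?I N \<rightarrow>\<^sub>M states"
    unfolding g_def states_def
  proof (intro measurable_restrict measurable_vec_lambda)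
    fix n i assume "n \<in> {1::nat..}"
    then have "(\<lambda>x. x (n, i)) \<in> PiM ?I N \<rightarrow>\<^sub>M N (n, i)"
      by (intro measurable_component_singleton) auto
    then show "(\<lambda>x. x (n, i)) \<in> borel_measurable (PiM ?I N)"
      using measurable_cong_sets[OF refl setsN] by blast
  qed
  define idx where "idx = (\<lambda>p :: nat \<times> 2. site (fst p) (snd p))"
  have inj: "inj_on idx ?I"
  proof (rule inj_onI)
    fix p p' assume p: "p \<in> ?I" "p' \<in> ?I" "idx p = idx p'"
    obtain n i n' i' where [simp]: "p = (n, i)" "p' = (n', i')" by (cases p, cases p') auto
    have "2 * (n - 1) + (if i = 1 then 0 else 1) = 2 * (n' - 1) + (if i' = 1 then 0 else (1::nat))"
      using p(3) by (simp add: idx_def site_def)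
    then have "n - 1 = n' - 1" "(i = 1) = (i' = 1)" by (auto split: if_splits) presburger+
    moreover have "i = i'" using \<open>(i = 1) = (i' = 1)\<close> exhaust_2[of i] exhaust_2[of i'] by auto
    ultimately show "p = p'" using p(1,2) by auto
  qed
  let ?r = "\<lambda>\<omega>. \<lambda>p\<in>?I. \<omega> (idx p)"
  have reindex: "distr white_noise (PiM ?I (\<lambda>_. gauss)) ?r = PiM ?I (\<lambda>_. gauss)"
    unfolding white_noise_def by (rule distr_PiM_reindex[OF prob_space_gauss inj]) simp
  have r: "?r \<in> white_noise \<rightarrow>\<^sub>M PiM ?I (\<lambda>_. gauss)"
    unfolding white_noise_def by (intro measurable_restrict measurable_component_singleton) simp
  let ?s = "\<lambda>\<omega>. \<lambda>p\<in>?I. sd (fst p) * \<omega> p"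
  have scale_meas: "(\<lambda>y. sd (fst p) * y) \<in> gauss \<rightarrow>\<^sub>M N p" for p
    using measurable_cong_sets[OF sets_gauss setsN[of p]] by auto
  have scale: "distr (PiM ?I (\<lambda>_. gauss)) (PiM ?I N) ?s = PiM ?I N"
    by (rule distr_PiM_coordinatewise[of ?I "\<lambda>_. gauss" "\<lambda>p y. sd (fst p) * y"])
      (auto simp: prob_space_gauss scale_meas N_def intro: distr_gauss_scale sd_pos)
  have s: "?s \<in> PiM ?I (\<lambda>_. gauss) \<rightarrow>\<^sub>M PiM ?I N"
  proof (rule measurable_restrict)
    fix p :: "nat \<times> 2" assume "p \<in> ?I"
    then show "(\<lambda>\<omega>. sd (fst p) * \<omega> p) \<in> PiM ?I (\<lambda>_. gauss) \<rightarrow>\<^sub>M N p"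
      by (intro measurable_compose[of "\<lambda>\<omega>. \<omega> p" _ gauss "\<lambda>y. sd (fst p) * y"]
          measurable_component_singleton scale_meas)
  qed
  have "gibbs k0 lam \<nu> = distr (distr (distr white_noise (PiM ?I (\<lambda>_. gauss)) ?r) (PiM ?I N) ?s) states g"
    by (simp only: gibbs reindex scale)
  also have "\<dots> = distr white_noise states (g \<circ> (?s \<circ> ?r))"
    using r s g by (simp add: distr_distr measurable_comp[OF r s])
  also have "g \<circ> (?s \<circ> ?r) = shells"
    by (auto simp: fun_eq_iff g_def shells_def idx_def vec_eq_iff restrict_def)
  finally show ?thesis by simp
qed

lemma distr_unshells: "distr (gibbs k0 lam \<nu>) white_noise unshells = white_noise"
proof -
  have "shells \<in> white_noise \<rightarrow>\<^sub>M states"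
    using measurable_shells measurable_cong_sets[OF sets_white_noise refl] by blast
  then have "distr (gibbs k0 lam \<nu>) white_noise unshells = distr white_noise white_noise (unshells \<circ> shells)"
    unfolding distr_shells[symmetric] by (intro distr_distr measurable_unshells)
  also have "unshells \<circ> shells = (\<lambda>x. x)"
    by (auto simp: unshells_shells)
  finally show ?thesis by simp
qed

section \<open>Regularity of the paths\<close>

text \<open>
  The squared norm in \<open>H\<^sup>\<alpha>\<close> of a state whose shells have the size \<open>n\<^sup>2\<close> times their standard deviation.
\<close>

definition weight :: "real \<Rightarrow> real" where
  "weight \<alpha> = (\<Sum>n. lambda_seq k0 lam (Suc n) powr \<alpha> * ((real (Suc n))\<^sup>2 * sd (Suc n))\<^sup>2)"

lemma summable_weight:
  assumes "\<alpha> < 1"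
  shows "summable (\<lambda>n. lambda_seq k0 lam (Suc n) powr \<alpha> * ((real (Suc n))\<^sup>2 * sd (Suc n))\<^sup>2)"
proof -
  define r where "r = (lam\<^sup>2) powr (\<alpha> - 1)"
  have lam2: "1 < lam\<^sup>2" using lam by (simp add: one_less_power)
  have r: "0 < r" "r < 1"
    using lam2 assms powr_less_mono[of "\<alpha> - 1" 0 "lam\<^sup>2"] lam by (auto simp: r_def)
  have "lambda_seq k0 lam (Suc n) powr \<alpha> * ((real (Suc n))\<^sup>2 * sd (Suc n))\<^sup>2
      = (1 / \<nu> * (k0\<^sup>2) powr (\<alpha> - 1) * r) * (real (Suc n) ^ 4 * r ^ n)" for n
  proof -
    let ?l = "lambda_seq k0 lam (Suc n)"
    have l: "0 < ?l" using k0 lam by (simp add: lambda_seq_def)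
    have "(sd (Suc n))\<^sup>2 = 1 / (\<nu> * ?l)"
      using l \<nu> by (simp add: sd_def)
    then have "?l powr \<alpha> * ((real (Suc n))\<^sup>2 * sd (Suc n))\<^sup>2 = 1 / \<nu> * (?l powr \<alpha> / ?l) * real (Suc n) ^ 4"
      by (simp add: power_mult_distrib power_mult[symmetric])
    also have "?l powr \<alpha> / ?l = ?l powr (\<alpha> - 1)"
      using l by (simp add: powr_diff)
    also have "\<dots> = (k0\<^sup>2) powr (\<alpha> - 1) * r ^ Suc n"
    proof -
      have "?l powr (\<alpha> - 1) = (k0\<^sup>2) powr (\<alpha> - 1) * ((lam\<^sup>2) ^ Suc n) powr (\<alpha> - 1)"
        unfolding lambda_seq_def power_mult by (rule powr_mult)
      also have "((lam\<^sup>2) ^ Suc n) powr (\<alpha> - 1) = r ^ Suc n"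
        using lam2 by (simp only: r_def powr_realpow[symmetric] powr_powr powr_gt_zero) (simp add: powr_powr mult.commute)
      finally show ?thesis .
    qed
    finally show ?thesis by simp
  qed
  then show ?thesis
    using summable_mult[OF summable_polynomial_geometric[OF r], of "1 / \<nu> * (k0\<^sup>2) powr (\<alpha> - 1) * r"] by simp
qed

lemma Hsp_bound:
  assumes "\<alpha> < 1" "0 \<le> P" and w: "\<And>n. 1 \<le> n \<Longrightarrow> norm (w n) \<le> P * ((real n)\<^sup>2 * sd n)"
  shows "w \<in> Hsp k0 lam \<alpha>" and "Hnorm k0 lam \<alpha> w \<le> P * sqrt (weight \<alpha>)" and "0 \<le> Hnorm k0 lam \<alpha> w"
proof -
  let ?f = "\<lambda>n. lambda_seq k0 lam (Suc n) powr \<alpha> * (norm (w (Suc n)))\<^sup>2"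
  let ?g = "\<lambda>n. P\<^sup>2 * (lambda_seq k0 lam (Suc n) powr \<alpha> * ((real (Suc n))\<^sup>2 * sd (Suc n))\<^sup>2)"
  have le: "?f n \<le> ?g n" for n
  proof -
    have "(norm (w (Suc n)))\<^sup>2 \<le> (P * ((real (Suc n))\<^sup>2 * sd (Suc n)))\<^sup>2"
      by (intro power_mono w) auto
    then have "?f n \<le> lambda_seq k0 lam (Suc n) powr \<alpha> * (P * ((real (Suc n))\<^sup>2 * sd (Suc n)))\<^sup>2"
      by (intro mult_left_mono) auto
    then show ?thesis by (simp add: power_mult_distrib mult_ac)
  qed
  have g: "summable ?g"
    by (intro summable_mult summable_weight assms)
  have f: "summable ?f"
    by (rule summable_comparison_test'[OF g, where N=0]) (use le in auto)
  then show "w \<in> Hsp k0 lam \<alpha>" by (simp add: Hsp_def)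
  have "suminf ?f \<le> suminf ?g" by (intro suminf_le le f g)
  also have "\<dots> = P\<^sup>2 * weight \<alpha>"
    unfolding weight_def by (intro suminf_mult summable_weight assms)
  finally show "Hnorm k0 lam \<alpha> w \<le> P * sqrt (weight \<alpha>)"
    using assms(2) real_sqrt_le_mono unfolding Hnorm_def by (fastforce simp: real_sqrt_mult)
  show "0 \<le> Hnorm k0 lam \<alpha> w"
    unfolding Hnorm_def by (intro real_sqrt_ge_zero suminf_nonneg f) auto
qed

lemma norm_pair_le:
  assumes "\<And>i. \<bar>f i\<bar> \<le> (c :: real)"
  shows "norm (\<chi> i :: 2. f i) \<le> 2 * c"
proof -
  have "norm (\<chi> i :: 2. f i) \<le> (\<Sum>i\<in>UNIV. \<bar>f i\<bar>)"
    using norm_le_l1_cart[of "\<chi> i :: 2. f i"] by simp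
  also have "\<dots> \<le> 2 * c" using assms[of 1] assms[of 2] by (simp add: sum_2)
  finally show ?thesis .
qed

lemma site_le: "1 \<le> n \<Longrightarrow> real (site n i) + 1 \<le> 2 * real n"
  by (auto simp: site_def of_nat_diff)

text \<open>Quadratic growth of the rescaled components costs nothing against the geometric weights.\<close>

lemma shell_norm_bound:
  assumes "1 \<le> n" "0 \<le> A" and f: "\<And>i. \<bar>f i\<bar> \<le> A * (real (site n i) + 1)\<^sup>2"
  shows "norm (\<chi> i :: 2. sd n * f i) \<le> 8 * A * ((real n)\<^sup>2 * sd n)"
proof -
  have "\<bar>sd n * f i\<bar> \<le> sd n * (A * (2 * real n)\<^sup>2)" for i
  proof -
    have "(real (site n i) + 1)\<^sup>2 \<le> (2 * real n)\<^sup>2"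
      using site_le[OF assms(1), of i] by (intro power_mono) auto
    then have "A * (real (site n i) + 1)\<^sup>2 \<le> A * (2 * real n)\<^sup>2"
      using assms(2) by (rule mult_left_mono)
    with f[of i] have "\<bar>f i\<bar> \<le> A * (2 * real n)\<^sup>2" by linarith
    then show ?thesis using sd_pos[of n] by (simp add: abs_mult)
  qed
  from norm_pair_le[OF this] show ?thesis by (simp add: power_mult_distrib mult_ac)
qed

lemma path_in_Hsp:
  assumes reg: "R.regular x" and "\<alpha> < 1"
  shows "shells (R.flow t x) \<in> Hsp k0 lam \<alpha>"
proof -
  obtain T where T: "\<bar>t\<bar> \<le> real T" using real_arch_simple by blast
  obtain A where A: "0 \<le> A" "\<And>t s. \<bar>t\<bar> \<le> real T \<Longrightarrow> \<bar>R.flow t x s\<bar> \<le> A * (real s + 1)"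
    using R.flow_growth[OF reg, of T] by blast
  have "norm (shells (R.flow t x) n) \<le> 8 * A * ((real n)\<^sup>2 * sd n)" if n: "1 \<le> n" for n
  proof -
    have "\<bar>R.flow t x s\<bar> \<le> A * (real s + 1)\<^sup>2" for s
    proof -
      have "A * (real s + 1) \<le> A * (real s + 1)\<^sup>2"
        using A(1) by (intro mult_left_mono self_le_power) auto
      with A(2)[OF T, of s] show ?thesis by linarith
    qed
    then have "norm (\<chi> i. sd n * R.flow t x (site n i)) \<le> 8 * A * ((real n)\<^sup>2 * sd n)"
      by (rule shell_norm_bound[OF n A(1)])
    then show ?thesis using n by (simp add: shells_def)
  qed
  with \<open>\<alpha> < 1\<close> A(1) show ?thesis by (intro Hsp_bound(1)[of _ "8 * A"]) auto
qed

lemma path_lipschitz: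
  assumes reg: "R.regular x" and "\<alpha> < 1"
  obtains K where "0 \<le> K"
    and "\<And>t t'. \<bar>t\<bar> \<le> real T \<Longrightarrow> \<bar>t'\<bar> \<le> real T \<Longrightarrow>
      0 \<le> Hnorm k0 lam \<alpha> (\<lambda>n. shells (R.flow t x) n - shells (R.flow t' x) n) \<and>
      Hnorm k0 lam \<alpha> (\<lambda>n. shells (R.flow t x) n - shells (R.flow t' x) n) \<le> K * \<bar>t - t'\<bar>"
proof -
  obtain L where L: "0 \<le> L" "\<And>t s. \<bar>t\<bar> \<le> real T \<Longrightarrow> \<bar>R.field (R.flow t x) s\<bar> \<le> L * (real s + 1)\<^sup>2"
    using R.field_flow_growth[OF reg, of T] by blast
  show thesis
  proof (rule that[of "8 * L * sqrt (weight \<alpha>)"])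
    have "0 \<le> weight \<alpha>"
      unfolding weight_def by (intro suminf_nonneg summable_weight assms) auto
    then show "0 \<le> 8 * L * sqrt (weight \<alpha>)" using L(1) by simp
    fix t t' assume t: "\<bar>t\<bar> \<le> real T" "\<bar>t'\<bar> \<le> real T"
    let ?w = "\<lambda>n. shells (R.flow t x) n - shells (R.flow t' x) n"
    have P: "0 \<le> 8 * (L * \<bar>t - t'\<bar>)" using L(1) by simp
    have w: "norm (?w n) \<le> 8 * (L * \<bar>t - t'\<bar>) * ((real n)\<^sup>2 * sd n)" if n: "1 \<le> n" for n
    proof -
      have "norm (\<chi> i. sd n * (R.flow t x (site n i) - R.flow t' x (site n i)))
          \<le> 8 * (L * \<bar>t - t'\<bar>) * ((real n)\<^sup>2 * sd n)"
        using L(1) R.flow_lipschitz[OF reg L(2) t]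
        by (intro shell_norm_bound[OF n]) (auto simp: mult_ac)
      moreover have "?w n = (\<chi> i. sd n * (R.flow t x (site n i) - R.flow t' x (site n i)))"
        using n by (simp add: shells_def vec_eq_iff right_diff_distrib)
      ultimately show ?thesis by simp
    qed
    show "0 \<le> Hnorm k0 lam \<alpha> ?w \<and> Hnorm k0 lam \<alpha> ?w \<le> 8 * L * sqrt (weight \<alpha>) * \<bar>t - t'\<bar>"
      using Hsp_bound(2,3)[OF \<open>\<alpha> < 1\<close> P w] by (simp add: mult_ac)
  qed
qed

lemma path_holder:
  assumes reg: "R.regular x" and \<delta>: "0 \<le> \<delta>" "\<delta> < 1 / 2" and \<alpha>: "\<alpha> < 1"
  shows "(\<lambda>t. shells (R.flow t x)) \<in> holder_paths k0 lam \<delta> \<alpha>"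
proof -
  let ?u = "\<lambda>t. shells (R.flow t x)"
  have "((\<lambda>s. Hnorm k0 lam \<alpha> (\<lambda>n. ?u s n - ?u t n)) \<longlongrightarrow> 0) (at t)" for t
  proof -
    obtain T where T: "\<bar>t\<bar> + 1 \<le> real T" using real_arch_simple by blast
    obtain K where K: "0 \<le> K" "\<And>t t'. \<bar>t\<bar> \<le> real T \<Longrightarrow> \<bar>t'\<bar> \<le> real T \<Longrightarrow>
        0 \<le> Hnorm k0 lam \<alpha> (\<lambda>n. ?u t n - ?u t' n) \<and>
        Hnorm k0 lam \<alpha> (\<lambda>n. ?u t n - ?u t' n) \<le> K * \<bar>t - t'\<bar>"
      by (rule path_lipschitz[OF reg \<alpha>, of T]) (rule that; assumption)
    show ?thesis
    proof (rule Lim_null_comparison)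
      have "\<forall>\<^sub>F s in at t. \<bar>s - t\<bar> < 1"
        using eventually_at_ball[of 1 t UNIV] by (simp add: dist_real_def abs_minus_commute)
      then show "\<forall>\<^sub>F s in at t. norm (Hnorm k0 lam \<alpha> (\<lambda>n. ?u s n - ?u t n)) \<le> K * \<bar>s - t\<bar>"
      proof eventually_elim
        case (elim s)
        then have "\<bar>s\<bar> \<le> real T" "\<bar>t\<bar> \<le> real T" using T by linarith+
        from K(2)[OF this] show ?case by simp
      qed
      have "((\<lambda>s. K * \<bar>s - t\<bar>) \<longlongrightarrow> K * \<bar>t - t\<bar>) (at t)"
        by (intro tendsto_intros)
      then show "((\<lambda>s. K * \<bar>s - t\<bar>) \<longlongrightarrow> 0) (at t)" by simp
    qed
  qed
  moreover have "\<exists>c. \<forall>s\<in>{S..S'}. \<forall>t\<in>{S..S'}. Hnorm k0 lam \<alpha> (\<lambda>n. ?u t n - ?u s n) \<le> c * \<bar>t - s\<bar> powr \<delta>" for S S'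
  proof -
    obtain T where T: "\<bar>S\<bar> + \<bar>S'\<bar> \<le> real T" using real_arch_simple by blast
    obtain K where K: "0 \<le> K" "\<And>t t'. \<bar>t\<bar> \<le> real T \<Longrightarrow> \<bar>t'\<bar> \<le> real T \<Longrightarrow>
        0 \<le> Hnorm k0 lam \<alpha> (\<lambda>n. ?u t n - ?u t' n) \<and>
        Hnorm k0 lam \<alpha> (\<lambda>n. ?u t n - ?u t' n) \<le> K * \<bar>t - t'\<bar>"
      by (rule path_lipschitz[OF reg \<alpha>, of T]) (rule that; assumption)
    have "Hnorm k0 lam \<alpha> (\<lambda>n. ?u t n - ?u s n) \<le> K * (2 * real T) powr (1 - \<delta>) * \<bar>t - s\<bar> powr \<delta>"
      if st: "s \<in> {S..S'}" "t \<in> {S..S'}" for s t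
    proof -
      have b: "\<bar>t\<bar> \<le> real T" "\<bar>s\<bar> \<le> real T" using st T by auto
      have "\<bar>t - s\<bar> \<le> (2 * real T) powr (1 - \<delta>) * \<bar>t - s\<bar> powr \<delta>"
      proof (cases "t = s")
        case False
        then have "\<bar>t - s\<bar> = \<bar>t - s\<bar> powr (1 - \<delta>) * \<bar>t - s\<bar> powr \<delta>"
          by (simp add: powr_add[symmetric])
        also have "\<dots> \<le> (2 * real T) powr (1 - \<delta>) * \<bar>t - s\<bar> powr \<delta>"
          using \<delta> b by (intro mult_right_mono powr_mono2) auto
        finally show ?thesis .
      qed simp
      then have "K * \<bar>t - s\<bar> \<le> K * ((2 * real T) powr (1 - \<delta>) * \<bar>t - s\<bar> powr \<delta>)"
        using K(1) by (rule mult_left_mono)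
      with K(2)[OF b] show ?thesis by (simp add: mult.assoc)
    qed
    then show ?thesis by blast
  qed
  ultimately show ?thesis
    unfolding holder_paths_def using path_in_Hsp[OF reg \<alpha>] by auto
qed

text \<open>
  The components are continuously differentiable, so componentwise this is the fundamental theorem of
  calculus; the norm of the integrand in \<open>H\<close> is bounded on \<open>{s..t}\<close> and measurable as a countable sum.
\<close>

lemma path_solves:
  assumes reg: "R.regular x"
  shows "solves_inviscid k0 lam a b (\<lambda>t. shells (R.flow t x))"
  unfolding solves_inviscid_def
proof (intro allI impI)
  let ?u = "\<lambda>t. shells (R.flow t x)"
  let ?f = "\<lambda>r. B k0 lam a b (?u r) (?u r)"
  fix s t :: real assume st: "s \<le> t"
  define G where "G n r = (\<chi> i. sd n * (- R.field (R.flow r x) (site n i)))" for n r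
  have f: "?f r n = G n r" if "1 \<le> n" for r n
    using B_shells[OF that, of "R.flow r x"] by (simp add: G_def)
  have G_cont: "continuous_on S (G n)" for S n
    unfolding G_def
    by (intro continuous_on_vec_lambda continuous_intros continuous_at_imp_continuous_on ballI
        R.continuous_field_flow[OF reg])
  have deriv: "((\<lambda>r. ?u r n) has_vector_derivative - G n r) (at r within S)" if n: "1 \<le> n" for n r S
  proof -
    have "((\<lambda>r. (sd n * R.flow r x q) *\<^sub>R v) has_vector_derivative (sd n * R.field (R.flow r x) q) *\<^sub>R v)
        (at r within S)" for q and v :: "real ^ 2"
    proof -
      have "((\<lambda>r. sd n * R.flow r x q) has_real_derivative sd n * R.field (R.flow r x) q) (at r within S)"
        by (rule DERIV_cmult[OF has_field_derivative_at_within[OF R.flow_derivative[OF reg]]])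
      from has_vector_derivative_scaleR[OF this has_vector_derivative_const[of v]] show ?thesis by simp
    qed
    then have "((\<lambda>r. (sd n * R.flow r x (site n 1)) *\<^sub>R axis 1 1 + (sd n * R.flow r x (site n 2)) *\<^sub>R axis 2 1 :: real ^ 2)
      has_vector_derivative (sd n * R.field (R.flow r x) (site n 1)) *\<^sub>R axis 1 1 + (sd n * R.field (R.flow r x) (site n 2)) *\<^sub>R axis 2 1)
      (at r within S)"
      by (intro has_vector_derivative_add)
    moreover have "(\<lambda>r. ?u r n) = (\<lambda>r. (sd n * R.flow r x (site n 1)) *\<^sub>R axis 1 1 + (sd n * R.flow r x (site n 2)) *\<^sub>R axis 2 1)"
      using n by (auto simp: fun_eq_iff shells_def vec_eq_iff forall_2 axis_def)
    moreover have "- G n r = (sd n * R.field (R.flow r x) (site n 1)) *\<^sub>R axis 1 1 + (sd n * R.field (R.flow r x) (site n 2)) *\<^sub>R axis 2 1"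
      by (auto simp: G_def vec_eq_iff forall_2 axis_def)
    ultimately show ?thesis by simp
  qed
  obtain T where T: "\<bar>s\<bar> + \<bar>t\<bar> \<le> real T" using real_arch_simple by blast
  obtain L where L: "0 \<le> L" "\<And>t s. \<bar>t\<bar> \<le> real T \<Longrightarrow> \<bar>R.field (R.flow t x) s\<bar> \<le> L * (real s + 1)\<^sup>2"
    using R.field_flow_growth[OF reg, of T] by blast
  have f_bound: "norm (?f r n) \<le> 8 * L * ((real n)\<^sup>2 * sd n)" if r: "r \<in> {s..t}" and n: "1 \<le> n" for r n
  proof -
    have "\<bar>r\<bar> \<le> real T" using r T by auto
    then have "\<bar>- R.field (R.flow r x) q\<bar> \<le> L * (real q + 1)\<^sup>2" for q
      using L(2)[of r q] by simp
    then show ?thesis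
      unfolding f[OF n] G_def by (rule shell_norm_bound[OF n L(1)])
  qed
  have Hsp: "?f r \<in> Hsp k0 lam 0" "Hnorm k0 lam 0 (?f r) \<le> 8 * L * sqrt (weight 0)" "0 \<le> Hnorm k0 lam 0 (?f r)"
    if "r \<in> {s..t}" for r
    using Hsp_bound[of 0 "8 * L" "?f r"] f_bound[OF that] L(1) by auto
  have Hnorm_meas: "(\<lambda>r. Hnorm k0 lam 0 (?f r)) \<in> borel_measurable lborel"
  proof -
    have "(\<lambda>r. Hnorm k0 lam 0 (?f r)) = (\<lambda>r. sqrt (\<Sum>n. lambda_seq k0 lam (Suc n) powr 0 * (norm (G (Suc n) r))\<^sup>2))"
      by (simp add: Hnorm_def f)
    moreover have "G n \<in> borel_measurable borel" for n
      by (rule borel_measurable_continuous_onI) (rule G_cont)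
    ultimately show ?thesis by simp
  qed
  have integrable: "set_integrable lborel {s..t} (\<lambda>r. Hnorm k0 lam 0 (?f r))"
    unfolding set_integrable_def
  proof (rule Bochner_Integration.integrable_bound)
    show "integrable lborel (\<lambda>r. indicator {s..t} r *\<^sub>R (8 * L * sqrt (weight 0)))"
      using borel_integrable_atLeastAtMost'[of s t "\<lambda>_. 8 * L * sqrt (weight 0)"]
      by (simp add: set_integrable_def)
    show "(\<lambda>r. indicator {s..t} r *\<^sub>R Hnorm k0 lam 0 (?f r)) \<in> borel_measurable lborel"
      using Hnorm_meas by measurable
    show "AE r in lborel. norm (indicator {s..t} r *\<^sub>R Hnorm k0 lam 0 (?f r))
        \<le> norm (indicator {s..t} r *\<^sub>R (8 * L * sqrt (weight 0)))"
      using Hsp(3) by (auto simp: indicator_def intro!: AE_I2 order_trans[OF Hsp(2) abs_ge_self])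
  qed
  have integral: "set_integrable lborel {s..t} (\<lambda>r. ?f r n) \<and> ?u s n - ?u t n = (LINT r:{s..t}|lborel. ?f r n)"
    if n: "1 \<le> n" for n
  proof
    show "set_integrable lborel {s..t} (\<lambda>r. ?f r n)"
      unfolding f[OF n] by (rule borel_integrable_atLeastAtMost') (rule G_cont)
    have "(LINT r|lborel. indicator {s..t} r *\<^sub>R G n r) = - ?u t n - (- ?u s n)"
    proof (rule integral_FTC_atLeastAtMost[OF st _ G_cont])
      fix r
      show "((\<lambda>r. - ?u r n) has_vector_derivative G n r) (at r within {s..t})"
        using has_vector_derivative_minus[OF deriv[OF n, of r "{s..t}"]] by simp
    qed
    then show "?u s n - ?u t n = (LINT r:{s..t}|lborel. ?f r n)"
      unfolding f[OF n] set_lebesgue_integral_def by simp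
  qed
  show "\<exists>I. has_H_integral k0 lam ?f I s t \<and> (\<forall>n\<ge>1. ?u t n = ?u s n - I n)"
  proof (intro exI[of _ "\<lambda>n. ?u s n - ?u t n"] conjI)
    show "has_H_integral k0 lam ?f (\<lambda>n. ?u s n - ?u t n) s t"
      unfolding has_H_integral_def using Hsp(1) integrable integral by blast
  qed simp
qed

section \<open>The stationary process\<close>

text \<open>
  The sample space consists of the functions from \<open>\<real>\<close> to the states, with independent values of law
  \<open>gibbs\<close>. The value at 0 alone supplies the initial condition, and everything else is deterministic.
\<close>

theorem stationary_solution:
  "\<exists>(M :: (real \<Rightarrow> state) measure) (X :: real \<Rightarrow> (real \<Rightarrow> state) \<Rightarrow> state).
     prob_space M \<and> stationary_process M states X \<and>
     (\<forall>t. distr M states (X t) = gibbs k0 lam \<nu>) \<and>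
     (AE \<omega> in M. solves_inviscid k0 lam a b (\<lambda>t. X t \<omega>)) \<and>
     (AE \<omega> in M. \<forall>\<delta> \<alpha>. 0 \<le> \<delta> \<and> \<delta> < 1/2 \<and> \<alpha> < 1 \<longrightarrow>
        (\<lambda>t. X t \<omega>) \<in> holder_paths k0 lam \<delta> \<alpha>)"
proof -
  have shells_meas: "shells \<in> white_noise \<rightarrow>\<^sub>M states"
    using measurable_shells measurable_cong_sets[OF sets_white_noise refl] by blast
  have gibbs_prob: "prob_space (gibbs k0 lam \<nu>)"
    unfolding distr_shells[symmetric] by (rule white_noise.prob_space_distr[OF shells_meas])
  have gibbs_sets: "sets (gibbs k0 lam \<nu>) = sets states"
    unfolding distr_shells[symmetric] by simp
  define M :: "(real \<Rightarrow> state) measure" where "M = PiM UNIV (\<lambda>_. gibbs k0 lam \<nu>)"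
  define noise where "noise \<omega> = unshells (\<omega> 0)" for \<omega> :: "real \<Rightarrow> state"
  define X where "X t \<omega> = shells (R.flow t (noise \<omega>))" for t \<omega>
  have "prob_space M" unfolding M_def by (intro prob_space_PiM gibbs_prob)
  have comp: "(\<lambda>\<omega>. \<omega> 0) \<in> M \<rightarrow>\<^sub>M gibbs k0 lam \<nu>"
    unfolding M_def by (rule measurable_component_singleton) simp
  have unshells_meas: "unshells \<in> gibbs k0 lam \<nu> \<rightarrow>\<^sub>M white_noise"
    using measurable_unshells measurable_cong_sets[OF gibbs_sets refl] by blast
  have noise_meas: "noise \<in> M \<rightarrow>\<^sub>M white_noise"
    unfolding noise_def by (rule measurable_compose[OF comp unshells_meas])
  have noise: "distr M white_noise noise = white_noise"
  proof -
    have "distr M white_noise noise = distr (distr M (gibbs k0 lam \<nu>) (\<lambda>\<omega>. \<omega> 0)) white_noise unshells"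
      by (subst distr_distr[OF unshells_meas comp]) (simp add: noise_def[abs_def] comp_def)
    also have "distr M (gibbs k0 lam \<nu>) (\<lambda>\<omega>. \<omega> 0) = gibbs k0 lam \<nu>"
      unfolding M_def by (rule distr_PiM_component) (auto simp: gibbs_prob)
    finally show ?thesis by (simp add: distr_unshells)
  qed
  have flow_meas: "R.flow t \<in> white_noise \<rightarrow>\<^sub>M PiM UNIV (\<lambda>_. borel)" for t
    by (rule measurable_coordinatewise) (rule R.measurable_flow)
  have flow_shells_meas: "(\<lambda>x. shells (R.flow t x)) \<in> white_noise \<rightarrow>\<^sub>M states" for t
    by (rule measurable_compose[OF flow_meas measurable_shells])
  have X_meas: "X t \<in> M \<rightarrow>\<^sub>M states" for t
    unfolding X_def by (rule measurable_compose[OF noise_meas flow_shells_meas])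

  \<comment> \<open>All joint laws are images of the joint law of countably many times of the flow.\<close>
  have joint: "distr M (PiM J (\<lambda>_. states)) (\<lambda>\<omega>. \<lambda>t\<in>J. X (t + h) \<omega>)
      = distr (distr white_noise borel (\<lambda>x p. R.flow (from_nat_into J p) x)) (PiM J (\<lambda>_. states))
          (\<lambda>z. \<lambda>t\<in>J. shells (z (to_nat_on J t)))"
    if J: "finite J" for J h
  proof -
    let ?P = "PiM J (\<lambda>_. states)"
    let ?F = "\<lambda>z :: nat \<Rightarrow> nat \<Rightarrow> real. \<lambda>t\<in>J. shells (z (to_nat_on J t))"
    let ?flow = "\<lambda>h x p. R.flow (from_nat_into J p + h) x"
    have F: "?F \<in> borel \<rightarrow>\<^sub>M ?P"
    proof (intro measurable_restrict)
      fix t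
      have "(\<lambda>z :: nat \<Rightarrow> nat \<Rightarrow> real. z (to_nat_on J t)) \<in> borel \<rightarrow>\<^sub>M PiM UNIV (\<lambda>_. borel)"
      proof (rule measurable_coordinatewise)
        fix s
        show "(\<lambda>z :: nat \<Rightarrow> nat \<Rightarrow> real. z (to_nat_on J t) s) \<in> borel_measurable borel"
          by (rule borel_measurable_continuous_onI[OF continuous_on_product_then_coordinatewise[OF
                continuous_on_product_coordinates]])
      qed
      then show "(\<lambda>z. shells (z (to_nat_on J t))) \<in> borel \<rightarrow>\<^sub>M states"
        by (rule measurable_compose[OF _ measurable_shells])
    qed
    have flow_h: "?flow h \<in> white_noise \<rightarrow>\<^sub>M borel" for h
      by (rule R.measurable_flow_family)
    have "(\<lambda>\<omega>. \<lambda>t\<in>J. X (t + h) \<omega>) = (?F \<circ> ?flow h) \<circ> noise"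
    proof (rule ext)
      fix \<omega>
      show "(\<lambda>t\<in>J. X (t + h) \<omega>) = ((?F \<circ> ?flow h) \<circ> noise) \<omega>"
        unfolding comp_def X_def
        by (rule restrict_ext) (simp only: from_nat_into_to_nat_on[OF countable_finite[OF J]])
    qed
    then have "distr M ?P (\<lambda>\<omega>. \<lambda>t\<in>J. X (t + h) \<omega>) = distr (distr M white_noise noise) ?P (?F \<circ> ?flow h)"
      by (simp only: distr_distr[OF measurable_comp[OF flow_h F] noise_meas])
    also have "\<dots> = distr (distr white_noise borel (?flow h)) ?P ?F"
      by (simp only: noise distr_distr[OF F flow_h])
    also have "distr white_noise borel (?flow h) = distr white_noise borel (\<lambda>x p. R.flow (from_nat_into J p) x)"
      by (rule R.flow_stationary)
    finally show ?thesis .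
  qed
  have "stationary_process M states X"
    unfolding stationary_process_def
  proof (intro conjI allI impI)
    fix J :: "real set" and h assume "finite J"
    from joint[OF this, of h] joint[OF this, of 0]
    show "distr M (PiM J (\<lambda>_. states)) (\<lambda>\<omega>. \<lambda>t\<in>J. X (t + h) \<omega>)
        = distr M (PiM J (\<lambda>_. states)) (\<lambda>\<omega>. \<lambda>t\<in>J. X t \<omega>)" by simp
  qed (rule X_meas)
  moreover have "distr M states (X t) = gibbs k0 lam \<nu>" for t
  proof -
    have proj: "(\<lambda>z. z t) \<in> PiM {t} (\<lambda>_. states) \<rightarrow>\<^sub>M states" for t :: real
      by (rule measurable_component_singleton) simp
    have X_one: "distr M states (X (t + h)) = distr (distr M (PiM {t} (\<lambda>_. states)) (\<lambda>\<omega>. \<lambda>t\<in>{t}. X (t + h) \<omega>)) states (\<lambda>z. z t)" for t h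
      using X_meas by (subst distr_distr[OF proj]) (auto simp: comp_def intro!: measurable_restrict)
    have "distr M states (X t) = distr M states (X (0 + t))" by simp
    also have "\<dots> = distr M states (X (0 + 0))"
      unfolding X_one joint[OF finite.insertI[OF finite.emptyI]] ..
    also have "X (0 + 0) = shells \<circ> noise"
      by (auto simp: X_def R.flow_0)
    also have "distr M states (shells \<circ> noise) = distr (distr M white_noise noise) states shells"
      by (rule distr_distr[OF shells_meas noise_meas, symmetric])
    finally show ?thesis by (simp only: noise distr_shells)
  qed
  moreover have "AE \<omega> in M. R.regular (noise \<omega>)"
  proof (rule AE_distrD[OF noise_meas])
    show "AE x in distr M white_noise noise. R.regular x"
      unfolding noise by (rule R.AE_regular)
  qed
  then have "AE \<omega> in M. solves_inviscid k0 lam a b (\<lambda>t. X t \<omega>)"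
    "AE \<omega> in M. \<forall>\<delta> \<alpha>. 0 \<le> \<delta> \<and> \<delta> < 1/2 \<and> \<alpha> < 1 \<longrightarrow> (\<lambda>t. X t \<omega>) \<in> holder_paths k0 lam \<delta> \<alpha>"
    unfolding X_def by (auto elim!: eventually_mono intro: path_solves path_holder)
  ultimately show ?thesis
    using \<open>prob_space M\<close> by blast
qed

end

theorem theorem5p2:
  fixes k0 lam a b \<nu> :: real
  assumes "k0 > 0" and "lam > 1"
    and "a + b * lam^2 = (a + b) * lam^4"
    and "\<nu> > 0"
  shows "\<exists>(M :: (real \<Rightarrow> state) measure) (X :: real \<Rightarrow> (real \<Rightarrow> state) \<Rightarrow> state).
           prob_space M \<and>
           stationary_process M states X \<and>
           (\<forall>t. distr M states (X t) = gibbs k0 lam \<nu>) \<and>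
           (AE \<omega> in M. solves_inviscid k0 lam a b (\<lambda>t. X t \<omega>)) \<and>
           (AE \<omega> in M. \<forall>\<delta> \<alpha>. 0 \<le> \<delta> \<and> \<delta> < 1/2 \<and> \<alpha> < 1 \<longrightarrow>
              (\<lambda>t. X t \<omega>) \<in> holder_paths k0 lam \<delta> \<alpha>)"
proof -
  interpret sabra k0 lam a b \<nu> using assms by unfold_locales
  show ?thesis by (rule stationary_solution)
qed

end
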